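(* Let $A$ be a self-adjoint operator and let $U$ be a unitary operator on a Hilbert space. Then $$\left\|\sum_{k=0}^m(-1)^k\binom mk f\big(e^{\mathrm ikA}U\big)\right\|\le d^m\,\|e^{\mathrm iA}-I\|^m\le d^m\|A\|^m$$ for every positive integer $m$ and every trigonometric polynomial $f$ of degree at most $d$ with $|f|\le1$ on $\mathbb T$.
   Context: $\mathbb T$ is the unit circle in $\mathbb C$. A trigonometric polynomial of degree at most $d$ is a function $f(\zeta)=\sum_{k=-d}^d a_k\zeta^k$, $\zeta\in\mathbb T$, with $a_k\in\mathbb C$; $f(W)=\sum_{k=-d}^d a_kW^k$ for unitary $W$. If $A$ is unbounded, $\|A\|$ is understood as $\infty$. *)

theory Defs
  imports "HOL-Analysis.Analysis"
begin

section \<open>Complex Hilbert spaces\<close>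

text \<open>
  A complex inner product space is carried by a real one: the real scalar product is the
  restriction of the complex one and the real inner product is its real part, so that norm and
  topology are those of the library.  The form \<open>cinner\<close> is linear in the first argument.
\<close>

class complex_inner = real_inner +
  fixes scaleC :: "complex \<Rightarrow> 'a \<Rightarrow> 'a"  (infixr \<open>*\<^sub>C\<close> 75)
    and cinner :: "'a \<Rightarrow> 'a \<Rightarrow> complex"
  assumes scaleC_add_right: "c *\<^sub>C (x + y) = c *\<^sub>C x + c *\<^sub>C y"
    and scaleC_add_left: "(b + c) *\<^sub>C x = b *\<^sub>C x + c *\<^sub>C x"
    and scaleC_scaleC: "b *\<^sub>C c *\<^sub>C x = (b * c) *\<^sub>C x"
    and scaleR_scaleC: "r *\<^sub>R x = complex_of_real r *\<^sub>C x"
    and cinner_commute: "cinner x y = cnj (cinner y x)"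
    and cinner_add_left: "cinner (x + y) z = cinner x z + cinner y z"
    and cinner_scaleC_left: "cinner (c *\<^sub>C x) y = c * cinner x y"
    and inner_eq_Re_cinner: "inner x y = Re (cinner x y)"

class chilbert_space = complex_inner + complete_space

instantiation complex :: chilbert_space
begin

definition scaleC_complex :: "complex \<Rightarrow> complex \<Rightarrow> complex"
  where "scaleC_complex c x = c * x"

definition cinner_complex :: "complex \<Rightarrow> complex \<Rightarrow> complex"
  where "cinner_complex x y = x * cnj y"

instance
  by standard
    (simp_all add: scaleC_complex_def cinner_complex_def algebra_simps inner_complex_def scaleR_conv_of_real)

end


section \<open>Operators\<close>

definition clinear_on :: "'a::complex_inner set \<Rightarrow> ('a \<Rightarrow> 'a) \<Rightarrow> bool"
  where "clinear_on D T \<longleftrightarrow>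
    0 \<in> D \<and> (\<forall>x\<in>D. \<forall>y\<in>D. x + y \<in> D \<and> T (x + y) = T x + T y) \<and>
    (\<forall>c. \<forall>x\<in>D. c *\<^sub>C x \<in> D \<and> T (c *\<^sub>C x) = c *\<^sub>C T x)"

text \<open>
  A possibly unbounded operator is a map \<open>A\<close> together with its domain \<open>D\<close>; the values of \<open>A\<close>
  outside \<open>D\<close> play no role.  The left-hand side of the equivalence below says that \<open>(y, z)\<close> lies in
  the graph of the adjoint of \<open>A\<close>, so the equivalence says that \<open>A\<close> and its adjoint have the same
  graph, including the equality of the domains.
\<close>

definition self_adjoint :: "'a::complex_inner set \<Rightarrow> ('a \<Rightarrow> 'a) \<Rightarrow> bool"
  where "self_adjoint D A \<longleftrightarrow>
    clinear_on D A \<and> closure D = UNIV \<and>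
    (\<forall>y z. (\<forall>x\<in>D. cinner (A x) y = cinner x z) \<longleftrightarrow> y \<in> D \<and> z = A y)"

definition unitary :: "('a::complex_inner \<Rightarrow> 'a) \<Rightarrow> bool"
  where "unitary U \<longleftrightarrow>
    clinear_on UNIV U \<and> surj U \<and> (\<forall>x y. cinner (U x) (U y) = cinner x y)"

definition orthogonal_projection :: "('a::complex_inner \<Rightarrow> 'a) \<Rightarrow> bool"
  where "orthogonal_projection P \<longleftrightarrow>
    clinear_on UNIV P \<and> P \<circ> P = P \<and> (\<forall>x y. cinner (P x) y = cinner x (P y))"

text \<open>The operator norm, which is \<open>\<infinity>\<close> for an unbounded operator.\<close>

definition opnorm :: "'a::complex_inner set \<Rightarrow> ('a \<Rightarrow> 'a) \<Rightarrow> ennreal"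
  where "opnorm D A = (SUP x\<in>{x\<in>D. norm x \<le> 1}. ennreal (norm (A x)))"


section \<open>Spectral measures and functions of a self-adjoint operator\<close>

definition projection_valued_measure :: "(real set \<Rightarrow> 'a::complex_inner \<Rightarrow> 'a) \<Rightarrow> bool"
  where "projection_valued_measure E \<longleftrightarrow>
    (\<forall>B\<in>sets borel. orthogonal_projection (E B)) \<and>
    E {} = (\<lambda>x. 0) \<and> E UNIV = id \<and>
    (\<forall>B\<in>sets borel. \<forall>C\<in>sets borel. E (B \<inter> C) = E B \<circ> E C) \<and>
    (\<forall>F x. range F \<subseteq> sets borel \<longrightarrow> disjoint_family F \<longrightarrow>
      (\<lambda>n::nat. E (F n) x) sums E (\<Union>n. F n) x)"

definition scalar_spectral_measure ::
    "(real set \<Rightarrow> 'a::complex_inner \<Rightarrow> 'a) \<Rightarrow> 'a \<Rightarrow> real measure"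
  where "scalar_spectral_measure E x =
    measure_of UNIV (sets borel) (\<lambda>B. ennreal (Re (cinner (E B x) x)))"

text \<open>
  The operator \<open>T\<close> with domain \<open>D\<close> is \<open>\<integral> g dE\<close>: the domain consists of the vectors \<open>x\<close> for which \<open>g\<close>
  is square integrable with respect to the scalar measure \<open>\<mu>\<^sub>x = \<langle>E(\<cdot>)x, x\<rangle>\<close>, and
  \<open>\<langle>T x, x\<rangle> = \<integral> g d\<mu>\<^sub>x\<close> there.  By polarization the linear map \<open>T\<close> is determined on \<open>D\<close>.
\<close>

definition is_spectral_integral ::
    "(real set \<Rightarrow> 'a::complex_inner \<Rightarrow> 'a) \<Rightarrow> (real \<Rightarrow> complex) \<Rightarrow> 'a set \<Rightarrow> ('a \<Rightarrow> 'a) \<Rightarrow> bool"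
  where "is_spectral_integral E g D T \<longleftrightarrow>
    clinear_on D T \<and>
    D = {x. integrable (scalar_spectral_measure E x) (\<lambda>t. (cmod (g t))\<^sup>2)} \<and>
    (\<forall>x\<in>D. cinner (T x) x = (LINT t|scalar_spectral_measure E x. g t))"

text \<open>
  The spectral measure of a self-adjoint operator, which exists and is unique on the Borel sets by
  the spectral theorem (outside the Borel sets its values are irrelevant).
\<close>

definition spectral_measure ::
    "'a::chilbert_space set \<Rightarrow> ('a \<Rightarrow> 'a) \<Rightarrow> real set \<Rightarrow> 'a \<Rightarrow> 'a"
  where "spectral_measure D A =
    (SOME E. projection_valued_measure E \<and> is_spectral_integral E complex_of_real D A)"

text \<open>The bounded operator \<open>g(A) = \<integral> g dE\<close> for a bounded Borel function \<open>g\<close>.\<close>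

definition bounded_borel_calculus ::
    "(real \<Rightarrow> complex) \<Rightarrow> 'a::chilbert_space set \<Rightarrow> ('a \<Rightarrow> 'a) \<Rightarrow> 'a \<Rightarrow> 'a"
  where "bounded_borel_calculus g D A =
    (THE T. is_spectral_integral (spectral_measure D A) g UNIV T)"

text \<open>The unitary operator \<open>exp (i s A)\<close>.\<close>

definition exp_i :: "real \<Rightarrow> 'a::chilbert_space set \<Rightarrow> ('a \<Rightarrow> 'a) \<Rightarrow> 'a \<Rightarrow> 'a"
  where "exp_i s = bounded_borel_calculus (\<lambda>t. exp (\<i> * complex_of_real (s * t)))"


section \<open>Trigonometric polynomials\<close>

definition op_powi :: "('a \<Rightarrow> 'a) \<Rightarrow> int \<Rightarrow> 'a \<Rightarrow> 'a"
  where "op_powi W k = (if k \<ge> 0 then W ^^ nat k else inv W ^^ nat (- k))"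

definition trig_poly :: "nat \<Rightarrow> (int \<Rightarrow> complex) \<Rightarrow> complex \<Rightarrow> complex"
  where "trig_poly d a \<zeta> = (\<Sum>k = - int d..int d. a k * \<zeta> powi k)"

definition trig_poly_op ::
    "nat \<Rightarrow> (int \<Rightarrow> complex) \<Rightarrow> ('a::complex_inner \<Rightarrow> 'a) \<Rightarrow> 'a \<Rightarrow> 'a"
  where "trig_poly_op d a W x = (\<Sum>k = - int d..int d. a k *\<^sub>C op_powi W k x)"

end

theory Submission
  imports Defs "HOL-Probability.Helly_Selection"
begin

text \<open>
  The operator \<open>e\<^bsup>iA\<^esup>\<close> is defined through the spectral measure of \<open>A\<close>, whose existence is derived from
  the Cayley transform \<open>W = (A - i) (A + i)\<^bsup>-1\<^esup>\<close>: Helly selection applied to Fejer densities gives the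
  scalar spectral measures of the unitary operator \<open>W\<close>, and an operator is attached to every bounded
  Borel function by closing the trigonometric polynomials in \<open>W\<close> under bounded pointwise limits.

  For the inequality, write \<open>\<parallel>e\<^bsup>iA\<^esup> - 1\<parallel> = 2 sin (\<sigma> / 2)\<close> with \<open>0 \<le> \<sigma> \<le> \<pi>\<close>.  At integer multiples of
  \<open>A\<close> one may replace \<open>A\<close> by an operator \<open>B\<close> with \<open>\<parallel>B\<parallel> \<le> \<sigma>\<close> and then approximate \<open>B\<close> by operators
  whose spectrum lies in a grid, so that \<open>\<tau> \<mapsto> f (e\<^bsup>i\<tau>B\<^esup> U) x\<close> is a vector-valued trigonometric
  polynomial bounded by \<open>\<parallel>x\<parallel>\<close> with frequencies of modulus at most \<open>d \<sigma>\<close>.  The sharp Bernstein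
  inequality for finite differences bounds its \<open>m\<close>-th difference with step \<open>1\<close> by
  \<open>(2 sin (d \<sigma> / 2))\<^sup>m \<parallel>x\<parallel> \<le> (2 d sin (\<sigma> / 2))\<^sup>m \<parallel>x\<parallel>\<close> if \<open>d \<sigma> \<le> \<pi>\<close>, and otherwise the trivial bound
  \<open>2\<^sup>m \<parallel>x\<parallel>\<close> suffices.
\<close>

section \<open>Complex inner product spaces\<close>

text \<open>\<open>A\<close> and \<open>U\<close> need not commute, so \<open>f (e^(ikA) U)\<close>
  is not a function of a single spectral variable. What survives is the dependence on a real
  parameter: if \<open>B\<close> has finitely many spectral values, \<open>e^(i\<tau>B)\<close> is a
  finite sum of exponentials in \<open>\<tau>\<close> with operator coefficients, and so is every
  word in it and \<open>U\<close>, whatever the order of the factors. For each fixed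
  \<open>\<tau>\<close> the operator \<open>e^(i\<tau>B) U\<close> is unitary, and the von Neumann
  inequality supplies the bound by \<open>\<parallel>x\<parallel>\<close>. Passing from
  \<open>A\<close> to \<open>B\<close> is legitimate because only integer \<open>k\<close> occur, so
  the spectrum matters modulo \<open>2 \<pi>\<close> only. Measuring \<open>e^(iA) - 1\<close> by
  the angle \<open>\<sigma>\<close> rather than by its chord keeps the difference inequality sharp;
  the factor \<open>d\<close> appears only at the end, through
  \<open>sin (d y) \<le> d sin y\<close>. The same inequality at \<open>y = \<pi> / (2 d)\<close>
  shows that \<open>2\<close> is at most \<open>d\<close> times the chord once
  \<open>d \<sigma> > \<pi>\<close>. The second inequality of the theorem is
  \<open>|e^(it) - 1| \<le> |t|\<close> on the spectrum of \<open>A\<close>.\<close>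

lemma scaleC_one [simp]: "1 *\<^sub>C (x::'a::complex_inner) = x"
  using scaleR_scaleC[of 1 x] by simp

lemma scaleC_zero_left [simp]: "0 *\<^sub>C (x::'a::complex_inner) = 0"
  using scaleR_scaleC[of 0 x] by simp

lemma scaleC_minus_one: "(-1) *\<^sub>C (x::'a::complex_inner) = - x"
  using scaleR_scaleC[of "-1" x] by simp

lemma cinner_self: "cinner x x = complex_of_real ((norm x)\<^sup>2)"
proof -
  have "Im (cinner x x) = 0"
    using arg_cong[OF cinner_commute[of x x], of Im] by simp
  moreover have "Re (cinner x x) = (norm x)\<^sup>2"
    by (simp add: inner_eq_Re_cinner[symmetric] power2_norm_eq_inner)
  ultimately show ?thesis by (simp add: complex_eq_iff)
qed

lemma norm_scaleC: "norm (c *\<^sub>C x) = cmod c * norm (x::'a::complex_inner)"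
proof -
  have "cinner (c *\<^sub>C x) (c *\<^sub>C x) = c * cnj (c * cinner x x)"
    by (subst cinner_scaleC_left, subst cinner_commute, subst cinner_scaleC_left) simp
  also have "\<dots> = complex_of_real ((cmod c * norm x)\<^sup>2)"
    unfolding cinner_self power_mult_distrib of_real_mult complex_norm_square by simp
  finally have "complex_of_real ((norm (c *\<^sub>C x))\<^sup>2) = complex_of_real ((cmod c * norm x)\<^sup>2)"
    by (simp only: cinner_self)
  then have "(norm (c *\<^sub>C x))\<^sup>2 = (cmod c * norm x)\<^sup>2"
    using of_real_eq_iff by blast
  then show ?thesis by (metis norm_ge_zero power2_eq_iff_nonneg mult_nonneg_nonneg)
qed

lemma cinner_add_right: "cinner x (y + z) = cinner x y + cinner x z"
  by (subst cinner_commute, subst cinner_add_left)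
    (simp add: cinner_commute[of y x] cinner_commute[of z x])

lemma cinner_scaleC_right: "cinner x (c *\<^sub>C y) = cnj c * cinner x y"
  by (subst cinner_commute, subst cinner_scaleC_left) (simp add: cinner_commute[of y x])

text \<open>A unimodular factor \<open>c\<close> rotates the product onto the positive real axis,
  where it equals the real inner product and the real Cauchy-Schwarz inequality applies.\<close>

lemma cmod_cinner_le: "cmod (cinner x y) \<le> norm x * norm y"
proof (cases "cinner x y = 0")
  case False
  define c where "c = cnj (cinner x y) / cmod (cinner x y)"
  have c: "cmod c = 1" "c * cinner x y = cmod (cinner x y)"
    using False complex_norm_square[of "cinner x y"]
    by (auto simp: c_def norm_divide field_simps power2_eq_square)
  have "cmod (cinner x y) = Re (cinner (c *\<^sub>C x) y)"
    by (simp add: cinner_scaleC_left c(2))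
  also have "\<dots> = inner (c *\<^sub>C x) y" by (simp add: inner_eq_Re_cinner)
  also have "\<dots> \<le> norm (c *\<^sub>C x) * norm y" by (rule norm_cauchy_schwarz)
  finally show ?thesis by (simp add: norm_scaleC c)
qed simp

lemma bounded_bilinear_cinner: "bounded_bilinear (cinner :: 'a::complex_inner \<Rightarrow> _)"
proof
  show "\<exists>K. \<forall>a b::'a. cmod (cinner a b) \<le> norm a * norm b * K"
    by (rule exI[of _ 1]) (auto intro: cmod_cinner_le)
qed (simp_all add: cinner_add_left cinner_add_right scaleR_scaleC cinner_scaleC_left
    cinner_scaleC_right scaleR_conv_of_real scaleC_complex_def)

lemma bounded_bilinear_scaleC: "bounded_bilinear (scaleC :: _ \<Rightarrow> 'a::complex_inner \<Rightarrow> 'a)"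
proof
  show "\<exists>K. \<forall>a (b::'a). norm (a *\<^sub>C b) \<le> norm a * norm b * K"
    by (rule exI[of _ 1]) (auto simp: norm_scaleC)
qed (simp_all add: scaleC_add_left scaleC_add_right scaleC_scaleC scaleR_conv_of_real
    scaleR_scaleC[where 'a='a] mult.commute)

interpretation cinner: bounded_bilinear "cinner :: 'a::complex_inner \<Rightarrow> 'a \<Rightarrow> complex"
  by (rule bounded_bilinear_cinner)

interpretation scaleC: bounded_bilinear "scaleC :: complex \<Rightarrow> 'a::complex_inner \<Rightarrow> 'a"
  by (rule bounded_bilinear_scaleC)

lemma clinear_on_UNIV_iff:
  "clinear_on UNIV T \<longleftrightarrow> (\<forall>x y. T (x + y) = T x + T y) \<and> (\<forall>c x. T (c *\<^sub>C x) = c *\<^sub>C T x)"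
  by (simp add: clinear_on_def)

lemma clinear_on_add: "clinear_on D T \<Longrightarrow> x \<in> D \<Longrightarrow> y \<in> D \<Longrightarrow> T (x + y) = T x + T y"
  and clinear_on_scaleC: "clinear_on D T \<Longrightarrow> x \<in> D \<Longrightarrow> T (c *\<^sub>C x) = c *\<^sub>C T x"
  and clinear_on_mem_add: "clinear_on D T \<Longrightarrow> x \<in> D \<Longrightarrow> y \<in> D \<Longrightarrow> x + y \<in> D"
  and clinear_on_mem_scaleC: "clinear_on D T \<Longrightarrow> x \<in> D \<Longrightarrow> c *\<^sub>C x \<in> D"
  and clinear_on_mem_zero: "clinear_on D T \<Longrightarrow> 0 \<in> D"
  by (auto simp: clinear_on_def)

lemma clinear_on_minus: "clinear_on D T \<Longrightarrow> x \<in> D \<Longrightarrow> T (- x) = - T x"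
  using clinear_on_scaleC[of D T x "-1"] by (simp add: scaleC_minus_one)

lemma clinear_on_mem_minus: "clinear_on D T \<Longrightarrow> x \<in> D \<Longrightarrow> - x \<in> D"
  using clinear_on_mem_scaleC[of D T x "-1"] by (simp add: scaleC_minus_one)

lemma clinear_on_mem_diff: "clinear_on D T \<Longrightarrow> x \<in> D \<Longrightarrow> y \<in> D \<Longrightarrow> x - y \<in> D"
  using clinear_on_mem_add[of D T x "-y"] clinear_on_mem_minus[of D T y] by simp

lemma clinear_on_diff: "clinear_on D T \<Longrightarrow> x \<in> D \<Longrightarrow> y \<in> D \<Longrightarrow> T (x - y) = T x - T y"
  using clinear_on_add[of D T x "-y"] clinear_on_mem_minus[of D T y] clinear_on_minus[of D T y]
  by simp

lemma clinear_on_zero: "clinear_on D T \<Longrightarrow> T 0 = 0"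
  using clinear_on_scaleC[of D T 0 0] clinear_on_mem_zero[of D T] by simp

lemma clinear_on_tendsto:
  assumes T: "clinear_on UNIV T" and K: "\<And>x. norm (T x) \<le> K * norm x"
    and f: "(f \<longlongrightarrow> l) F"
  shows "((\<lambda>n. T (f n)) \<longlongrightarrow> T l) F"
proof (rule tendsto_dist_iff[THEN iffD2])
  have "((\<lambda>n. \<bar>K\<bar> * dist (f n) l) \<longlongrightarrow> \<bar>K\<bar> * 0) F"
    using f by (intro tendsto_intros) (simp add: tendsto_dist_iff[symmetric])
  then have 1: "((\<lambda>n. \<bar>K\<bar> * dist (f n) l) \<longlongrightarrow> 0) F" by simp
  have "dist (T (f n)) (T l) \<le> \<bar>K\<bar> * dist (f n) l" for n
    using order_trans[OF K[of "f n - l"] mult_right_mono[of K "\<bar>K\<bar>" "norm (f n - l)"]]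
    by (simp add: dist_norm clinear_on_diff[OF T])
  then show "((\<lambda>n. dist (T (f n)) (T l)) \<longlongrightarrow> 0) F"
    by (intro Lim_null_comparison[OF always_eventually 1]) auto
qed

text \<open>Complex polarization: the form of the difference \<open>R\<close> vanishes at
  \<open>x + y\<close> and at \<open>x + \<i> *\<^sub>C y\<close>, and these two relations
  annihilate \<open>cinner (R x) y\<close>. This makes a spectral integral unique although only its
  quadratic form is prescribed.\<close>

lemma clinear_on_eqI:
  assumes S: "clinear_on UNIV S" and T: "clinear_on UNIV T"
    and eq: "\<And>x. cinner (S x) x = cinner (T x) x"
  shows "S = T"
proof
  fix x
  define R where "R = (\<lambda>x. S x - T x)"
  have R: "clinear_on UNIV R"
    unfolding clinear_on_UNIV_iff R_def
    by (simp add: clinear_on_add[OF S] clinear_on_add[OF T] clinear_on_scaleC[OF S]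
        clinear_on_scaleC[OF T] scaleC.diff_right)
  have q: "cinner (R x) x = 0" for x by (simp add: R_def cinner.diff_left eq)
  have 1: "cinner (R x) y + cinner (R y) x = 0" for x y
    using q[of "x + y"] q[of x] q[of y]
    by (simp add: clinear_on_add[OF R] cinner_add_left cinner_add_right add.commute)
  have 2: "cinner (R x) y = 0" for x y
  proof -
    have "- \<i> * cinner (R x) y + \<i> * cinner (R y) x = 0"
      using 1[of x "\<i> *\<^sub>C y"]
      by (simp add: clinear_on_scaleC[OF R] cinner_scaleC_left cinner_scaleC_right)
    then have "cinner (R y) x = cinner (R x) y" by simp
    with 1[of x y] show ?thesis by simp
  qed
  have "R x = 0" using 2[of x "R x"] by (simp add: cinner_self)
  then show "S x = T x" by (simp add: R_def)
qed

text \<open>The vector is the difference of \<open>z\<close> and its nearest point in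
  \<open>S\<close>. A minimizing sequence converges by the parallelogram law, and minimality forces
  orthogonality.\<close>

lemma closed_subspace_orthogonal_vector:
  fixes S :: "'a::chilbert_space set"
  assumes cl: "closed S" and ne: "0 \<in> S" and add: "\<And>x y. x \<in> S \<Longrightarrow> y \<in> S \<Longrightarrow> x + y \<in> S"
    and sc: "\<And>c x. x \<in> S \<Longrightarrow> c *\<^sub>C x \<in> S" and z: "z \<notin> S"
  obtains y where "y \<noteq> 0" "\<And>x. x \<in> S \<Longrightarrow> cinner x y = 0"
proof -
  have scR: "r *\<^sub>R x \<in> S" if "x \<in> S" for r x using sc[OF that] by (simp add: scaleR_scaleC)
  define \<delta> where "\<delta> = infdist z S"
  have S0: "S \<noteq> {}" using ne by auto
  have \<delta>_le: "\<delta> \<le> norm (z - x)" if "x \<in> S" for x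
    using infdist_le[OF that, of z] by (simp add: \<delta>_def dist_norm)
  have \<delta>0: "\<delta> \<ge> 0" by (simp add: \<delta>_def infdist_nonneg)
  have "\<exists>x\<in>S. norm (z - x) < \<delta> + 1 / Suc n" for n
  proof -
    have "Inf (dist z ` S) < \<delta> + 1 / Suc n" using S0 by (simp add: \<delta>_def infdist_def)
    then show ?thesis
      using S0 cInf_lessD[of "dist z ` S"] by (force simp: dist_norm)
  qed
  then obtain u where uS: "\<And>n. u n \<in> S" and u: "\<And>n. norm (z - u n) < \<delta> + 1 / Suc n" by metis
  \<comment> \<open>Parallelogram law for \<open>z - x\<close> and \<open>z - y\<close>; the
    midpoint of \<open>x\<close> and \<open>y\<close> lies in \<open>S\<close>, hence at distance at
    least \<open>\<delta>\<close> from \<open>z\<close>.\<close>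
  have par: "(norm (x - y))\<^sup>2 \<le> 2 * ((norm (z - x))\<^sup>2 - \<delta>\<^sup>2) + 2 * ((norm (z - y))\<^sup>2 - \<delta>\<^sup>2)"
    if "x \<in> S" "y \<in> S" for x y
  proof -
    have m: "(1/2) *\<^sub>R (x + y) \<in> S" using that by (intro scR add)
    have "(norm (x - y))\<^sup>2 + (norm (2 *\<^sub>R (z - (1/2) *\<^sub>R (x + y))))\<^sup>2
        = 2 * (norm (z - x))\<^sup>2 + 2 * (norm (z - y))\<^sup>2"
      by (simp add: power2_norm_eq_inner algebra_simps inner_commute)
    moreover have "(norm (2 *\<^sub>R (z - (1/2) *\<^sub>R (x + y))))\<^sup>2 \<ge> 4 * \<delta>\<^sup>2"
      using power_mono[OF \<delta>_le[OF m] \<delta>0, of 2] by (simp only: norm_scaleR power_mult_distrib) simp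
    ultimately show ?thesis by (simp add: algebra_simps)
  qed
  have lim: "(\<lambda>n. norm (z - u n)) \<longlonglongrightarrow> \<delta>"
  proof (rule tendsto_sandwich[OF _ _ tendsto_const])
    show "(\<lambda>n. \<delta> + 1 / Suc n) \<longlonglongrightarrow> \<delta>"
      using tendsto_add[OF tendsto_const[of \<delta>] LIMSEQ_inverse_real_of_nat] by (simp add: divide_inverse)
  qed (use \<delta>_le uS u[THEN less_imp_le] in \<open>auto intro!: always_eventually\<close>)
  have lim2: "(\<lambda>n. 2 * ((norm (z - u n))\<^sup>2 - \<delta>\<^sup>2)) \<longlonglongrightarrow> 0"
    by (rule tendsto_eq_rhs[OF tendsto_mult[OF tendsto_const tendsto_diff[OF tendsto_power[OF lim] tendsto_const]]]) simp
  have "Cauchy u"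
  proof (rule metric_CauchyI)
    fix e :: real assume e: "e > 0"
    then have "eventually (\<lambda>n. 2 * ((norm (z - u n))\<^sup>2 - \<delta>\<^sup>2) < e\<^sup>2 / 2) sequentially"
      by (intro order_tendstoD(2)[OF lim2]) simp
    then obtain N where N: "\<And>n. n \<ge> N \<Longrightarrow> 2 * ((norm (z - u n))\<^sup>2 - \<delta>\<^sup>2) < e\<^sup>2 / 2"
      by (auto simp: eventually_sequentially)
    have "dist (u m) (u n) < e" if "m \<ge> N" "n \<ge> N" for m n
    proof -
      have "(norm (u m - u n))\<^sup>2 < e\<^sup>2" using par[OF uS[of m] uS[of n]] N[OF that(1)] N[OF that(2)] by linarith
      then show ?thesis using e by (simp add: dist_norm power_less_imp_less_base)
    qed
    then show "\<exists>M. \<forall>m\<ge>M. \<forall>n\<ge>M. dist (u m) (u n) < e" by blast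
  qed
  then obtain p where p: "u \<longlonglongrightarrow> p" using Cauchy_convergent convergent_def by blast
  have pS: "p \<in> S" using cl p uS closed_sequentially by blast
  have "(\<lambda>n. norm (z - u n)) \<longlonglongrightarrow> norm (z - p)" by (intro tendsto_intros p)
  then have np: "norm (z - p) = \<delta>" using lim LIMSEQ_unique by blast
  define y where "y = z - p"
  have re: "inner x y = 0" if x: "x \<in> S" for x
  proof (rule ccontr)
    assume a: "inner x y \<noteq> 0"
    then have x0: "x \<noteq> 0" by auto
    \<comment> \<open>The minimizer of the quadratic function
      \<open>r \<mapsto> \<parallel>y - r x\<parallel>\<^sup>2\<close>, whose minimum would lie
      strictly below \<open>\<delta>\<^sup>2\<close>.\<close>
    define r where "r = inner x y / (norm x)\<^sup>2"
    have "\<delta>\<^sup>2 \<le> (norm (z - (p + r *\<^sub>R x)))\<^sup>2"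
      by (intro power_mono \<delta>_le add pS scR x \<delta>0)
    also have "\<dots> = (norm (y - r *\<^sub>R x))\<^sup>2" by (simp add: y_def algebra_simps)
    also have "\<dots> = \<delta>\<^sup>2 - 2 * r * inner x y + r\<^sup>2 * (norm x)\<^sup>2"
      unfolding np[symmetric] y_def[symmetric] power2_norm_eq_inner
      by (simp add: algebra_simps inner_commute power2_eq_square)
    also have "\<dots> = \<delta>\<^sup>2 - (inner x y)\<^sup>2 / (norm x)\<^sup>2"
      using x0 by (simp add: r_def field_simps power2_eq_square)
    finally show False using a x0 by (simp add: field_simps)
  qed
  show ?thesis
  proof (rule that)
    show "y \<noteq> 0" using pS z by (auto simp: y_def)
    fix x assume x: "x \<in> S"
    have "Re (cinner x y) = 0" using re[OF x] by (simp add: inner_eq_Re_cinner)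
    moreover have "Re (cinner (\<i> *\<^sub>C x) y) = 0" using re[OF sc[OF x]] by (simp add: inner_eq_Re_cinner)
    ultimately show "cinner x y = 0" by (simp add: cinner_scaleC_left complex_eq_iff)
  qed
qed

section \<open>Unitary operators\<close>

lemma unitary_linear: "unitary U \<Longrightarrow> clinear_on UNIV U"
  and unitary_surj: "unitary U \<Longrightarrow> surj U"
  and unitary_cinner: "unitary U \<Longrightarrow> cinner (U x) (U y) = cinner x y"
  by (auto simp: unitary_def)

lemma unitary_norm:
  assumes "unitary U" shows "norm (U x) = norm x"
proof -
  have "(norm (U x))\<^sup>2 = (norm x)\<^sup>2"
    using unitary_cinner[OF assms, of x x] unfolding cinner_self of_real_eq_iff .
  then show ?thesis by simp
qed

lemma unitary_inj:
  assumes "unitary U" shows "inj U"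
proof (rule injI)
  fix x y assume "U x = U y"
  then have "norm (U (x - y)) = 0" by (simp add: clinear_on_diff[OF unitary_linear[OF assms]])
  then show "x = y" by (simp add: unitary_norm[OF assms])
qed

lemma unitary_bij: "unitary U \<Longrightarrow> bij U"
  by (simp add: bij_def unitary_inj unitary_surj)

lemma unitary_inv_right: "unitary U \<Longrightarrow> U (inv U x) = x"
  by (simp add: surj_f_inv_f unitary_surj)

lemma unitary_inv:
  assumes "unitary U" shows "unitary (inv U)"
  unfolding unitary_def
proof (intro conjI allI)
  have L: "clinear_on UNIV U" by (rule unitary_linear[OF assms])
  have "inv U (x + y) = inv U x + inv U y" for x y
    by (rule injD[OF unitary_inj[OF assms]])
      (simp add: clinear_on_add[OF L] unitary_inv_right[OF assms])
  moreover have "inv U (c *\<^sub>C x) = c *\<^sub>C inv U x" for c x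
    by (rule injD[OF unitary_inj[OF assms]])
      (simp add: clinear_on_scaleC[OF L] unitary_inv_right[OF assms])
  ultimately show "clinear_on UNIV (inv U)" by (simp add: clinear_on_UNIV_iff)
  show "surj (inv U)" by (simp add: assms bij_imp_bij_inv bij_is_surj unitary_bij)
  show "cinner (inv U x) (inv U y) = cinner x y" for x y
    using unitary_cinner[OF assms, of "inv U x" "inv U y"] by (simp add: unitary_inv_right[OF assms])
qed

lemma unitary_id: "unitary (\<lambda>x. x)"
  by (simp add: unitary_def clinear_on_UNIV_iff surj_def)

lemma unitary_comp: "unitary U \<Longrightarrow> unitary V \<Longrightarrow> unitary (U \<circ> V)"
  unfolding unitary_def clinear_on_UNIV_iff by (simp add: comp_surj del: comp_apply) simp

lemma unitary_funpow: "unitary U \<Longrightarrow> unitary (U ^^ n)"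
  by (induction n) (simp_all add: unitary_id unitary_comp id_def)

lemma op_powi_0 [simp]: "op_powi W 0 x = x"
  by (simp add: op_powi_def)

lemma op_powi_1 [simp]: "op_powi W 1 x = W x"
  by (simp add: op_powi_def)

lemma unitary_op_powi: "unitary U \<Longrightarrow> unitary (op_powi U k)"
  by (simp add: op_powi_def unitary_funpow unitary_inv)

lemma op_powi_Suc:
  assumes W: "bij W" shows "op_powi W (k + 1) x = W (op_powi W k x)"
proof (cases "k \<ge> 0")
  case True
  then show ?thesis by (simp add: op_powi_def nat_add_distrib)
next
  case False
  define n where "n = nat (- k - 1)"
  have k: "k = - int n - 1" using False by (simp add: n_def)
  have "nat (- k) = Suc n" unfolding k by simp
  then have "W (op_powi W k x) = (inv W ^^ n) x"
    using False by (simp add: op_powi_def surj_f_inv_f[OF bij_is_surj[OF W]])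
  moreover have "op_powi W (k + 1) x = (inv W ^^ n) x"
    by (cases "n = 0") (auto simp: op_powi_def k)
  ultimately show ?thesis by simp
qed

lemma op_powi_pred:
  assumes W: "bij W" shows "op_powi W (k - 1) x = inv W (op_powi W k x)"
  using op_powi_Suc[OF W, of "k - 1" x] by (simp add: inv_f_f[OF bij_is_inj[OF W]])

lemma op_powi_add:
  assumes W: "bij W" shows "op_powi W (j + k) x = op_powi W j (op_powi W k x)"
proof (induction j rule: int_induct[where k = 0])
  case (step1 i)
  then show ?case using op_powi_Suc[OF W, of "i + k" x] op_powi_Suc[OF W, of i "op_powi W k x"]
    by (simp add: add.commute add.left_commute)
next
  case (step2 i)
  then show ?case using op_powi_pred[OF W, of "i + k" x] op_powi_pred[OF W, of i "op_powi W k x"]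
    by (simp add: algebra_simps)
qed simp

lemma op_powi_adjoint:
  assumes "unitary W" shows "cinner (op_powi W k x) y = cinner x (op_powi W (-k) y)"
proof -
  have "cinner (op_powi W k x) (op_powi W k (op_powi W (-k) y)) = cinner x (op_powi W (-k) y)"
    by (rule unitary_cinner[OF unitary_op_powi[OF assms]])
  then show ?thesis
    using op_powi_add[OF unitary_bij[OF assms], of k "-k" y] by simp
qed

section \<open>The Cayley transform of a self-adjoint operator\<close>

lemma self_adjoint_symmetric:
  assumes "self_adjoint D A" "x \<in> D" "y \<in> D"
  shows "cinner (A x) y = cinner x (A y)"
  using assms unfolding self_adjoint_def by blast

lemma self_adjoint_adjoint_memI:
  assumes "self_adjoint D A" "\<And>x. x \<in> D \<Longrightarrow> cinner (A x) y = cinner x z"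
  shows "y \<in> D" "z = A y"
  using assms unfolding self_adjoint_def by blast+

lemma self_adjoint_linear: "self_adjoint D A \<Longrightarrow> clinear_on D A"
  by (simp add: self_adjoint_def)

text \<open>The cross terms cancel by symmetry of \<open>A\<close> because \<open>c\<close> is
  purely imaginary. Hence \<open>A + c\<close> is bounded below by 1, which gives injectivity and
  closed range.\<close>

lemma self_adjoint_shift_norm:
  assumes A: "self_adjoint D A" and x: "x \<in> D" and c: "c = \<i> \<or> c = - \<i>"
  shows "(norm (A x + c *\<^sub>C x))\<^sup>2 = (norm (A x))\<^sup>2 + (norm x)\<^sup>2"
proof -
  have "cinner (A x + c *\<^sub>C x) (A x + c *\<^sub>C x) = cinner (A x) (A x) + cinner x x"
    using c self_adjoint_symmetric[OF A x x]
    by (auto simp: cinner_add_left cinner_add_right cinner_scaleC_left cinner_scaleC_right algebra_simps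
        cinner.minus_left cinner.minus_right)
  then have "complex_of_real ((norm (A x + c *\<^sub>C x))\<^sup>2) = complex_of_real ((norm (A x))\<^sup>2 + (norm x)\<^sup>2)"
    unfolding cinner_self by simp
  then show ?thesis unfolding of_real_eq_iff .
qed

text \<open>The range is closed, and a vector \<open>y\<close> orthogonal to it satisfies
  \<open>A y = c y\<close> by self-adjointness, since \<open>cnj c = - c\<close>. The norm identity
  for \<open>- c\<close> then gives \<open>y = 0\<close>.\<close>

lemma self_adjoint_shift_surj:
  fixes D :: "'a::chilbert_space set"
  assumes A: "self_adjoint D A" and c: "c = \<i> \<or> c = - \<i>"
  shows "\<exists>x\<in>D. A x + c *\<^sub>C x = v"
proof -
  note L = self_adjoint_linear[OF A]
  note mem = clinear_on_mem_add[OF L] clinear_on_mem_scaleC[OF L] clinear_on_mem_zero[OF L] clinear_on_mem_diff[OF L]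
  define R where "R = (\<lambda>x. A x + c *\<^sub>C x) ` D"
  have R_diff: "(A x + c *\<^sub>C x) - (A y + c *\<^sub>C y) = A (x - y) + c *\<^sub>C (x - y)" if "x \<in> D" "y \<in> D" for x y
    using that by (simp add: clinear_on_diff[OF L] scaleC.diff_right)
  have le: "norm x \<le> norm (A x + c *\<^sub>C x)" if "x \<in> D" for x
  proof (rule power2_le_imp_le)
    show "(norm x)\<^sup>2 \<le> (norm (A x + c *\<^sub>C x))\<^sup>2"
      unfolding self_adjoint_shift_norm[OF A that c] by simp
  qed simp
  have cl: "closed R"
    unfolding closed_sequential_limits
  proof (intro allI impI, elim conjE)
    fix w l assume w: "\<forall>n. w n \<in> R" and l: "w \<longlonglongrightarrow> l"
    then have "\<forall>n. \<exists>x. x \<in> D \<and> w n = A x + c *\<^sub>C x" by (auto simp: R_def)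
    then obtain x where x: "\<And>n. x n \<in> D" and wx: "\<And>n. w n = A (x n) + c *\<^sub>C x n" by metis
    have "Cauchy x"
    proof (rule metric_CauchyI)
      fix e :: real assume "e > 0"
      then obtain N where N: "\<And>m n. m \<ge> N \<Longrightarrow> n \<ge> N \<Longrightarrow> dist (w m) (w n) < e"
        using LIMSEQ_imp_Cauchy[OF l] unfolding Cauchy_def by blast
      have "dist (x m) (x n) \<le> dist (w m) (w n)" for m n
        using le[OF mem(4)[OF x[of m] x[of n]]] unfolding R_diff[OF x x, symmetric] wx[symmetric] dist_norm .
      then show "\<exists>M. \<forall>m\<ge>M. \<forall>n\<ge>M. dist (x m) (x n) < e" using N le_less_trans by blast
    qed
    then obtain y where y: "x \<longlonglongrightarrow> y" using Cauchy_convergent convergent_def by blast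
    have Ax: "(\<lambda>n. A (x n)) \<longlonglongrightarrow> l - c *\<^sub>C y"
    proof -
      have "(\<lambda>n. w n - c *\<^sub>C x n) \<longlonglongrightarrow> l - c *\<^sub>C y"
        by (intro tendsto_diff l scaleC.tendsto tendsto_const y)
      then show ?thesis by (simp add: wx)
    qed
    \<comment> \<open>A self-adjoint operator is closed: the limit pair satisfies the adjoint
      relation and therefore lies in the graph of \<open>A\<close>.\<close>
    have "cinner (A u) y = cinner u (l - c *\<^sub>C y)" if u: "u \<in> D" for u
    proof (rule LIMSEQ_unique)
      show "(\<lambda>n. cinner (A u) (x n)) \<longlonglongrightarrow> cinner (A u) y"
        by (intro cinner.tendsto tendsto_const y)
      show "(\<lambda>n. cinner (A u) (x n)) \<longlonglongrightarrow> cinner u (l - c *\<^sub>C y)"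
        unfolding self_adjoint_symmetric[OF A u x] by (intro cinner.tendsto tendsto_const Ax)
    qed
    from self_adjoint_adjoint_memI[OF A this] have "y \<in> D" "l = A y + c *\<^sub>C y" by (auto simp: algebra_simps)
    then show "l \<in> R" by (auto simp: R_def)
  qed
  have "v \<in> R"
  proof (rule ccontr)
    assume v: "v \<notin> R"
    obtain y where y0: "y \<noteq> 0" and y: "\<And>x. x \<in> R \<Longrightarrow> cinner x y = 0"
    proof (rule closed_subspace_orthogonal_vector[OF cl _ _ _ v])
      show "0 \<in> R" using mem(3) clinear_on_zero[OF L] by (auto simp: R_def simp: scaleC.zero_right intro!: image_eqI[of _ _ 0])
      show "x + y \<in> R" if xy: "x \<in> R" "y \<in> R" for x y
      proof -
        obtain a b where "a \<in> D" "b \<in> D" "x = A a + c *\<^sub>C a" "y = A b + c *\<^sub>C b"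
          using xy by (auto simp: R_def)
        then show ?thesis unfolding R_def
          by (intro image_eqI[of _ _ "a + b"]) (auto simp: clinear_on_add[OF L] mem scaleC_add_right)
      qed
      show "b *\<^sub>C x \<in> R" if xR: "x \<in> R" for b x
      proof -
        obtain a where "a \<in> D" "x = A a + c *\<^sub>C a" using xR by (auto simp: R_def)
        then show ?thesis unfolding R_def
          by (intro image_eqI[of _ _ "b *\<^sub>C a"])
            (auto simp: clinear_on_scaleC[OF L] mem scaleC_add_right scaleC_scaleC mult.commute)
      qed
    qed auto
    have "cinner (A x) y = cinner x (c *\<^sub>C y)" if x: "x \<in> D" for x
    proof -
      have "cinner (A x + c *\<^sub>C x) y = 0" by (rule y) (auto simp: R_def x)
      then show ?thesis using c
        by (auto simp: cinner_add_left cinner_scaleC_left cinner_scaleC_right cinner.diff_left add_eq_0_iff)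
    qed
    from self_adjoint_adjoint_memI[OF A this] have yD: "y \<in> D" and Ay: "c *\<^sub>C y = A y" by auto
    have "(norm (A y + (- c) *\<^sub>C y))\<^sup>2 = (norm (A y))\<^sup>2 + (norm y)\<^sup>2"
      by (rule self_adjoint_shift_norm[OF A yD]) (use c in auto)
    then have "(norm y)\<^sup>2 \<le> 0" by (simp add: Ay[symmetric] scaleC.minus_left)
    then show False using y0 by simp
  qed
  then show ?thesis by (auto simp: R_def)
qed

text \<open>With the resolvent \<open>J = (A + i)\<^sup>-\<^sup>1\<close> one has
  \<open>y - W y = 2 i J y\<close> and \<open>y + W y = 2 A (J y)\<close>, so the bounded operator
  \<open>W\<close> encodes both the domain and the values of \<open>A\<close>. Isometry and
  surjectivity of \<open>W\<close> come from the norm identity and the surjectivity for both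
  signs.\<close>

lemma cayley_transform:
  fixes D :: "'a::chilbert_space set"
  assumes A: "self_adjoint D A"
  obtains W where "unitary W" "D = range (\<lambda>y. y - W y)" "\<And>y. A (y - W y) = \<i> *\<^sub>C (y + W y)"
proof -
  note L = self_adjoint_linear[OF A]
  note mem = clinear_on_mem_add[OF L] clinear_on_mem_scaleC[OF L] clinear_on_mem_zero[OF L] clinear_on_mem_diff[OF L]
  obtain J where JD: "\<And>v. J v \<in> D" and J: "\<And>v. A (J v) + \<i> *\<^sub>C J v = v"
    using self_adjoint_shift_surj[OF A, of \<i>] by metis
  have uniq: "J v = x" if "x \<in> D" "A x + \<i> *\<^sub>C x = v" for x v
  proof -
    have "A (J v - x) + \<i> *\<^sub>C (J v - x) = (A (J v) + \<i> *\<^sub>C J v) - (A x + \<i> *\<^sub>C x)"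
      using that(1) JD by (simp add: clinear_on_diff[OF L] scaleC.diff_right)
    then have "A (J v - x) + \<i> *\<^sub>C (J v - x) = 0" using J that by simp
    then have "(norm (0::'a))\<^sup>2 = (norm (A (J v - x)))\<^sup>2 + (norm (J v - x))\<^sup>2"
      using self_adjoint_shift_norm[OF A mem(4)[OF JD that(1)], of \<i> v]
      by (simp add: clinear_on_zero[OF L])
    then have "J v - x = 0" by simp
    then show ?thesis by simp
  qed
  define W where "W = (\<lambda>v. A (J v) - \<i> *\<^sub>C J v)"
  have J_add: "J (u + v) = J u + J v" for u v
  proof (rule uniq)
    show "J u + J v \<in> D" by (intro mem JD)
    have "A (J u + J v) + \<i> *\<^sub>C (J u + J v) = (A (J u) + \<i> *\<^sub>C J u) + (A (J v) + \<i> *\<^sub>C J v)"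
      using JD by (simp add: clinear_on_add[OF L] scaleC_add_right)
    then show "A (J u + J v) + \<i> *\<^sub>C (J u + J v) = u + v" by (simp only: J)
  qed
  have J_scale: "J (c *\<^sub>C u) = c *\<^sub>C J u" for c u
  proof (rule uniq)
    show "c *\<^sub>C J u \<in> D" by (intro mem JD)
    have "A (c *\<^sub>C J u) + \<i> *\<^sub>C (c *\<^sub>C J u) = c *\<^sub>C (A (J u) + \<i> *\<^sub>C J u)"
      using JD by (simp add: clinear_on_scaleC[OF L] scaleC_add_right scaleC_scaleC mult.commute)
    then show "A (c *\<^sub>C J u) + \<i> *\<^sub>C (c *\<^sub>C J u) = c *\<^sub>C u" by (simp only: J)
  qed
  have sub: "v - W v = (2 * \<i>) *\<^sub>C J v" for v
  proof -
    have "v - W v = (A (J v) + \<i> *\<^sub>C J v) - (A (J v) - \<i> *\<^sub>C J v)" by (simp only: J W_def)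
    also have "\<dots> = (\<i> + \<i>) *\<^sub>C J v" unfolding scaleC_add_left by simp
    finally show ?thesis by simp
  qed
  have add: "v + W v = 2 *\<^sub>C A (J v)" for v
  proof -
    have "v + W v = (A (J v) + \<i> *\<^sub>C J v) + (A (J v) - \<i> *\<^sub>C J v)" by (simp only: J W_def)
    also have "\<dots> = (1 + 1) *\<^sub>C A (J v)" unfolding scaleC_add_left by simp
    finally show ?thesis by simp
  qed
  show ?thesis
  proof (rule that)
    have "clinear_on UNIV W"
      unfolding clinear_on_UNIV_iff W_def
      using JD by (simp add: J_add J_scale clinear_on_add[OF L] clinear_on_scaleC[OF L] scaleC_add_right
          scaleC.diff_right scaleC_scaleC mult.commute)
    moreover have "surj W"
      unfolding surj_def
    proof
      fix v
      obtain x where x: "x \<in> D" "A x + (- \<i>) *\<^sub>C x = v" using self_adjoint_shift_surj[OF A, of "-\<i>" v] by auto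
      have "J (A x + \<i> *\<^sub>C x) = x" using x by (intro uniq) auto
      then have "v = W (A x + \<i> *\<^sub>C x)" using x by (simp add: W_def scaleC.minus_left)
      then show "\<exists>u. v = W u" ..
    qed
    moreover have "cinner (W u) (W v) = cinner u v" for u v
    proof -
      have "cinner (W u) (W v) = cinner (A (J u) + \<i> *\<^sub>C J u) (A (J v) + \<i> *\<^sub>C J v)"
        unfolding W_def using self_adjoint_symmetric[OF A JD[of u] JD[of v]]
        by (simp add: cinner_add_left cinner_add_right cinner_scaleC_left cinner_scaleC_right
            cinner.diff_left cinner.diff_right algebra_simps)
      then show ?thesis by (simp only: J)
    qed
    ultimately show "unitary W" by (simp add: unitary_def)
    show "D = range (\<lambda>y. y - W y)"
    proof safe
      fix x assume x: "x \<in> D"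
      \<comment> \<open>Solves \<open>x = 2 i J y\<close>, that is,
        \<open>y = (A + i) (x / (2 i))\<close>.\<close>
      define y where "y = A ((1 / (2 * \<i>)) *\<^sub>C x) + \<i> *\<^sub>C ((1 / (2 * \<i>)) *\<^sub>C x)"
      have "J y = (1 / (2 * \<i>)) *\<^sub>C x" by (rule uniq) (auto simp: y_def x mem)
      then have "x = y - W y" by (simp add: sub scaleC_scaleC)
      then show "x \<in> range (\<lambda>y. y - W y)" by blast
    next
      fix y show "y - W y \<in> D" unfolding sub by (intro mem JD)
    qed
    show "A (y - W y) = \<i> *\<^sub>C (y + W y)" for y
      unfolding sub add using JD by (simp add: clinear_on_scaleC[OF L] scaleC_scaleC mult.commute)
  qed
qed

section \<open>Herglotz measures of a unitary operator\<close>

lemma has_bochner_integral_cis_period: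
  "has_bochner_integral lborel (\<lambda>\<theta>. indicator {0..2*pi} \<theta> *\<^sub>R cis (real_of_int j * \<theta>))
     (if j = 0 then of_real (2 * pi) else 0)"
proof (cases "j = 0")
  case True
  have "has_bochner_integral lborel (\<lambda>\<theta>. indicator {0..2*pi} \<theta> *\<^sub>R (1::complex)) (of_real (2*pi) - of_real 0)"
    by (rule has_bochner_integral_FTC_Icc[where F = of_real])
      (auto intro!: derivative_eq_intros simp: has_vector_derivative_def scaleR_conv_of_real[abs_def]
        bounded_linear_of_real intro!: bounded_linear_imp_has_derivative)
  then show ?thesis by (simp add: True)
next
  case False
  have "has_bochner_integral lborel (\<lambda>\<theta>. indicator {0..2*pi} \<theta> *\<^sub>R cis (real_of_int j * \<theta>))
     (cis (j * (2*pi)) / (\<i> * j) - cis (real_of_int j * 0) / (\<i> * j))"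
  proof (rule has_bochner_integral_FTC_Icc[where F = "\<lambda>a. cis (real_of_int j * a) / (\<i> * of_int j)"])
    show "((\<lambda>a. cis (real_of_int j * a) / (\<i> * of_int j)) has_vector_derivative cis (real_of_int j * x)) (at x within {0..2*pi})" for x
    proof -
      have "((\<lambda>a. cis (real_of_int j * a)) has_vector_derivative real_of_int j *\<^sub>R (\<i> * cis (real_of_int j * x))) (at x within {0..2*pi})"
        unfolding has_vector_derivative_def
        by (auto intro!: derivative_eq_intros simp: scaleR_conv_of_real mult_ac)
      from has_vector_derivative_divide[OF this, of "\<i> * of_int j"] show ?thesis
        using False by (simp add: scaleR_conv_of_real)
    qed
  qed (auto intro!: continuous_intros)
  moreover have "cis (j * (2*pi)) = 1"
    using cis_multiple_2pi[of "real_of_int j"] by (simp add: mult_ac)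
  ultimately show ?thesis using False by simp
qed

lemma borel_measurable_cis_mult [measurable]: "(\<lambda>\<theta>. cis (r * \<theta>)) \<in> borel_measurable borel"
  by (intro borel_measurable_continuous_onI continuous_intros)

text \<open>Counts the pairs on the \<open>j\<close>-th diagonal of an \<open>N\<close> by
  \<open>N\<close> square, the source of Fejer's triangular factor. In the bijection at most one of
  \<open>nat j\<close> and \<open>nat (- j)\<close> is nonzero.\<close>

lemma double_sum_diff_eq:
  fixes c :: complex
  shows "(\<Sum>k<N. \<Sum>l<N. if int k - int l = j then c else 0) = of_nat (N - nat \<bar>j\<bar>) * c"
proof -
  have "(\<Sum>k<N. \<Sum>l<N. if int k - int l = j then c else 0)
      = (\<Sum>p\<in>{..<N} \<times> {..<N}. if int (fst p) - int (snd p) = j then c else 0)"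
    by (simp add: sum.cartesian_product split_def)
  also have "\<dots> = of_nat (card {p \<in> {..<N} \<times> {..<N}. int (fst p) - int (snd p) = j}) * c"
    by (simp add: sum.inter_filter[symmetric])
  also have "card {p \<in> {..<N} \<times> {..<N}. int (fst p) - int (snd p) = j} = card {..<N - nat \<bar>j\<bar>}"
  proof (rule bij_betw_same_card[symmetric])
    show "bij_betw (\<lambda>i. (i + nat j, i + nat (- j))) {..<N - nat \<bar>j\<bar>}
        {p \<in> {..<N} \<times> {..<N}. int (fst p) - int (snd p) = j}"
      by (rule bij_betw_byWitness[where f' = "\<lambda>p. min (fst p) (snd p)"]) auto
  qed
  finally show ?thesis by simp
qed

text \<open>Expanding the square gives \<open>1 / (2 \<pi>)\<close> times the sum of \<open>(1 - |j|
  / N) * cinner (op_powi W j x) x * cis (- j * \<theta>)\<close> over \<open>|j| < N\<close>: the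
  Fejer mean of the formal Fourier series of the wanted measure. Writing it as a squared norm makes
  positivity evident.\<close>

definition fejer_density :: "('a::complex_inner \<Rightarrow> 'a) \<Rightarrow> 'a \<Rightarrow> nat \<Rightarrow> real \<Rightarrow> real"
  where "fejer_density W x N \<theta> = indicator {0..2*pi} \<theta> *
    (norm (\<Sum>k<N. cis (- (real k * \<theta>)) *\<^sub>C op_powi W (int k) x))\<^sup>2 / (2 * pi * real N)"

lemma fejer_density_nonneg: "fejer_density W x N \<theta> \<ge> 0"
  by (simp add: fejer_density_def)

lemma fejer_density_outside: "\<theta> \<notin> {0..2*pi} \<Longrightarrow> fejer_density W x N \<theta> = 0"
  by (simp add: fejer_density_def)

lemma fejer_density_measurable [measurable]: "fejer_density W x N \<in> borel_measurable borel"
proof -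
  have "continuous_on UNIV (\<lambda>\<theta>. (norm (\<Sum>k<N. cis (- (real k * \<theta>)) *\<^sub>C op_powi W (int k) x))\<^sup>2)"
    by (intro continuous_intros scaleC.continuous_on)
  note [measurable] = borel_measurable_continuous_onI[OF this]
  show ?thesis unfolding fejer_density_def[abs_def] by measurable
qed

text \<open>Orthogonality of the exponentials leaves only the pairs with \<open>k - l = j\<close>.
  Truncated subtraction makes the coefficient vanish for \<open>|j| \<ge> N\<close>, as it
  should.\<close>

lemma has_bochner_integral_fejer:
  assumes W: "unitary W"
  shows "has_bochner_integral lborel (\<lambda>\<theta>. fejer_density W x N \<theta> *\<^sub>R cis (real_of_int j * \<theta>))
    (of_nat (N - nat \<bar>j\<bar>) / of_nat N * cinner (op_powi W j x) x)"
proof -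
  define c where "c = (\<lambda>k. cinner (op_powi W k x) x / (2 * pi * N))"
  have "fejer_density W x N \<theta> *\<^sub>R cis (real_of_int j * \<theta>)
      = (\<Sum>k<N. \<Sum>l<N. (indicator {0..2*pi} \<theta> *\<^sub>R cis (real_of_int (j + int l - int k) * \<theta>)) * c (int k - int l))" for \<theta>
  proof -
    define v where "v = (\<lambda>k::nat. cis (- (real k * \<theta>)) *\<^sub>C op_powi W (int k) x)"
    have "cinner (v k) (v l) = cis (real_of_int (int l - int k) * \<theta>) * cinner (op_powi W (int k - int l) x) x" for k l
    proof -
      have "cinner (op_powi W (int k) x) (op_powi W (int l) x) = cinner (op_powi W (int k - int l) x) x"
        using op_powi_adjoint[OF W, of "- int l" "op_powi W (int k) x" x]
          op_powi_add[OF unitary_bij[OF W], of "- int l" "int k" x] by (simp add: algebra_simps)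
      then show ?thesis
        by (simp add: v_def cinner_scaleC_left cinner_scaleC_right cis_cnj cis_mult
            mult.assoc[symmetric] algebra_simps)
    qed
    then have "complex_of_real ((norm (\<Sum>k<N. v k))\<^sup>2)
        = (\<Sum>k<N. \<Sum>l<N. cis (real_of_int (int l - int k) * \<theta>) * cinner (op_powi W (int k - int l) x) x)"
      unfolding cinner_self[symmetric] cinner.sum_left cinner.sum_right by (subst sum.swap) simp
    then have "complex_of_real (fejer_density W x N \<theta>)
        = indicator {0..2*pi} \<theta> * (\<Sum>k<N. \<Sum>l<N. cis (real_of_int (int l - int k) * \<theta>) * c (int k - int l))"
      by (simp add: fejer_density_def v_def c_def sum_divide_distrib[symmetric] sum_distrib_left indicator_def)
    then have "complex_of_real (fejer_density W x N \<theta>) * cis (real_of_int j * \<theta>)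
        = indicator {0..2*pi} \<theta> * (cis (real_of_int j * \<theta>) * (\<Sum>k<N. \<Sum>l<N. cis (real_of_int (int l - int k) * \<theta>) * c (int k - int l)))"
      by (simp only: mult_ac)
    also have "\<dots> = indicator {0..2*pi} \<theta> * (\<Sum>k<N. \<Sum>l<N. cis (real_of_int j * \<theta>) * (cis (real_of_int (int l - int k) * \<theta>) * c (int k - int l)))"
      by (simp only: sum_distrib_left)
    also have "\<dots> = (\<Sum>k<N. \<Sum>l<N. (indicator {0..2*pi} \<theta> *\<^sub>R cis (real_of_int (j + int l - int k) * \<theta>)) * c (int k - int l))"
    proof -
      have eq: "cis (real_of_int j * \<theta>) * (cis (real_of_int (int l - int k) * \<theta>) * z) = cis (real_of_int (j + int l - int k) * \<theta>) * z"
        for k l :: nat and z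
      proof -
        have "real_of_int j * \<theta> + real_of_int (int l - int k) * \<theta> = real_of_int (j + int l - int k) * \<theta>"
          by (simp add: algebra_simps)
        then show ?thesis by (simp only: mult.assoc[symmetric] cis_mult)
      qed
      show ?thesis unfolding eq by (simp add: indicator_def)
    qed
    finally show ?thesis by (simp add: scaleR_conv_of_real)
  qed
  moreover have "has_bochner_integral lborel (\<lambda>\<theta>. \<Sum>k<N. \<Sum>l<N.
      (indicator {0..2*pi} \<theta> *\<^sub>R cis (real_of_int (j + int l - int k) * \<theta>)) * c (int k - int l))
      (\<Sum>k<N. \<Sum>l<N. (if j + int l - int k = 0 then of_real (2 * pi) else 0) * c (int k - int l))"
    by (intro has_bochner_integral_sum has_bochner_integral_mult_left has_bochner_integral_cis_period)
  moreover have "(\<Sum>k<N. \<Sum>l<N. (if j + int l - int k = 0 then of_real (2 * pi) else 0) * c (int k - int l))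
      = (\<Sum>k<N. \<Sum>l<N. if int k - int l = j then of_real (2 * pi) * c j else 0)"
    by (intro sum.cong refl) auto
  moreover have "of_nat (N - nat \<bar>j\<bar>) * (of_real (2 * pi) * c j)
      = of_nat (N - nat \<bar>j\<bar>) / of_nat N * cinner (op_powi W j x) x"
    by (simp add: c_def field_simps)
  ultimately show ?thesis by (simp only: double_sum_diff_eq)
qed

text \<open>For a unit vector the Fejer densities are probability densities carried by
  \<open>{0..2*pi}\<close>, so Helly selection yields a weak limit. Its moments are as claimed
  because each Fejer factor tends to 1 for fixed \<open>k\<close>. The measure lives on the line of
  angles; only integrals of functions of \<open>cis\<close> will matter.\<close>

lemma herglotz_unit:
  fixes x :: "'a::complex_inner"
  assumes W: "unitary W" and x: "norm x = 1"
  shows "\<exists>\<nu>. real_distribution \<nu> \<and> (\<forall>k. (LINT \<theta>|\<nu>. cis (real_of_int k * \<theta>)) = cinner (op_powi W k x) x)"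
proof -
  define p where "p = (\<lambda>n. fejer_density W x (Suc n))"
  define \<mu> where "\<mu> = (\<lambda>n. density lborel (\<lambda>\<theta>. ennreal (p n \<theta>)))"
  have pm [measurable]: "p n \<in> borel_measurable borel" for n by (simp add: p_def)
  have p0: "p n \<theta> \<ge> 0" for n \<theta> by (simp add: p_def fejer_density_nonneg)
  have pI: "has_bochner_integral lborel (p n) 1" for n
  proof -
    have "has_bochner_integral lborel (\<lambda>\<theta>. Re (p n \<theta> *\<^sub>R cis (real_of_int 0 * \<theta>)))
        (Re (of_nat (Suc n - nat \<bar>0\<bar>) / of_nat (Suc n) * cinner (op_powi W 0 x) x))"
      unfolding p_def by (intro has_bochner_integral_Re has_bochner_integral_fejer W)
    moreover have "Re (of_nat (Suc n - nat \<bar>0\<bar>) / of_nat (Suc n) * cinner (op_powi W 0 x) x) = 1"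
      by (simp add: cinner_self x del: of_nat_Suc)
    ultimately show ?thesis by simp
  qed
  have em: "emeasure (\<mu> n) A = 1" if A: "A \<in> sets borel" "{0..2*pi} \<subseteq> A" for n A
  proof -
    have "emeasure (\<mu> n) A = (\<integral>\<^sup>+\<theta>. ennreal (p n \<theta>) * indicator A \<theta> \<partial>lborel)"
      unfolding \<mu>_def using A by (intro emeasure_density) auto
    also have "\<dots> = (\<integral>\<^sup>+\<theta>. ennreal (p n \<theta>) \<partial>lborel)"
    proof (intro nn_integral_cong)
      fix \<theta>
      have "\<theta> \<notin> A \<Longrightarrow> p n \<theta> = 0" using A(2) fejer_density_outside unfolding p_def by blast
      then show "ennreal (p n \<theta>) * indicator A \<theta> = ennreal (p n \<theta>)" by (cases "\<theta> \<in> A") auto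
    qed
    also have "\<dots> = ennreal (LINT \<theta>|lborel. p n \<theta>)"
      by (intro nn_integral_eq_integral) (use pI p0 in \<open>auto simp: has_bochner_integral_iff\<close>)
    finally show ?thesis using pI by (simp add: has_bochner_integral_iff)
  qed
  have rd: "real_distribution (\<mu> n)" for n
    unfolding real_distribution_def real_distribution_axioms_def
    by (auto simp: \<mu>_def intro!: prob_spaceI) (use em[of UNIV n] in \<open>simp add: \<mu>_def\<close>)
  have "tight \<mu>"
    unfolding tight_def
  proof (intro conjI allI impI rd)
    fix e :: real assume e: "e > 0"
    \<comment> \<open>The interval contains \<open>{0..2*pi}\<close> because \<open>pi < 4\<close>,
      so no mass can escape.\<close>
    have "measure (\<mu> n) {-1<..8} = 1" for n
    proof -
      have "emeasure (\<mu> n) {-1<..8} = 1" using pi_less_4 by (intro em) auto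
      then show ?thesis by (simp add: measure_def)
    qed
    then show "\<exists>a b::real. a < b \<and> (\<forall>n. 1 - e < measure (\<mu> n) {a<..b})"
      using e by (intro exI[of _ "-1"] exI[of _ 8]) auto
  qed
  from tight_imp_convergent_subsubsequence[OF this strict_mono_id] obtain r M
    where r: "strict_mono r" and M: "real_distribution M" and conv: "weak_conv_m (\<mu> \<circ> id \<circ> r) M" by blast
  have "(LINT \<theta>|M. cis (real_of_int k * \<theta>)) = cinner (op_powi W k x) x" for k
  proof (rule LIMSEQ_unique)
    have "(\<lambda>n. LINT \<theta>|(\<mu> \<circ> id \<circ> r) n. cis (real_of_int k * \<theta>)) \<longlonglongrightarrow> (LINT \<theta>|M. cis (real_of_int k * \<theta>))"
      by (rule weak_conv_imp_integral_bdd_continuous_conv[OF _ M conv, of _ 1])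
        (auto simp: rd intro!: continuous_intros
          continuous_on_eq_continuous_at[OF open_UNIV, THEN iffD1, rule_format])
    moreover have "(LINT \<theta>|\<mu> n. cis (real_of_int k * \<theta>))
        = of_nat (Suc n - nat \<bar>k\<bar>) / of_nat (Suc n) * cinner (op_powi W k x) x" for n
    proof -
      have "(LINT \<theta>|\<mu> n. cis (real_of_int k * \<theta>)) = (LINT \<theta>|lborel. p n \<theta> *\<^sub>R cis (real_of_int k * \<theta>))"
        unfolding \<mu>_def by (intro integral_density) (auto simp: p0)
      then show ?thesis
        using has_bochner_integral_fejer[OF W, of x "Suc n" k] by (simp add: p_def has_bochner_integral_iff)
    qed
    ultimately show "(\<lambda>n. of_nat (Suc (r n) - nat \<bar>k\<bar>) / of_nat (Suc (r n)) * cinner (op_powi W k x) x)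
        \<longlonglongrightarrow> (LINT \<theta>|M. cis (real_of_int k * \<theta>))" by (simp add: o_def)
    have "(\<lambda>n. real (Suc n - nat \<bar>k\<bar>) / real (Suc n)) \<longlonglongrightarrow> 1"
    proof (rule Lim_transform_eventually)
      have "(\<lambda>n. 1 - real (nat \<bar>k\<bar>) * inverse (real (Suc n))) \<longlonglongrightarrow> 1 - real (nat \<bar>k\<bar>) * 0"
        by (intro tendsto_intros LIMSEQ_inverse_real_of_nat)
      then show "(\<lambda>n. 1 - real (nat \<bar>k\<bar>) * inverse (real (Suc n))) \<longlonglongrightarrow> 1" by simp
      show "\<forall>\<^sub>F n in sequentially. 1 - real (nat \<bar>k\<bar>) * inverse (real (Suc n)) = real (Suc n - nat \<bar>k\<bar>) / real (Suc n)"
        using eventually_ge_at_top[of "nat \<bar>k\<bar>"]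
        by eventually_elim (simp add: of_nat_diff field_simps)
    qed
    then have "(\<lambda>n. complex_of_real (real (Suc n - nat \<bar>k\<bar>) / real (Suc n))) \<longlonglongrightarrow> of_real 1"
      by (rule tendsto_of_real)
    from LIMSEQ_subseq_LIMSEQ[OF this r]
    have "(\<lambda>n. of_nat (Suc (r n) - nat \<bar>k\<bar>) / of_nat (Suc (r n)) * cinner (op_powi W k x) x)
        \<longlonglongrightarrow> of_real 1 * cinner (op_powi W k x) x"
      by (intro tendsto_mult tendsto_const) (simp add: o_def)
    then show "(\<lambda>n. of_nat (Suc (r n) - nat \<bar>k\<bar>) / of_nat (Suc (r n)) * cinner (op_powi W k x) x)
        \<longlonglongrightarrow> cinner (op_powi W k x) x" by simp
  qed
  with M show ?thesis by blast
qed

text \<open>Scaling from unit vectors: the measure of \<open>x\<close> has total mass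
  \<open>(norm x)\<^sup>2\<close>, and the zero vector gets the zero measure.\<close>

lemma herglotz:
  fixes x :: "'a::complex_inner"
  assumes W: "unitary W"
  shows "\<exists>\<nu>::real measure. finite_measure \<nu> \<and> sets \<nu> = sets borel \<and>
    (\<forall>k. (LINT \<theta>|\<nu>. cis (real_of_int k * \<theta>)) = cinner (op_powi W k x) x)"
proof (cases "x = 0")
  case True
  have "op_powi W k 0 = 0" for k
    by (rule clinear_on_zero[OF unitary_linear[OF unitary_op_powi[OF W]]])
  then show ?thesis
    by (intro exI[of _ "null_measure borel"])
      (auto simp: True cinner.zero_right intro!: finite_measureI)
next
  case False
  define u where "u = (1 / norm x) *\<^sub>R x"
  have u: "norm u = 1" using False by (simp add: u_def)
  have xu: "x = complex_of_real (norm x) *\<^sub>C u" using False by (simp add: u_def scaleR_scaleC[symmetric])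
  obtain M where M: "real_distribution M"
    and Mk: "\<And>k. (LINT \<theta>|M. cis (real_of_int k * \<theta>)) = cinner (op_powi W k u) u"
    using herglotz_unit[OF W u] by blast
  interpret M: real_distribution M by (rule M)
  define \<nu> where "\<nu> = density M (\<lambda>_. ennreal ((norm x)\<^sup>2))"
  have "finite_measure \<nu>"
    by (rule finite_measureI) (simp add: \<nu>_def emeasure_density M.emeasure_space_1[simplified])
  moreover have "sets \<nu> = sets borel" by (simp add: \<nu>_def)
  moreover have "(LINT \<theta>|\<nu>. cis (real_of_int k * \<theta>)) = cinner (op_powi W k x) x" for k
  proof -
    have "(LINT \<theta>|\<nu>. cis (real_of_int k * \<theta>)) = (LINT \<theta>|M. (norm x)\<^sup>2 *\<^sub>R cis (real_of_int k * \<theta>))"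
      unfolding \<nu>_def by (intro integral_density) auto
    also have "\<dots> = (norm x)\<^sup>2 *\<^sub>R cinner (op_powi W k u) u" by (simp add: Mk)
    also have "\<dots> = cinner (op_powi W k x) x"
    proof -
      have "cinner (op_powi W k (complex_of_real r *\<^sub>C u)) (complex_of_real r *\<^sub>C u)
          = r\<^sup>2 *\<^sub>R cinner (op_powi W k u) u" for r
        by (simp add: clinear_on_scaleC[OF unitary_linear[OF unitary_op_powi[OF W]]]
          cinner_scaleC_left cinner_scaleC_right scaleR_conv_of_real power2_eq_square mult_ac)
      from this[of "norm x"] show ?thesis by (simp only: xu[symmetric])
    qed
    finally show ?thesis .
  qed
  ultimately show ?thesis by blast
qed

section \<open>Functional calculus from a family of scalar measures\<close>

lemma norm_diff_square_le:
  fixes a b c :: complex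
  shows "(cmod (a - b))\<^sup>2 \<le> 2 * (cmod (a - c))\<^sup>2 + 2 * (cmod (b - c))\<^sup>2"
proof -
  have "cmod (a - b) \<le> cmod (a - c) + cmod (b - c)"
    using norm_triangle_ineq4[of "a - c" "b - c"] by simp
  then have "(cmod (a - b))\<^sup>2 \<le> (cmod (a - c) + cmod (b - c))\<^sup>2"
    by (intro power_mono) auto
  also have "\<dots> \<le> 2 * (cmod (a - c))\<^sup>2 + 2 * (cmod (b - c))\<^sup>2"
    using zero_le_power2[of "cmod (a - c) - cmod (b - c)"] by (simp add: power2_eq_square algebra_simps)
  finally show ?thesis .
qed

text \<open>The vectors are controlled by L2 distances of the functions, and dominated convergence
  makes the functions L2-Cauchy. The dominating function may be unbounded: a constant serves for
  bounded limits, while \<open>1 + \<bar>h\<bar>\<close> serves to recover the domain of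
  \<open>A\<close>.\<close>

lemma convergent_of_L2_dominated:
  fixes v :: "nat \<Rightarrow> 'a::complete_space" and f :: "nat \<Rightarrow> 'b \<Rightarrow> complex"
  assumes v: "\<And>n m. (dist (v n) (v m))\<^sup>2 \<le> (LINT t|N. (cmod (f n t - f m t))\<^sup>2)"
    and f [measurable]: "\<And>n. f n \<in> borel_measurable N"
    and le: "\<And>n t. t \<in> space N \<Longrightarrow> cmod (f n t) \<le> w t"
    and w [measurable]: "w \<in> borel_measurable N" and w2: "integrable N (\<lambda>t. (w t)\<^sup>2)"
    and lim: "\<And>t. t \<in> space N \<Longrightarrow> (\<lambda>n. f n t) \<longlonglongrightarrow> g t"
  shows "convergent v"
proof -
  have g [measurable]: "g \<in> borel_measurable N"
    by (rule borel_measurable_LIMSEQ_metric[OF f lim])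
  have gle: "cmod (g t) \<le> w t" if "t \<in> space N" for t
    by (rule LIMSEQ_le_const2[OF tendsto_norm[OF lim[OF that]]]) (use le that in auto)
  have bd: "(cmod (f n t - g t))\<^sup>2 \<le> 4 * (w t)\<^sup>2" if "t \<in> space N" for n t
  proof -
    have "cmod (f n t - g t) \<le> 2 * w t"
      using norm_triangle_ineq4[of "f n t" "g t"] le[OF that, of n] gle[OF that] by linarith
    from power_mono[OF this norm_ge_zero, of 2] show ?thesis by (simp add: power_mult_distrib)
  qed
  have "(\<lambda>n. LINT t|N. (cmod (f n t - g t))\<^sup>2) \<longlonglongrightarrow> (LINT t|N. 0)"
  proof (rule integral_dominated_convergence[where w = "\<lambda>t. 4 * (w t)\<^sup>2"])
    show "AE t in N. (\<lambda>n. (cmod (f n t - g t))\<^sup>2) \<longlonglongrightarrow> 0"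
    proof (rule AE_I2)
      fix t assume "t \<in> space N"
      from tendsto_power[OF tendsto_norm[OF tendsto_diff[OF lim[OF this] tendsto_const[of "g t"]]], of 2]
      show "(\<lambda>n. (cmod (f n t - g t))\<^sup>2) \<longlonglongrightarrow> 0" by simp
    qed
  qed (use w2 bd in auto)
  then have a: "(\<lambda>n. LINT t|N. (cmod (f n t - g t))\<^sup>2) \<longlonglongrightarrow> 0" by simp
  have int: "integrable N (\<lambda>t. (cmod (f n t - g t))\<^sup>2)" for n
    by (rule Bochner_Integration.integrable_bound[of _ "\<lambda>t. 4 * (w t)\<^sup>2"]) (use w2 bd in auto)
  have d: "(dist (v n) (v m))\<^sup>2 \<le> 2 * (LINT t|N. (cmod (f n t - g t))\<^sup>2) + 2 * (LINT t|N. (cmod (f m t - g t))\<^sup>2)" for n m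
  proof -
    have "(LINT t|N. (cmod (f n t - f m t))\<^sup>2)
        \<le> (LINT t|N. 2 * (cmod (f n t - g t))\<^sup>2 + 2 * (cmod (f m t - g t))\<^sup>2)"
    proof (rule integral_mono)
      show int': "integrable N (\<lambda>t. 2 * (cmod (f n t - g t))\<^sup>2 + 2 * (cmod (f m t - g t))\<^sup>2)"
        using int by auto
      show "integrable N (\<lambda>t. (cmod (f n t - f m t))\<^sup>2)"
        by (rule Bochner_Integration.integrable_bound[OF int']) (auto intro!: norm_diff_square_le)
    qed (rule norm_diff_square_le)
    also have "\<dots> = 2 * (LINT t|N. (cmod (f n t - g t))\<^sup>2) + 2 * (LINT t|N. (cmod (f m t - g t))\<^sup>2)"
      using int by simp
    finally show ?thesis using v[of n m] by linarith
  qed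
  have "Cauchy v"
  proof (rule metric_CauchyI)
    fix e :: real assume e: "e > 0"
    then have "\<forall>\<^sub>F n in sequentially. (LINT t|N. (cmod (f n t - g t))\<^sup>2) < e\<^sup>2 / 4"
      by (intro order_tendstoD(2)[OF a]) simp
    then obtain K where K: "\<And>n. n \<ge> K \<Longrightarrow> (LINT t|N. (cmod (f n t - g t))\<^sup>2) < e\<^sup>2 / 4"
      by (auto simp: eventually_sequentially)
    have "dist (v n) (v m) < e" if "n \<ge> K" "m \<ge> K" for n m
    proof -
      have "(dist (v n) (v m))\<^sup>2 < e\<^sup>2" using d[of n m] K[OF that(1)] K[OF that(2)] by linarith
      then show ?thesis using e by (simp add: power_less_imp_less_base)
    qed
    then show "\<exists>M. \<forall>m\<ge>M. \<forall>n\<ge>M. dist (v m) (v n) < e" by blast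
  qed
  then show ?thesis by (rule Cauchy_convergent)
qed

text \<open>
  In \<open>gen f S S'\<close> the operator \<open>S\<close> stands for \<open>f\<close> and \<open>S'\<close> for its complex conjugate.
  Carrying both through the induction makes adjoints, products and hence the isometry
  \<open>\<parallel>S x\<parallel>\<^sup>2 = \<integral> \<bar>f\<bar>\<^sup>2 d\<nu>\<^sub>x\<close> available, which in turn forces bounded pointwise limits of functions to
  have strong limits of operators.
\<close>

locale operator_calculus =
  fixes gen :: "(real \<Rightarrow> complex) \<Rightarrow> ('a::chilbert_space \<Rightarrow> 'a) \<Rightarrow> ('a \<Rightarrow> 'a) \<Rightarrow> bool"
    and \<nu> :: "'a \<Rightarrow> real measure"
  assumes gen_bounded: "gen f S S' \<Longrightarrow> \<exists>K. \<forall>t. cmod (f t) \<le> K"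
    and gen_measurable: "gen f S S' \<Longrightarrow> f \<in> borel_measurable borel"
    and gen_linear: "gen f S S' \<Longrightarrow> clinear_on UNIV S"
    and gen_bounded_op: "gen f S S' \<Longrightarrow> \<exists>K. \<forall>x. norm (S x) \<le> K * norm x"
    and gen_adjoint: "gen f S S' \<Longrightarrow> cinner (S x) y = cinner x (S' y)"
    and gen_integral: "gen f S S' \<Longrightarrow> cinner (S x) x = (LINT t|\<nu> x. f t)"
    and gen_conj: "gen f S S' \<Longrightarrow> gen (\<lambda>t. cnj (f t)) S' S"
    and gen_mult: "gen f S S' \<Longrightarrow> gen g T T' \<Longrightarrow> gen (\<lambda>t. f t * g t) (S \<circ> T) (T' \<circ> S')"
    and gen_const: "gen (\<lambda>_. c) (\<lambda>x. c *\<^sub>C x) (\<lambda>x. cnj c *\<^sub>C x)"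
    and finite_\<nu>: "finite_measure (\<nu> x)"
    and sets_\<nu>: "sets (\<nu> x) = sets borel"
begin

lemma space_\<nu> [simp]: "space (\<nu> x) = UNIV"
  using sets_eq_imp_space_eq[OF sets_\<nu>] by simp

lemma borel_measurable_\<nu>: "f \<in> borel_measurable (\<nu> x) \<longleftrightarrow> f \<in> borel_measurable borel"
  by (rule measurable_cong_sets[OF sets_\<nu> refl, THEN eqset_imp_iff])

lemma integrable_bounded:
  fixes f :: "real \<Rightarrow> 'c::{banach, second_countable_topology}"
  assumes "f \<in> borel_measurable borel" "\<And>t. norm (f t) \<le> K"
  shows "integrable (\<nu> x) f"
  by (rule finite_measure.integrable_const_bound[OF finite_\<nu>])
    (use assms in \<open>auto simp: borel_measurable_\<nu>\<close>)

text \<open>Products are not a rule but a consequence of \<open>gen_mult\<close>. The limit rule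
  demands strong convergence of both operator sequences, since strong convergence does not pass to
  adjoints, and uniform bounds, so that every property can be carried through the induction.\<close>

inductive calc :: "(real \<Rightarrow> complex) \<Rightarrow> ('a \<Rightarrow> 'a) \<Rightarrow> ('a \<Rightarrow> 'a) \<Rightarrow> bool"
  where
    calc_gen: "gen f S S' \<Longrightarrow> calc f S S'"
  | calc_add: "calc f S S' \<Longrightarrow> calc g T T' \<Longrightarrow> calc (\<lambda>t. f t + g t) (\<lambda>x. S x + T x) (\<lambda>x. S' x + T' x)"
  | calc_lim: "(\<And>n. calc (f n) (S n) (S' n)) \<Longrightarrow> (\<And>n t. cmod (f n t) \<le> K) \<Longrightarrow>
      (\<And>n x. norm (S n x) \<le> L * norm x) \<Longrightarrow> (\<And>n x. norm (S' n x) \<le> L * norm x) \<Longrightarrow>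
      (\<And>t. (\<lambda>n. f n t) \<longlonglongrightarrow> g t) \<Longrightarrow>
      (\<And>x. (\<lambda>n. S n x) \<longlonglongrightarrow> T x) \<Longrightarrow> (\<And>x. (\<lambda>n. S' n x) \<longlonglongrightarrow> T' x) \<Longrightarrow> calc g T T'"

lemma calc_conj: "calc f S S' \<Longrightarrow> calc (\<lambda>t. cnj (f t)) S' S"
proof (induction rule: calc.induct)
  case (calc_lim f S S' K L g T T')
  show ?case
    by (rule calc.calc_lim[OF calc_lim.IH, where K = K and L = L])
      (use calc_lim.hyps(2-4,6,7) tendsto_cnj[OF calc_lim.hyps(5)] in auto)
qed (auto intro: calc_gen gen_conj dest: calc_add)

lemma calc_bounded: "calc f S S' \<Longrightarrow> \<exists>K. \<forall>t. cmod (f t) \<le> K"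
proof (induction rule: calc.induct)
  case (calc_add f S S' g T T')
  then obtain K L where "\<And>t. cmod (f t) \<le> K" "\<And>t. cmod (g t) \<le> L" by blast
  then have "cmod (f t + g t) \<le> K + L" for t
    using norm_triangle_ineq[of "f t" "g t"] add_mono order_trans by blast
  then show ?case by blast
next
  case (calc_lim f S S' K L g T T')
  have "cmod (g t) \<le> K" for t
    by (rule LIMSEQ_le_const2[OF tendsto_norm[OF calc_lim.hyps(5)]]) (use calc_lim.hyps in auto)
  then show ?case by blast
qed (rule gen_bounded)

lemma calc_measurable: "calc f S S' \<Longrightarrow> f \<in> borel_measurable borel"
proof (induction rule: calc.induct)
  case (calc_lim f S S' K L g T T')
  show ?case by (rule borel_measurable_LIMSEQ_metric[OF calc_lim.IH]) (rule calc_lim.hyps)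
qed (auto intro: gen_measurable)

lemma calc_integrable: "calc f S S' \<Longrightarrow> integrable (\<nu> x) f"
  using calc_bounded calc_measurable integrable_bounded by metis

lemma calc_linear: "calc f S S' \<Longrightarrow> clinear_on UNIV S"
proof (induction rule: calc.induct)
  case (calc_lim f S S' K L g T T')
  have "T (x + y) = T x + T y" for x y
  proof (rule LIMSEQ_unique[OF calc_lim.hyps(6)])
    show "(\<lambda>n. S n (x + y)) \<longlonglongrightarrow> T x + T y"
      using tendsto_add[OF calc_lim.hyps(6)[of x] calc_lim.hyps(6)[of y]]
      by (simp add: clinear_on_add[OF calc_lim.IH])
  qed
  moreover have "T (c *\<^sub>C x) = c *\<^sub>C T x" for c x
  proof (rule LIMSEQ_unique[OF calc_lim.hyps(6)])
    show "(\<lambda>n. S n (c *\<^sub>C x)) \<longlonglongrightarrow> c *\<^sub>C T x"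
      using scaleC.tendsto[OF tendsto_const[of c] calc_lim.hyps(6)[of x]]
      by (simp add: clinear_on_scaleC[OF calc_lim.IH])
  qed
  ultimately show ?case by (simp add: clinear_on_UNIV_iff)
next
  case (calc_gen f S S')
  then show ?case by (rule gen_linear)
qed (auto simp: clinear_on_UNIV_iff scaleC_add_right)

lemma calc_bounded_op: "calc f S S' \<Longrightarrow> \<exists>K. \<forall>x. norm (S x) \<le> K * norm x"
proof (induction rule: calc.induct)
  case (calc_add f S S' g T T')
  then obtain K L where "\<And>x. norm (S x) \<le> K * norm x" "\<And>x. norm (T x) \<le> L * norm x" by blast
  then have "norm (S x + T x) \<le> (K + L) * norm x" for x
    unfolding distrib_right using norm_triangle_ineq[of "S x" "T x"] add_mono order_trans by blast
  then show ?case by blast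
next
  case (calc_lim f S S' K L g T T')
  have "norm (T x) \<le> L * norm x" for x
    by (rule LIMSEQ_le_const2[OF tendsto_norm[OF calc_lim.hyps(6)]]) (use calc_lim.hyps in auto)
  then show ?case by blast
qed (rule gen_bounded_op)

lemma calc_tendsto: "calc f S S' \<Longrightarrow> (v \<longlongrightarrow> l) F \<Longrightarrow> ((\<lambda>n. S (v n)) \<longlongrightarrow> S l) F"
  using clinear_on_tendsto[OF calc_linear] calc_bounded_op by metis

lemma calc_adjoint: "calc f S S' \<Longrightarrow> cinner (S x) y = cinner x (S' y)"
proof (induction rule: calc.induct)
  case (calc_lim f S S' K L g T T')
  show ?case
  proof (rule LIMSEQ_unique)
    show "(\<lambda>n. cinner (S n x) y) \<longlonglongrightarrow> cinner (T x) y"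
      by (intro cinner.tendsto tendsto_const calc_lim.hyps)
    show "(\<lambda>n. cinner (S n x) y) \<longlonglongrightarrow> cinner x (T' y)"
      unfolding calc_lim.IH by (intro cinner.tendsto tendsto_const calc_lim.hyps)
  qed
qed (auto intro: gen_adjoint simp: cinner_add_left cinner_add_right)

lemma calc_integral: "calc f S S' \<Longrightarrow> cinner (S x) x = (LINT t|\<nu> x. f t)"
proof (induction rule: calc.induct)
  case (calc_add f S S' g T T')
  then show ?case by (simp add: cinner_add_left calc_integrable)
next
  case (calc_lim f S S' K L g T T')
  have m: "f n \<in> borel_measurable (\<nu> x)" for n
    unfolding borel_measurable_\<nu> by (rule calc_measurable[OF calc_lim.hyps(1)])
  show ?case
  proof (rule LIMSEQ_unique)
    show "(\<lambda>n. cinner (S n x) x) \<longlonglongrightarrow> cinner (T x) x"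
      by (intro cinner.tendsto tendsto_const calc_lim.hyps)
    show "(\<lambda>n. cinner (S n x) x) \<longlonglongrightarrow> (LINT t|\<nu> x. g t)"
      unfolding calc_lim.IH
      by (rule integral_dominated_convergence[where w = "\<lambda>_. K"])
        (use calc_lim.hyps in \<open>auto intro!: m borel_measurable_LIMSEQ_metric[OF m] integrable_bounded[of _ "\<bar>K\<bar>"]\<close>)
  qed
qed (rule gen_integral)

text \<open>Multiplicativity takes two inductions: here on the right factor with a generator on the
  left, and in \<open>calc_mult\<close> on the left factor with this lemma as the base case.\<close>

lemma calc_mult_gen: "calc g T T' \<Longrightarrow> gen f S S' \<Longrightarrow> calc (\<lambda>t. f t * g t) (S \<circ> T) (T' \<circ> S')"
proof (induction rule: calc.induct)
  case (calc_gen g T T')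
  then show ?case by (intro calc.calc_gen gen_mult)
next
  case (calc_add g T T' h R R')
  from calc.calc_add[OF calc_add.IH(1)[OF calc_add.prems] calc_add.IH(2)[OF calc_add.prems]]
  show ?case
    by (simp add: o_def algebra_simps clinear_on_add[OF gen_linear[OF calc_add.prems]])
next
  case (calc_lim g T T' K L h R R')
  obtain M where M: "\<And>t. cmod (f t) \<le> M" using gen_bounded[OF calc_lim.prems] by blast
  obtain N where N: "\<And>x. norm (S x) \<le> N * norm x" using gen_bounded_op[OF calc_lim.prems] by blast
  obtain N' where N': "\<And>x. norm (S' x) \<le> N' * norm x"
    using gen_bounded_op[OF gen_conj[OF calc_lim.prems]] by blast
  show ?case
  \<comment> \<open>The limit rule has a single constant for operators and adjoints, hence the
    maximum; absolute values are taken because nothing excludes negative bounds.\<close>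
  proof (rule calc.calc_lim[OF calc_lim.IH[OF calc_lim.prems],
        where K = "M * K" and L = "max (\<bar>N\<bar> * \<bar>L\<bar>) (\<bar>L\<bar> * \<bar>N'\<bar>)"])
    show "cmod (f t * g n t) \<le> M * K" for n t
      unfolding norm_mult by (intro mult_mono M calc_lim.hyps order_trans[OF norm_ge_zero M]) auto
    have abs: "norm (v::'a) \<le> r * norm u \<Longrightarrow> norm v \<le> \<bar>r\<bar> * norm u" for u v :: 'a and r
      by (erule order_trans) (simp add: mult_right_mono)
    show "norm ((S \<circ> T n) x) \<le> max (\<bar>N\<bar> * \<bar>L\<bar>) (\<bar>L\<bar> * \<bar>N'\<bar>) * norm x" for n x
    proof -
      have "norm (S (T n x)) \<le> \<bar>N\<bar> * (\<bar>L\<bar> * norm x)"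
        using order_trans[OF abs[OF N] mult_left_mono[OF abs[OF calc_lim.hyps(3)]]] by simp
      also have "\<dots> \<le> max (\<bar>N\<bar> * \<bar>L\<bar>) (\<bar>L\<bar> * \<bar>N'\<bar>) * norm x"
        unfolding mult.assoc[symmetric] by (intro mult_right_mono) auto
      finally show ?thesis by simp
    qed
    show "norm ((T' n \<circ> S') x) \<le> max (\<bar>N\<bar> * \<bar>L\<bar>) (\<bar>L\<bar> * \<bar>N'\<bar>) * norm x" for n x
    proof -
      have "norm (T' n (S' x)) \<le> \<bar>L\<bar> * (\<bar>N'\<bar> * norm x)"
        using order_trans[OF abs[OF calc_lim.hyps(4)] mult_left_mono[OF abs[OF N']]] by simp
      also have "\<dots> \<le> max (\<bar>N\<bar> * \<bar>L\<bar>) (\<bar>L\<bar> * \<bar>N'\<bar>) * norm x"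
        unfolding mult.assoc[symmetric] by (intro mult_right_mono) auto
      finally show ?thesis by simp
    qed
  qed (use calc_lim.hyps calc_tendsto[OF calc.calc_gen[OF calc_lim.prems] calc_lim.hyps(6)] in \<open>auto intro!: tendsto_mult\<close>)
qed

lemma calc_mult: "calc f S S' \<Longrightarrow> calc g T T' \<Longrightarrow> calc (\<lambda>t. f t * g t) (S \<circ> T) (T' \<circ> S')"
proof (induction rule: calc.induct)
  case (calc_gen f S S')
  then show ?case by (intro calc_mult_gen)
next
  case (calc_add f S S' h R R')
  from calc.calc_add[OF calc_add.IH(1)[OF calc_add.prems] calc_add.IH(2)[OF calc_add.prems]]
  show ?case
    by (simp add: o_def algebra_simps clinear_on_add[OF calc_linear[OF calc_conj[OF calc_add.prems]]])
next
  case (calc_lim f S S' K L h R R')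
  obtain M where M: "\<And>t. cmod (g t) \<le> M" using calc_bounded[OF calc_lim.prems] by blast
  obtain N where N: "\<And>x. norm (T x) \<le> N * norm x" using calc_bounded_op[OF calc_lim.prems] by blast
  obtain N' where N': "\<And>x. norm (T' x) \<le> N' * norm x"
    using calc_bounded_op[OF calc_conj[OF calc_lim.prems]] by blast
  show ?case
  proof (rule calc.calc_lim[OF calc_lim.IH[OF calc_lim.prems],
        where K = "K * M" and L = "max (\<bar>N'\<bar> * \<bar>L\<bar>) (\<bar>L\<bar> * \<bar>N\<bar>)"])
    show "cmod (f n t * g t) \<le> K * M" for n t
      unfolding norm_mult by (intro mult_mono M calc_lim.hyps order_trans[OF norm_ge_zero calc_lim.hyps(2)]) auto
    have abs: "norm (v::'a) \<le> r * norm u \<Longrightarrow> norm v \<le> \<bar>r\<bar> * norm u" for u v :: 'a and r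
      by (erule order_trans) (simp add: mult_right_mono)
    show "norm ((S n \<circ> T) x) \<le> max (\<bar>N'\<bar> * \<bar>L\<bar>) (\<bar>L\<bar> * \<bar>N\<bar>) * norm x" for n x
    proof -
      have "norm (S n (T x)) \<le> \<bar>L\<bar> * (\<bar>N\<bar> * norm x)"
        using order_trans[OF abs[OF calc_lim.hyps(3)] mult_left_mono[OF abs[OF N]]] by simp
      also have "\<dots> \<le> max (\<bar>N'\<bar> * \<bar>L\<bar>) (\<bar>L\<bar> * \<bar>N\<bar>) * norm x"
        unfolding mult.assoc[symmetric] by (intro mult_right_mono) auto
      finally show ?thesis by simp
    qed
    show "norm ((T' \<circ> S' n) x) \<le> max (\<bar>N'\<bar> * \<bar>L\<bar>) (\<bar>L\<bar> * \<bar>N\<bar>) * norm x" for n x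
    proof -
      have "norm (T' (S' n x)) \<le> \<bar>N'\<bar> * (\<bar>L\<bar> * norm x)"
        using order_trans[OF abs[OF N'] mult_left_mono[OF abs[OF calc_lim.hyps(4)]]] by simp
      also have "\<dots> \<le> max (\<bar>N'\<bar> * \<bar>L\<bar>) (\<bar>L\<bar> * \<bar>N\<bar>) * norm x"
        unfolding mult.assoc[symmetric] by (intro mult_right_mono) auto
      finally show ?thesis by simp
    qed
  qed (use calc_lim.hyps calc_tendsto[OF calc_conj[OF calc_lim.prems] calc_lim.hyps(7)] in \<open>auto intro!: tendsto_mult\<close>)
qed

lemma calc_const: "calc (\<lambda>_. c) (\<lambda>x. c *\<^sub>C x) (\<lambda>x. cnj c *\<^sub>C x)"
  by (rule calc_gen[OF gen_const])

lemma calc_scale: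
  assumes "calc f S S'" shows "calc (\<lambda>t. c * f t) (\<lambda>x. c *\<^sub>C S x) (\<lambda>x. cnj c *\<^sub>C S' x)"
  using calc_mult[OF calc_const[of c] assms]
  by (simp add: o_def clinear_on_scaleC[OF calc_linear[OF calc_conj[OF assms]]])

lemma calc_diff:
  assumes f: "calc f S S'" and g: "calc g T T'"
  shows "calc (\<lambda>t. f t - g t) (\<lambda>x. S x - T x) (\<lambda>x. S' x - T' x)"
  using calc_add[OF f calc_scale[OF g, of "-1"]] by (simp add: scaleC_minus_one)

lemma calc_sum:
  assumes "\<And>i. i \<in> I \<Longrightarrow> calc (f i) (S i) (S' i)"
  shows "calc (\<lambda>t. \<Sum>i\<in>I. f i t) (\<lambda>x. \<Sum>i\<in>I. S i x) (\<lambda>x. \<Sum>i\<in>I. S' i x)"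
  using assms
proof (induction I rule: infinite_finite_induct)
  case (insert i I)
  then show ?case using calc_add[of "f i" "S i" "S' i"] by simp
qed (use calc_const[of 0] in auto)

lemma calc_norm:
  assumes "calc f S S'" shows "(norm (S x))\<^sup>2 = (LINT t|\<nu> x. (cmod (f t))\<^sup>2)"
proof -
  have "complex_of_real ((norm (S x))\<^sup>2) = cinner ((S' \<circ> S) x) x"
    using calc_adjoint[OF calc_conj[OF assms], of "S x" x] by (simp add: cinner_self)
  also have "\<dots> = (LINT t|\<nu> x. cnj (f t) * f t)"
    by (rule calc_integral[OF calc_mult[OF calc_conj[OF assms] assms]])
  also have "\<dots> = (LINT t|\<nu> x. complex_of_real ((cmod (f t))\<^sup>2))"
    by (simp only: complex_norm_square mult.commute)
  also have "\<dots> = complex_of_real (LINT t|\<nu> x. (cmod (f t))\<^sup>2)"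
    by (rule integral_complex_of_real)
  finally show ?thesis unfolding of_real_eq_iff .
qed

lemma measure_\<nu>: "measure (\<nu> x) UNIV = (norm x)\<^sup>2"
  using calc_norm[OF calc_const[of 1], of x] by simp

lemma calc_norm_le:
  assumes f: "calc f S S'" and K: "\<And>t. cmod (f t) \<le> K"
  shows "norm (S x) \<le> K * norm x"
proof (rule power2_le_imp_le)
  have K0: "K \<ge> 0" using order_trans[OF norm_ge_zero K] by blast
  note [measurable] = calc_measurable[OF f]
  have K2: "(cmod (f t))\<^sup>2 \<le> K\<^sup>2" for t by (intro power_mono K) auto
  have "(norm (S x))\<^sup>2 = (LINT t|\<nu> x. (cmod (f t))\<^sup>2)" by (rule calc_norm[OF f])
  also have "\<dots> \<le> (LINT t|\<nu> x. K\<^sup>2)"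
    by (rule integral_mono) (use K2 in \<open>auto intro!: integrable_bounded[of _ "K\<^sup>2"]\<close>)
  finally show "(norm (S x))\<^sup>2 \<le> (K * norm x)\<^sup>2"
    by (simp add: measure_\<nu> power_mult_distrib mult.commute)
  show "K * norm x \<ge> 0" using K0 by simp
qed

text \<open>The difference represents the zero function and so has norm 0. Hence the operator
  depends on the function only, not on its derivation in \<open>calc\<close>, and \<open>op\<close>
  is well defined.\<close>

lemma calc_unique:
  assumes f: "calc f S S'" and g: "calc f T T'" shows "S = T"
  using calc_norm_le[OF calc_diff[OF f g], of 0] by (auto simp: fun_eq_iff)

lemma calc_bounded_limit:
  assumes f: "\<And>n. calc (f n) (S n) (S' n)" and K: "\<And>n t. cmod (f n t) \<le> K"
    and lim: "\<And>t. (\<lambda>n. f n t) \<longlonglongrightarrow> g t"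
  obtains T T' where "calc g T T'" "\<And>x. (\<lambda>n. S n x) \<longlonglongrightarrow> T x"
proof -
  \<comment> \<open>Stated for arbitrary sequences so that it can be applied twice, to the functions
    and to their conjugates; the latter gives the convergence of the adjoints.\<close>
  have conv: "convergent (\<lambda>n. S n x)"
    if f: "\<And>n. calc (f n) (S n) (S' n)" and K: "\<And>n t. cmod (f n t) \<le> K"
      and lim: "\<And>t. (\<lambda>n. f n t) \<longlonglongrightarrow> g t" for f S S' g x
  proof (rule convergent_of_L2_dominated[where N = "\<nu> x" and f = f and g = g and w = "\<lambda>_. K"])
    show "(dist (S n x) (S m x))\<^sup>2 \<le> (LINT t|\<nu> x. (cmod (f n t - f m t))\<^sup>2)" for n m
      using calc_norm[OF calc_diff[OF f f]] by (simp add: dist_norm)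
  qed (use K lim in \<open>auto simp: borel_measurable_\<nu> calc_measurable[OF f] intro: integrable_bounded[of _ "K\<^sup>2"]\<close>)
  have "convergent (\<lambda>n. S n x)" for x by (rule conv[OF f K lim])
  moreover have "convergent (\<lambda>n. S' n x)" for x
    by (rule conv[OF calc_conj[OF f] _ tendsto_cnj[OF lim]]) (simp add: K)
  ultimately obtain T T' where T: "\<And>x. (\<lambda>n. S n x) \<longlonglongrightarrow> T x" and T': "\<And>x. (\<lambda>n. S' n x) \<longlonglongrightarrow> T' x"
    unfolding convergent_def by metis
  have "calc g T T'"
    by (rule calc_lim[where f = f and S = S and S' = S' and K = K and L = K])
      (use f K lim T T' calc_norm_le[OF f] calc_norm_le[OF calc_conj[OF f]] in auto)
  then show ?thesis using T that by blast
qed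

section \<open>Operators attached to functions\<close>

definition calculable :: "(real \<Rightarrow> complex) \<Rightarrow> bool"
  where "calculable f \<longleftrightarrow> (\<exists>S S'. calc f S S')"

definition op :: "(real \<Rightarrow> complex) \<Rightarrow> 'a \<Rightarrow> 'a"
  where "op f = (THE S. \<exists>S'. calc f S S')"

lemma op_eq: "calc f S S' \<Longrightarrow> op f = S"
  unfolding op_def using calc_unique by blast

lemma calc_op: "calculable f \<Longrightarrow> calc f (op f) (op (\<lambda>t. cnj (f t)))"
  unfolding calculable_def using op_eq calc_conj by metis

lemma calculable_const: "calculable (\<lambda>_. c)"
  unfolding calculable_def using calc_const by blast

lemma calculable_conj: "calculable f \<Longrightarrow> calculable (\<lambda>t. cnj (f t))"
  unfolding calculable_def by (elim exE) (rule exI, rule exI, erule calc_conj)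

lemma calculable_add: "calculable f \<Longrightarrow> calculable g \<Longrightarrow> calculable (\<lambda>t. f t + g t)"
  unfolding calculable_def by (elim exE) (rule exI, rule exI, erule (1) calc_add)

lemma calculable_mult: "calculable f \<Longrightarrow> calculable g \<Longrightarrow> calculable (\<lambda>t. f t * g t)"
  unfolding calculable_def by (elim exE) (rule exI, rule exI, erule (1) calc_mult)

lemma calculable_diff: "calculable f \<Longrightarrow> calculable g \<Longrightarrow> calculable (\<lambda>t. f t - g t)"
  unfolding calculable_def by (elim exE) (rule exI, rule exI, erule (1) calc_diff)

lemma calculable_sum:
  "(\<And>i. i \<in> I \<Longrightarrow> calculable (f i)) \<Longrightarrow> calculable (\<lambda>t. \<Sum>i\<in>I. f i t)"
  by (induction I rule: infinite_finite_induct) (auto intro: calculable_const calculable_add)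

lemma calculable_limit:
  assumes "\<And>n. calculable (f n)" "\<And>n t. cmod (f n t) \<le> K" "\<And>t. (\<lambda>n. f n t) \<longlonglongrightarrow> g t"
  shows "calculable g" "(\<lambda>n. op (f n) x) \<longlonglongrightarrow> op g x"
proof -
  obtain T T' where "calc g T T'" "\<And>x. (\<lambda>n. op (f n) x) \<longlonglongrightarrow> T x"
    using calc_bounded_limit[OF calc_op[OF assms(1)] assms(2,3)] by blast
  then show "calculable g" "(\<lambda>n. op (f n) x) \<longlonglongrightarrow> op g x"
    using op_eq by (auto simp: calculable_def)
qed

lemma op_linear: "calculable f \<Longrightarrow> clinear_on UNIV (op f)"
  and op_integral: "calculable f \<Longrightarrow> cinner (op f x) x = (LINT t|\<nu> x. f t)"
  and op_norm: "calculable f \<Longrightarrow> (norm (op f x))\<^sup>2 = (LINT t|\<nu> x. (cmod (f t))\<^sup>2)"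
  and op_adjoint: "calculable f \<Longrightarrow> cinner (op f x) y = cinner x (op (\<lambda>t. cnj (f t)) y)"
  and op_tendsto: "calculable f \<Longrightarrow> (v \<longlongrightarrow> l) F \<Longrightarrow> ((\<lambda>n. op f (v n)) \<longlongrightarrow> op f l) F"
  by (rule calc_linear[OF calc_op] calc_integral[OF calc_op] calc_norm[OF calc_op]
      calc_adjoint[OF calc_op] calc_tendsto[OF calc_op]; assumption)+

lemma op_norm_le: "calculable f \<Longrightarrow> (\<And>t. cmod (f t) \<le> K) \<Longrightarrow> norm (op f x) \<le> K * norm x"
  by (rule calc_norm_le[OF calc_op])

lemma op_const: "op (\<lambda>_. c) x = c *\<^sub>C x"
  using op_eq[OF calc_const] by simp

lemma op_add: "calculable f \<Longrightarrow> calculable g \<Longrightarrow> op (\<lambda>t. f t + g t) x = op f x + op g x"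
  and op_diff: "calculable f \<Longrightarrow> calculable g \<Longrightarrow> op (\<lambda>t. f t - g t) x = op f x - op g x"
  and op_mult: "calculable f \<Longrightarrow> calculable g \<Longrightarrow> op (\<lambda>t. f t * g t) x = op f (op g x)"
  using op_eq[OF calc_add[OF calc_op calc_op]] op_eq[OF calc_diff[OF calc_op calc_op]]
    op_eq[OF calc_mult[OF calc_op calc_op]] by auto

lemma op_scale: "calculable f \<Longrightarrow> op (\<lambda>t. c * f t) x = c *\<^sub>C op f x"
  using op_eq[OF calc_scale[OF calc_op]] by auto

lemma op_sum: "(\<And>i. i \<in> I \<Longrightarrow> calculable (f i)) \<Longrightarrow> op (\<lambda>t. \<Sum>i\<in>I. f i t) x = (\<Sum>i\<in>I. op (f i) x)"
  using op_eq[OF calc_sum[OF calc_op], of I f] by auto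

text \<open>Approximation by simple functions dominated by \<open>2 * cmod (f t)\<close>. The map
  \<open>\<phi>\<close> lets one argument serve the circle, with \<open>\<phi> = cis\<close>, and
  the line, with the identity.\<close>

lemma calculable_borel:
  fixes \<phi> :: "real \<Rightarrow> 'c::topological_space"
  assumes ind: "\<And>B. B \<in> sets borel \<Longrightarrow> calculable (\<lambda>t. indicator B (\<phi> t))"
    and f: "f \<in> borel_measurable borel" and K: "\<And>t. cmod (f t) \<le> K"
  shows "calculable (\<lambda>t. f (\<phi> t))"
proof -
  obtain F where F: "\<And>i. simple_function borel (F i)" "\<And>x. (\<lambda>i. F i x) \<longlonglongrightarrow> f x"
    "\<And>i x. dist (F i x) 0 \<le> 2 * dist (f x) 0"
    using borel_measurable_implies_sequence_metric[OF f, of 0] by auto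
  have "calculable (\<lambda>t. F i (\<phi> t))" for i
  proof -
    have fin: "finite (range (F i))" using simple_functionD(1)[OF F(1)[of i]] by simp
    have "F i -` {y} \<in> sets borel" for y using simple_functionD(2)[OF F(1)[of i], of "{y}"] by simp
    then have "calculable (\<lambda>t. \<Sum>y\<in>range (F i). y * indicator (F i -` {y}) (\<phi> t))"
      by (intro calculable_sum calculable_mult calculable_const ind)
    moreover have "(\<Sum>y\<in>range (F i). y * indicator (F i -` {y}) x) = F i x" for x
    proof -
      have "(\<Sum>y\<in>range (F i). y * indicator (F i -` {y}) x) = (\<Sum>y\<in>range (F i). if y = F i x then y else 0)"
        by (intro sum.cong refl) (auto simp: indicator_def)
      then show ?thesis using fin by simp
    qed
    ultimately show ?thesis by simp
  qed
  then show ?thesis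
    by (rule calculable_limit(1)[where K = "2 * K"])
      (use F(2) order_trans[OF F(3) mult_left_mono[of "dist (f _) 0" K 2]] K in auto)
qed

end

section \<open>Borel functions of a unitary operator\<close>

text \<open>Single monomials suffice: they are closed under products and conjugation, and
  \<open>calc\<close> supplies the sums.\<close>

definition unitary_gen ::
    "('a::complex_inner \<Rightarrow> 'a) \<Rightarrow> (real \<Rightarrow> complex) \<Rightarrow> ('a \<Rightarrow> 'a) \<Rightarrow> ('a \<Rightarrow> 'a) \<Rightarrow> bool"
  where "unitary_gen W f S S' \<longleftrightarrow> (\<exists>c k. f = (\<lambda>\<theta>. c * cis (real_of_int k * \<theta>)) \<and>
    S = (\<lambda>x. c *\<^sub>C op_powi W k x) \<and> S' = (\<lambda>x. cnj c *\<^sub>C op_powi W (- k) x))"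

definition herglotz_measure :: "('a::complex_inner \<Rightarrow> 'a) \<Rightarrow> 'a \<Rightarrow> real measure"
  where "herglotz_measure W x = (SOME \<nu>. finite_measure \<nu> \<and> sets \<nu> = sets borel \<and>
    (\<forall>k. (LINT \<theta>|\<nu>. cis (real_of_int k * \<theta>)) = cinner (op_powi W k x) x))"

lemma herglotz_measure:
  assumes "unitary W"
  shows "finite_measure (herglotz_measure W x)" "sets (herglotz_measure W x) = sets borel"
    "(LINT \<theta>|herglotz_measure W x. cis (real_of_int k * \<theta>)) = cinner (op_powi W k x) x"
  using someI_ex[OF herglotz[OF assms, of x]] by (simp_all add: herglotz_measure_def)

locale unitary_operator =
  fixes W :: "'a::chilbert_space \<Rightarrow> 'a"
  assumes unitary: "unitary W"

sublocale unitary_operator \<subseteq> operator_calculus "unitary_gen W" "herglotz_measure W"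
proof (rule operator_calculus.intro)
  note L = unitary_linear[OF unitary_op_powi[OF unitary]]
  fix f S S' x y assume "unitary_gen W f S S'"
  then obtain c k where f: "f = (\<lambda>\<theta>. c * cis (real_of_int k * \<theta>))"
    and S: "S = (\<lambda>x. c *\<^sub>C op_powi W k x)" and S': "S' = (\<lambda>x. cnj c *\<^sub>C op_powi W (- k) x)"
    by (auto simp: unitary_gen_def)
  show "\<exists>K. \<forall>t. cmod (f t) \<le> K" by (auto simp: f norm_mult)
  show "f \<in> borel_measurable borel" unfolding f by measurable
  show "clinear_on UNIV S"
    by (simp add: clinear_on_UNIV_iff S clinear_on_add[OF L] clinear_on_scaleC[OF L]
        scaleC_add_right scaleC_scaleC mult.commute)
  show "\<exists>K. \<forall>x. norm (S x) \<le> K * norm x"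
    by (auto simp: S norm_scaleC unitary_norm[OF unitary_op_powi[OF unitary]])
  show "cinner (S x) y = cinner x (S' y)"
    by (simp add: S S' cinner_scaleC_left cinner_scaleC_right op_powi_adjoint[OF unitary])
  show "cinner (S x) x = (LINT t|herglotz_measure W x. f t)"
    by (simp add: S f cinner_scaleC_left herglotz_measure(3)[OF unitary])
  show "unitary_gen W (\<lambda>t. cnj (f t)) S' S"
    unfolding unitary_gen_def
    by (rule exI[of _ "cnj c"], rule exI[of _ "- k"]) (simp add: f S S' cis_cnj)
  fix g T T' assume "unitary_gen W g T T'"
  then obtain b j where g: "g = (\<lambda>\<theta>. b * cis (real_of_int j * \<theta>))"
    and T: "T = (\<lambda>x. b *\<^sub>C op_powi W j x)" and T': "T' = (\<lambda>x. cnj b *\<^sub>C op_powi W (- j) x)"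
    by (auto simp: unitary_gen_def)
  show "unitary_gen W (\<lambda>t. f t * g t) (S \<circ> T) (T' \<circ> S')"
    unfolding unitary_gen_def
  proof (rule exI[of _ "c * b"], rule exI[of _ "k + j"], intro conjI ext)
    fix t
    have "cis (real_of_int (k + j) * t) = cis (real_of_int k * t) * cis (real_of_int j * t)"
      by (simp add: cis_mult distrib_right)
    then show "f t * g t = c * b * cis (real_of_int (k + j) * t)" by (simp add: f g)
    show "(S \<circ> T) x = (c * b) *\<^sub>C op_powi W (k + j) x" for x
      by (simp add: S T op_powi_add[OF unitary_bij[OF unitary]] clinear_on_scaleC[OF L] scaleC_scaleC)
    have "- (k + j) = - j + - k" by simp
    then show "(T' \<circ> S') x = cnj (c * b) *\<^sub>C op_powi W (- (k + j)) x" for x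
      by (simp only: op_powi_add[OF unitary_bij[OF unitary]])
        (simp add: S' T' clinear_on_scaleC[OF L] scaleC_scaleC mult.commute)
  qed
next
  show "unitary_gen W (\<lambda>_. c) (\<lambda>x. c *\<^sub>C x) (\<lambda>x. cnj c *\<^sub>C x)" for c
    unfolding unitary_gen_def by (rule exI[of _ c], rule exI[of _ 0]) simp
qed (rule herglotz_measure[OF unitary])+

context unitary_operator
begin

lemma calc_cis: "calc (\<lambda>\<theta>. cis (real_of_int k * \<theta>)) (op_powi W k) (op_powi W (- k))"
  by (rule calc_gen, unfold unitary_gen_def, rule exI[of _ 1], rule exI[of _ k]) simp

lemma calculable_cis: "calculable (\<lambda>\<theta>. cis (real_of_int k * \<theta>))"
  using calc_cis by (auto simp: calculable_def)

lemma op_cis: "op (\<lambda>\<theta>. cis (real_of_int k * \<theta>)) = op_powi W k"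
  by (rule op_eq[OF calc_cis])

lemma calc_trig_poly:
  "calc (\<lambda>\<theta>. trig_poly d a (cis \<theta>)) (trig_poly_op d a W)
    (\<lambda>x. \<Sum>k = - int d..int d. cnj (a k) *\<^sub>C op_powi W (- k) x)"
  using calc_sum[of "{- int d..int d}", OF calc_scale[OF calc_cis], of a]
  by (simp add: trig_poly_def trig_poly_op_def[abs_def] cis_power_int)

text \<open>\<open>Re\<close> and \<open>Im\<close> separate the points of the circle and are, along
  \<open>cis\<close>, combinations of \<open>cis\<close> and its conjugate. The real continuous
  functions calculable along \<open>cis\<close> form an algebra, so Stone-Weierstrass gives uniform
  approximation.\<close>

lemma calculable_continuous:
  assumes F: "continuous_on (sphere 0 1) F"
  shows "calculable (\<lambda>\<theta>. complex_of_real (F (cis \<theta>)))"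
proof -
  define P where "P = (\<lambda>f::complex \<Rightarrow> real. continuous_on (sphere 0 1) f \<and> calculable (\<lambda>\<theta>. complex_of_real (f (cis \<theta>))))"
  have cis1: "calculable cis" "calculable (\<lambda>\<theta>. cnj (cis \<theta>))"
    using calculable_cis[of 1] calculable_conj by auto
  have "complex_of_real (Re (cis \<theta>)) = (1/2) * (cis \<theta> + cnj (cis \<theta>))" for \<theta>
    by (simp add: complex_add_cnj)
  moreover have "calculable (\<lambda>\<theta>. (1/2) * (cis \<theta> + cnj (cis \<theta>)))"
    by (intro calculable_mult calculable_const calculable_add cis1)
  ultimately have PRe: "P Re"
    unfolding P_def by (simp only:) (auto intro!: continuous_intros)
  have "complex_of_real (Im (cis \<theta>)) = (1/(2*\<i>)) * (cis \<theta> - cnj (cis \<theta>))" for \<theta>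
    by (simp add: complex_eq_iff)
  moreover have "calculable (\<lambda>\<theta>. (1/(2*\<i>)) * (cis \<theta> - cnj (cis \<theta>)))"
    by (intro calculable_mult calculable_const calculable_diff cis1)
  ultimately have PIm: "P Im"
    unfolding P_def by (simp only:) (auto intro!: continuous_intros)
  have approx: "\<exists>g. P g \<and> (\<forall>x\<in>sphere 0 1. \<bar>F x - g x\<bar> < e)" if "e > 0" for e
  proof (rule Stone_Weierstrass_HOL[of "sphere 0 1" P])
    show "P (\<lambda>x. c)" for c by (simp add: P_def calculable_const)
    show "P (\<lambda>x. f x + g x)" "P (\<lambda>x. f x * g x)" if "P f \<and> P g" for f g
      using that by (auto simp: P_def intro!: continuous_intros calculable_add calculable_mult)
    show "\<exists>f. P f \<and> f x \<noteq> f y" if "x \<in> sphere 0 1 \<and> y \<in> sphere 0 1 \<and> x \<noteq> y" for x y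
      using that PRe PIm complex_eq_iff by metis
  qed (use F that in \<open>auto simp: P_def\<close>)
  then have "\<forall>n. \<exists>g. P g \<and> (\<forall>x\<in>sphere 0 1. \<bar>F x - g x\<bar> < inverse (real (Suc n)))" by simp
  then obtain g where gP: "\<And>n. P (g n)"
    and g: "\<And>n x. x \<in> sphere 0 1 \<Longrightarrow> \<bar>F x - g n x\<bar> < inverse (real (Suc n))" by metis
  have "bounded (F ` sphere 0 1)" by (intro compact_imp_bounded compact_continuous_image F) simp
  then obtain K where K: "\<And>x. x \<in> sphere 0 1 \<Longrightarrow> \<bar>F x\<bar> \<le> K"
    unfolding bounded_iff real_norm_def by blast
  show ?thesis
  proof (rule calculable_limit(1))
    show "calculable (\<lambda>\<theta>. complex_of_real (g n (cis \<theta>)))" for n using gP by (simp add: P_def)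
    show "cmod (complex_of_real (g n (cis \<theta>))) \<le> K + 1" for n \<theta>
    proof -
      have "inverse (real (Suc n)) \<le> 1" by (simp add: field_simps)
      then show ?thesis using g[of "cis \<theta>" n] K[of "cis \<theta>"] by simp
    qed
    show "(\<lambda>n. complex_of_real (g n (cis \<theta>))) \<longlonglongrightarrow> complex_of_real (F (cis \<theta>))" for \<theta>
    proof (intro tendsto_of_real)
      have "(\<lambda>n. g n (cis \<theta>) - F (cis \<theta>)) \<longlonglongrightarrow> 0"
        by (rule Lim_null_comparison[OF always_eventually LIMSEQ_inverse_real_of_nat])
          (use g[of "cis \<theta>"] in \<open>auto simp: abs_minus_commute less_imp_le\<close>)
      then show "(\<lambda>n. g n (cis \<theta>)) \<longlonglongrightarrow> F (cis \<theta>)" by (simp add: LIM_zero_iff)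
    qed
  qed
qed

text \<open>Induction over the sigma-algebra generated by the closed sets, with closed sets reached
  from continuous functions.\<close>

lemma calculable_indicator:
  assumes "B \<in> sets borel"
  shows "calculable (\<lambda>\<theta>. indicator B (cis \<theta>))"
proof -
  have cl: "calculable (\<lambda>\<theta>. indicator C (cis \<theta>))" if C: "closed C" for C :: "complex set"
  proof (cases "C = {}")
    case False
    \<comment> \<open>Powers of a continuous function equal to 1 on \<open>C\<close> and smaller
      than 1 off \<open>C\<close>. The empty set is separated because \<open>infdist\<close> to it
      is 0 by convention.\<close>
    define f where "f = (\<lambda>n (w::complex). (1 / (1 + infdist w C)) ^ n)"
    have pos: "1 + infdist w C > 0" for w using infdist_nonneg[of w C] by linarith
    show ?thesis
    proof (rule calculable_limit(1)[where K = 1])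
      show "calculable (\<lambda>\<theta>. complex_of_real (f n (cis \<theta>)))" for n
        unfolding f_def by (rule calculable_continuous) (intro continuous_intros, use pos less_irrefl in metis)
      show "cmod (complex_of_real (f n (cis \<theta>))) \<le> 1" for n \<theta>
        using infdist_nonneg[of "cis \<theta>" C] by (simp only: f_def norm_of_real) (auto intro!: power_le_one)
      show "(\<lambda>n. complex_of_real (f n (cis \<theta>))) \<longlonglongrightarrow> indicator C (cis \<theta>)" for \<theta>
      proof (cases "cis \<theta> \<in> C")
        case True
        then show ?thesis by (simp add: f_def)
      next
        case notin: False
        then have "infdist (cis \<theta>) C > 0" using C False by (simp add: infdist_pos_not_in_closed)
        then have "(\<lambda>n. f n (cis \<theta>)) \<longlonglongrightarrow> 0" unfolding f_def by (intro LIMSEQ_power_zero) auto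
        from tendsto_of_real[OF this, where 'a = complex] show ?thesis using notin by simp
      qed
    qed
  qed (simp add: calculable_const)
  have "B \<in> sigma_sets UNIV (Collect closed)"
    using assms by (simp add: borel_eq_closed)
  then show ?thesis
  proof (induction rule: sigma_sets.induct)
    case (Basic C)
    then show ?case by (simp add: cl)
  next
    case Empty
    then show ?case by (simp add: calculable_const)
  next
    case (Compl C)
    have "indicator (UNIV - C) w = 1 - (indicator C w :: complex)" for w by (simp add: indicator_def)
    then show ?case by (simp only:) (intro calculable_diff calculable_const Compl.IH)
  next
    case (Union C)
    \<comment> \<open>The sets need not be disjoint, so finite unions are built by
      inclusion-exclusion; their indicators stay bounded by 1.\<close>
    have fin: "calculable (\<lambda>\<theta>. indicator (\<Union>i<n. C i) (cis \<theta>))" for n :: nat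
    proof (induction n)
      case 0
      then show ?case by (simp add: calculable_const)
    next
      case (Suc n)
      have "indicator (\<Union>i<Suc n. C i) (cis \<theta>) = indicator (\<Union>i<n. C i) (cis \<theta>) + indicator (C n) (cis \<theta>)
          - indicator (\<Union>i<n. C i) (cis \<theta>) * (indicator (C n) (cis \<theta>) :: complex)" for \<theta>
        by (auto simp: lessThan_Suc indicator_def)
      then show ?case
        by (simp only:) (intro calculable_diff calculable_add calculable_mult Suc Union.IH)
    qed
    show ?case
      by (rule calculable_limit(1)[OF fin _ LIMSEQ_indicator_UN, where K = 1]) (simp add: indicator_def)
  qed
qed

lemma calculable_cis_borel:
  assumes "F \<in> borel_measurable borel" "\<And>w. cmod (F w) \<le> K"
  shows "calculable (\<lambda>\<theta>. F (cis \<theta>))"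
  by (rule calculable_borel[OF calculable_indicator assms])

end

text \<open>The operator represents \<open>\<theta> \<mapsto> trig_poly d a (cis \<theta>)\<close>,
  which sees the polynomial on the circle only, and the calculus is contractive for the supremum
  norm.\<close>

lemma unitary_von_neumann:
  fixes W :: "'a::chilbert_space \<Rightarrow> 'a"
  assumes "unitary W" and "\<And>\<zeta>. cmod \<zeta> = 1 \<Longrightarrow> cmod (trig_poly d a \<zeta>) \<le> 1"
  shows "norm (trig_poly_op d a W x) \<le> norm x"
proof -
  interpret unitary_operator W by standard (rule assms(1))
  show ?thesis using calc_norm_le[OF calc_trig_poly, of d a 1 x] assms(2) by simp
qed

section \<open>The spectral theorem for self-adjoint operators\<close>

lemma scalar_spectral_measure_eqI:
  assumes N: "finite_measure N" "sets N = sets borel"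
    and eq: "\<And>B. B \<in> sets borel \<Longrightarrow> cinner (E B x) x = of_real (measure N B)"
  shows "scalar_spectral_measure E x = N"
proof -
  have sp: "space N = UNIV" using sets_eq_imp_space_eq[OF N(2)] by simp
  have "scalar_spectral_measure E x = measure_of UNIV (sets borel) (emeasure N)"
    unfolding scalar_spectral_measure_def
  proof (rule measure_of_eq)
    fix B :: "real set" assume "B \<in> sigma_sets UNIV (sets borel)"
    then have "B \<in> sets borel" using sets.sigma_sets_eq[of "borel :: real measure"] by simp
    then show "ennreal (Re (cinner (E B x) x)) = emeasure N B"
      by (simp add: eq finite_measure.emeasure_eq_measure[OF N(1)])
  qed simp
  also have "\<dots> = N" using measure_of_of_measure[of N] by (simp add: N sp)
  finally show ?thesis .
qed

text \<open>
  The value is \<open>- cot (\<theta> / 2)\<close> for \<open>w = cis \<theta>\<close>, and \<open>0\<close> at \<open>w = 1\<close> because of division by zero.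
\<close>

definition cayley_inv :: "complex \<Rightarrow> real"
  where "cayley_inv w = Re (\<i> * (1 + w) / (1 - w))"

lemma cayley_inv_measurable [measurable]: "cayley_inv \<in> borel_measurable borel"
  unfolding cayley_inv_def by measurable

text \<open>On the circle \<open>cnj w = 1 / w\<close>, so \<open>\<i> * (1 + w) / (1 - w)\<close>
  is real there and taking \<open>Re\<close> loses nothing.\<close>

lemma cayley_inv_mult:
  assumes "cmod w = 1" "w \<noteq> 1"
  shows "of_real (cayley_inv w) * (1 - w) = \<i> * (1 + w)"
proof -
  have ww: "w * cnj w = 1" using assms(1) complex_norm_square[of w] by simp
  then have w0: "w \<noteq> 0" by auto
  then have c: "cnj w = 1 / w" using ww by (simp add: eq_divide_eq mult.commute)
  define z where "z = \<i> * (1 + w) / (1 - w)"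
  have "cnj z = z"
    unfolding z_def using assms(2) w0 by (simp add: c field_simps)
  then have "complex_of_real (cayley_inv w) = z"
    unfolding cayley_inv_def z_def[symmetric] by (simp add: complex_eq_iff)
  then show ?thesis using assms(2) by (simp add: z_def)
qed

text \<open>Combines \<open>|1 - w|\<^sup>2 + |1 + w|\<^sup>2 = 4\<close> with the previous
  identity. It makes square integrability of \<open>cayley_inv\<close> equivalent to that of
  \<open>1 / (1 - w)\<close>, the symbol of the inverse of \<open>1 - W\<close>.\<close>

lemma cayley_inv_norm:
  assumes "cmod w = 1" "w \<noteq> 1"
  shows "(cmod (1 / (1 - w)))\<^sup>2 = (1 + (cayley_inv w)\<^sup>2) / 4"
proof -
  have "(cmod (1 - w))\<^sup>2 + (cmod (1 + w))\<^sup>2 = 2 + 2 * (cmod w)\<^sup>2"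
    unfolding cmod_power2 by (simp add: power2_eq_square algebra_simps)
  moreover have "(cmod (1 + w))\<^sup>2 = (cayley_inv w)\<^sup>2 * (cmod (1 - w))\<^sup>2"
    using arg_cong[OF cayley_inv_mult[OF assms], of "\<lambda>z. (cmod z)\<^sup>2"]
    by (simp add: norm_mult power_mult_distrib)
  ultimately have "(cmod (1 - w))\<^sup>2 * (1 + (cayley_inv w)\<^sup>2) = 4"
    using assms(1) by (simp add: algebra_simps)
  then show ?thesis using assms(2) by (simp add: norm_divide power_divide field_simps)
qed

section \<open>Transport of the spectral measure from the circle to the line\<close>

context unitary_operator
begin

lemma op_one_minus: "calculable (\<lambda>\<theta>. 1 - cis \<theta>)" "op (\<lambda>\<theta>. 1 - cis \<theta>) x = x - W x"
proof -
  have "calculable cis" using calculable_cis[of 1] by simp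
  then show "calculable (\<lambda>\<theta>. 1 - cis \<theta>)" by (intro calculable_diff calculable_const)
  have "op cis x = W x" using op_cis[of 1] by simp
  then show "op (\<lambda>\<theta>. 1 - cis \<theta>) x = x - W x"
    using op_diff[OF calculable_const[of 1] \<open>calculable cis\<close>] by (simp add: op_const)
qed

lemma op_one_plus: "calculable (\<lambda>\<theta>. \<i> * (1 + cis \<theta>))" "op (\<lambda>\<theta>. \<i> * (1 + cis \<theta>)) x = \<i> *\<^sub>C (x + W x)"
proof -
  have c: "calculable cis" using calculable_cis[of 1] by simp
  then have p: "calculable (\<lambda>\<theta>. 1 + cis \<theta>)" by (intro calculable_add calculable_const)
  then show "calculable (\<lambda>\<theta>. \<i> * (1 + cis \<theta>))" by (intro calculable_mult calculable_const)
  have "op cis x = W x" using op_cis[of 1] by simp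
  then show "op (\<lambda>\<theta>. \<i> * (1 + cis \<theta>)) x = \<i> *\<^sub>C (x + W x)"
    using op_scale[OF p] op_add[OF calculable_const[of 1] c] by (simp add: op_const)
qed

lemma calculable_point: "calculable (\<lambda>\<theta>. indicator {1} (cis \<theta>))"
  by (rule calculable_indicator) simp

text \<open>
  The spectral projection at the point \<open>1\<close>, which corresponds to infinity on the spectrum of \<open>A\<close>,
  annihilates the range of \<open>1 - W\<close>, that is, the dense domain of \<open>A\<close>.
\<close>

lemma op_point_eq_0:
  assumes dense: "closure (range (\<lambda>y. y - W y)) = UNIV"
  shows "op (\<lambda>\<theta>. indicator {1} (cis \<theta>)) x = 0"
proof -
  have z: "op (\<lambda>\<theta>. indicator {1} (cis \<theta>)) (y - W y) = 0" for y
  proof -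
    have "(\<lambda>\<theta>. indicator {1} (cis \<theta>) * (1 - cis \<theta>)) = (\<lambda>_. 0)" by (auto simp: indicator_def)
    then show ?thesis
      using op_mult[OF calculable_point op_one_minus(1), of y] by (simp add: op_one_minus op_const)
  qed
  have "x \<in> closure (range (\<lambda>y. y - W y))" by (simp add: dense)
  then obtain u where u: "\<And>n. u n \<in> range (\<lambda>y. y - W y)" "u \<longlonglongrightarrow> x"
    unfolding closure_sequential by blast
  have "(\<lambda>n. op (\<lambda>\<theta>. indicator {1} (cis \<theta>)) (u n)) \<longlonglongrightarrow> op (\<lambda>\<theta>. indicator {1} (cis \<theta>)) x"
    by (rule op_tendsto[OF calculable_point u(2)])
  moreover have "op (\<lambda>\<theta>. indicator {1} (cis \<theta>)) (u n) = 0" for n using u(1)[of n] z by auto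
  ultimately show ?thesis by (simp add: LIMSEQ_const_iff)
qed

text \<open>The image of the spectral measure of \<open>W\<close> under the inverse Cayley
  transform. The value \<open>cayley_inv 1 = 0\<close> creates no spurious mass at 0 when
  \<open>1 - W\<close> has dense range, by \<open>op_point_eq_0\<close>.\<close>

definition cayley_pvm :: "real set \<Rightarrow> 'a \<Rightarrow> 'a"
  where "cayley_pvm B = op (\<lambda>\<theta>. indicator B (cayley_inv (cis \<theta>)))"

lemma calculable_cayley:
  assumes F: "F \<in> borel_measurable borel" "\<And>t. cmod (F t) \<le> K"
  shows "calculable (\<lambda>\<theta>. F (cayley_inv (cis \<theta>)))"
  by (rule calculable_cis_borel[where F = "\<lambda>w. F (cayley_inv w)" and K = K])
    (use F in \<open>auto intro: measurable_compose[OF cayley_inv_measurable]\<close>)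

lemma calculable_cayley_indicator:
  "B \<in> sets borel \<Longrightarrow> calculable (\<lambda>\<theta>. indicator B (cayley_inv (cis \<theta>)))"
  by (rule calculable_cayley[where K = 1]) (auto simp: indicator_def)

lemma projection_valued_measure_cayley: "projection_valued_measure cayley_pvm"
  unfolding projection_valued_measure_def
proof (intro conjI ballI allI impI)
  note ci = calculable_cayley_indicator
  fix B :: "real set" assume B: "B \<in> sets borel"
  show "orthogonal_projection (cayley_pvm B)"
    unfolding orthogonal_projection_def
  proof (intro conjI allI)
    show "clinear_on UNIV (cayley_pvm B)" unfolding cayley_pvm_def by (rule op_linear[OF ci[OF B]])
    have "(\<lambda>\<theta>. indicator B (cayley_inv (cis \<theta>)) * indicator B (cayley_inv (cis \<theta>)) :: complex)
        = (\<lambda>\<theta>. indicator B (cayley_inv (cis \<theta>)))" by (auto simp: indicator_def)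
    then show "cayley_pvm B \<circ> cayley_pvm B = cayley_pvm B"
      by (intro ext) (simp only: o_apply cayley_pvm_def op_mult[OF ci[OF B] ci[OF B], symmetric])
    have "cnj (indicator B t) = indicator B t" for t :: real by (simp add: indicator_def)
    then show "cinner (cayley_pvm B x) y = cinner x (cayley_pvm B y)" for x y
      using op_adjoint[OF ci[OF B]] by (simp add: cayley_pvm_def)
  qed
  fix C :: "real set" assume C: "C \<in> sets borel"
  have "(\<lambda>\<theta>. indicator B (cayley_inv (cis \<theta>)) * indicator C (cayley_inv (cis \<theta>)) :: complex)
      = (\<lambda>\<theta>. indicator (B \<inter> C) (cayley_inv (cis \<theta>)))" by (auto simp: indicator_def)
  then show "cayley_pvm (B \<inter> C) = cayley_pvm B \<circ> cayley_pvm C"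
    by (intro ext) (simp only: o_apply cayley_pvm_def op_mult[OF ci[OF B] ci[OF C], symmetric])
next
  show "cayley_pvm {} = (\<lambda>x. 0)" by (simp add: cayley_pvm_def fun_eq_iff op_const)
  show "cayley_pvm UNIV = id" by (simp add: cayley_pvm_def fun_eq_iff op_const)
  fix F :: "nat \<Rightarrow> real set" and x assume F: "range F \<subseteq> sets borel" "disjoint_family F"
  have ci: "calculable (\<lambda>\<theta>. indicator (F i) (cayley_inv (cis \<theta>)))" for i
    by (rule calculable_cayley_indicator) (use F in auto)
  have eq: "(\<Sum>i<n. indicator (F i) t) = (indicator (\<Union>i<n. F i) t :: complex)" for n t
    by (rule indicator_UN_disjoint[symmetric]) (use F in \<open>auto simp: disjoint_family_on_def\<close>)
  have "(\<lambda>n. op (\<lambda>\<theta>. \<Sum>i<n. indicator (F i) (cayley_inv (cis \<theta>))) x) \<longlonglongrightarrow> cayley_pvm (\<Union>n. F n) x"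
    unfolding cayley_pvm_def
  proof (rule calculable_limit(2)[where K = 1])
    show "calculable (\<lambda>\<theta>. \<Sum>i<n. indicator (F i) (cayley_inv (cis \<theta>)))" for n
      by (intro calculable_sum ci)
    show "cmod (\<Sum>i<n. indicator (F i) (cayley_inv (cis \<theta>))) \<le> 1" for n \<theta>
      unfolding eq by (simp add: indicator_def)
    show "(\<lambda>n. \<Sum>i<n. indicator (F i) (cayley_inv (cis \<theta>)) :: complex) \<longlonglongrightarrow> indicator (\<Union>n. F n) (cayley_inv (cis \<theta>))" for \<theta>
      unfolding eq by (rule LIMSEQ_indicator_UN)
  qed
  then show "(\<lambda>n. cayley_pvm (F n) x) sums cayley_pvm (\<Union>n. F n) x"
    by (simp add: sums_def op_sum[OF ci] cayley_pvm_def)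
qed

lemma scalar_spectral_measure_cayley:
  "scalar_spectral_measure cayley_pvm x = distr (herglotz_measure W x) borel (\<lambda>\<theta>. cayley_inv (cis \<theta>))"
proof (rule scalar_spectral_measure_eqI)
  have m: "(\<lambda>\<theta>. cayley_inv (cis \<theta>)) \<in> borel_measurable (herglotz_measure W x)"
    unfolding borel_measurable_\<nu> using borel_measurable_cis_mult[of 1]
    by (intro measurable_compose[OF _ cayley_inv_measurable]) simp
  show "finite_measure (distr (herglotz_measure W x) borel (\<lambda>\<theta>. cayley_inv (cis \<theta>)))"
    by (intro finite_measure.finite_measure_distr finite_\<nu> m)
  show "sets (distr (herglotz_measure W x) borel (\<lambda>\<theta>. cayley_inv (cis \<theta>))) = sets borel" by simp
  fix B :: "real set" assume B: "B \<in> sets borel"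
  let ?C = "(\<lambda>\<theta>. cayley_inv (cis \<theta>)) -` B"
  have C: "?C \<in> sets (herglotz_measure W x)" using measurable_sets[OF m B] by simp
  have "indicator B (cayley_inv (cis \<theta>)) = complex_of_real (indicator ?C \<theta>)" for \<theta>
    by (simp add: indicator_def)
  then have "cinner (cayley_pvm B x) x = (LINT \<theta>|herglotz_measure W x. complex_of_real (indicator ?C \<theta>))"
    unfolding cayley_pvm_def op_integral[OF calculable_cayley_indicator[OF B]] by (simp only:)
  also have "\<dots> = complex_of_real (LINT \<theta>|herglotz_measure W x. indicator ?C \<theta>)"
    by (rule integral_complex_of_real)
  also have "(LINT \<theta>|herglotz_measure W x. indicator ?C \<theta>) = measure (herglotz_measure W x) ?C"
    using C by simp
  also have "\<dots> = measure (distr (herglotz_measure W x) borel (\<lambda>\<theta>. cayley_inv (cis \<theta>))) B"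
    using measure_distr[OF m B] by simp
  finally show "cinner (cayley_pvm B x) x = complex_of_real (measure (distr (herglotz_measure W x) borel (\<lambda>\<theta>. cayley_inv (cis \<theta>))) B)" .
qed

end

text \<open>Two inclusions of domains are needed. For \<open>x = y - W y\<close>, truncations of
  \<open>h\<close> applied to \<open>x\<close> converge to \<open>A x\<close>, which bounds the
  integral of \<open>h\<^sup>2\<close>. Conversely, if \<open>h\<^sup>2\<close> is integrable, then
  \<open>1 / (1 - w)\<close> is square integrable, and truncations of it applied to \<open>x\<close>
  converge to some \<open>y\<close> with \<open>y - W y = x\<close>.\<close>

theorem spectral_theorem:
  fixes D :: "'a::chilbert_space set"
  assumes A: "self_adjoint D A"
  shows "\<exists>E. projection_valued_measure E \<and> is_spectral_integral E complex_of_real D A"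
proof -
  obtain W where W: "unitary W" and D: "D = range (\<lambda>y. y - W y)" and AW: "\<And>y. A (y - W y) = \<i> *\<^sub>C (y + W y)"
    using cayley_transform[OF A] by blast
  interpret unitary_operator W by standard (rule W)
  define h where "h = (\<lambda>\<theta>. cayley_inv (cis \<theta>))"
  let ?\<nu> = "herglotz_measure W"
  have hb [measurable]: "h \<in> borel_measurable borel"
    unfolding h_def using borel_measurable_cis_mult[of 1]
    by (intro measurable_compose[OF _ cayley_inv_measurable]) simp
  then have hm [measurable]: "h \<in> borel_measurable (?\<nu> x)" for x unfolding borel_measurable_\<nu> .
  \<comment> \<open>The last factor absorbs the default value of \<open>h\<close> where
    \<open>cis \<theta> = 1\<close>; there the left side is 0.\<close>
  have cish: "of_real (h \<theta>) * (1 - cis \<theta>) = \<i> * (1 + cis \<theta>) * (1 - indicator {1} (cis \<theta>))" for \<theta>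
    using cayley_inv_mult[of "cis \<theta>"] by (cases "cis \<theta> = 1") (auto simp: h_def)
  have point: "op (\<lambda>\<theta>. indicator {1} (cis \<theta>)) x = 0" for x
    by (rule op_point_eq_0) (use A D in \<open>simp add: self_adjoint_def\<close>)
  have cpt: "calculable (\<lambda>\<theta>. 1 - indicator {1} (cis \<theta>))"
    by (intro calculable_diff calculable_const calculable_point)
  have pt: "op (\<lambda>\<theta>. 1 - indicator {1} (cis \<theta>)) x = x" for x
    using op_diff[OF calculable_const[of 1] calculable_point, of x] by (simp add: op_const point)
  have iw: "op (\<lambda>\<theta>. \<i> * (1 + cis \<theta>) * (1 - indicator {1} (cis \<theta>))) x = \<i> *\<^sub>C (x + W x)" for x
    using op_mult[OF op_one_plus(1) cpt] by (simp add: pt op_one_plus)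
  \<comment> \<open>The calculus covers bounded functions only, so \<open>h\<close> is cut off at
    height \<open>n\<close>.\<close>
  define h' where "h' = (\<lambda>(n::nat) \<theta>. h \<theta> * indicator {-real n..real n} (h \<theta>))"
  have h'm [measurable]: "h' n \<in> borel_measurable borel" for n unfolding h'_def by measurable
  have h'le: "\<bar>h' n \<theta>\<bar> \<le> real n" "\<bar>h' n \<theta>\<bar> \<le> \<bar>h \<theta>\<bar>" for n \<theta> by (auto simp: h'_def indicator_def)
  have h'lim: "(\<lambda>n. h' n \<theta>) \<longlonglongrightarrow> h \<theta>" for \<theta>
  proof (rule tendsto_eventually)
    obtain N :: nat where "\<bar>h \<theta>\<bar> \<le> real N" using real_arch_simple by blast
    then show "\<forall>\<^sub>F n in sequentially. h' n \<theta> = h \<theta>"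
      by (intro eventually_mono[OF eventually_ge_at_top[of N]]) (auto simp: h'_def indicator_def)
  qed
  have ch': "calculable (\<lambda>\<theta>. complex_of_real (h' n \<theta>))" for n
    unfolding h'_def h_def
    by (rule calculable_cayley[where K = "real n" and F = "\<lambda>t. complex_of_real (t * indicator {-real n..real n} t)"])
      (auto simp: indicator_def)
  have domain: "integrable (?\<nu> x) (\<lambda>\<theta>. (h \<theta>)\<^sup>2) \<and> (LINT \<theta>|?\<nu> x. complex_of_real (h \<theta>)) = cinner (A x) x"
    if x: "x = y - W y" for x y
  proof -
    have opx: "op (\<lambda>\<theta>. of_real (h' n \<theta>)) x = op (\<lambda>\<theta>. of_real (h' n \<theta>) * (1 - cis \<theta>)) y" for n
      unfolding x using op_mult[OF ch' op_one_minus(1)] by (simp add: op_one_minus)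
    \<comment> \<open>Although \<open>h\<close> is unbounded, \<open>h * (1 - cis)\<close> is
      bounded, so the bounded limit theorem applies to \<open>y\<close> in place of
      \<open>x\<close>.\<close>
    have "(\<lambda>n. op (\<lambda>\<theta>. of_real (h' n \<theta>) * (1 - cis \<theta>)) y)
        \<longlonglongrightarrow> op (\<lambda>\<theta>. \<i> * (1 + cis \<theta>) * (1 - indicator {1} (cis \<theta>))) y"
    proof (rule calculable_limit(2)[where K = 4])
      show "calculable (\<lambda>\<theta>. of_real (h' n \<theta>) * (1 - cis \<theta>))" for n
        by (intro calculable_mult ch' op_one_minus(1))
      show "cmod (of_real (h' n \<theta>) * (1 - cis \<theta>)) \<le> 4" for n \<theta>
      proof -
        have "cmod (of_real (h' n \<theta>) * (1 - cis \<theta>)) \<le> cmod (of_real (h \<theta>) * (1 - cis \<theta>))"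
          unfolding norm_mult norm_of_real by (intro mult_right_mono h'le) simp
        also have "\<dots> \<le> 1 * 2 * 2"
          unfolding cish norm_mult
          using norm_triangle_ineq[of 1 "cis \<theta>"] norm_triangle_ineq4[of 1 "indicator {1} (cis \<theta>) :: complex"]
          by (intro mult_mono) (auto simp: indicator_def)
        finally show ?thesis by simp
      qed
      show "(\<lambda>n. of_real (h' n \<theta>) * (1 - cis \<theta>)) \<longlonglongrightarrow> \<i> * (1 + cis \<theta>) * (1 - indicator {1} (cis \<theta>))" for \<theta>
        unfolding cish[symmetric] by (intro tendsto_mult tendsto_const tendsto_of_real h'lim)
    qed
    moreover have "A x = \<i> *\<^sub>C (y + W y)" unfolding x by (rule AW)
    ultimately have lim: "(\<lambda>n. op (\<lambda>\<theta>. of_real (h' n \<theta>)) x) \<longlonglongrightarrow> A x"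
      by (simp only: opx iw)
    have int2: "integrable (?\<nu> x) (\<lambda>\<theta>. (h \<theta>)\<^sup>2)"
    proof (rule integrable_monotone_convergence)
      show "integrable (?\<nu> x) (\<lambda>\<theta>. (h' n \<theta>)\<^sup>2)" for n
        by (rule integrable_bounded[where K = "(real n)\<^sup>2"]) (auto simp: abs_le_square_iff[symmetric] h'le)
      show "AE \<theta> in ?\<nu> x. mono (\<lambda>n. (h' n \<theta>)\<^sup>2)"
        by (auto simp: mono_def h'_def indicator_def)
      show "AE \<theta> in ?\<nu> x. (\<lambda>n. (h' n \<theta>)\<^sup>2) \<longlonglongrightarrow> (h \<theta>)\<^sup>2"
        by (auto intro!: tendsto_power h'lim)
      have "(LINT \<theta>|?\<nu> x. (h' n \<theta>)\<^sup>2) = (norm (op (\<lambda>\<theta>. of_real (h' n \<theta>)) x))\<^sup>2" for n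
        unfolding op_norm[OF ch'] by simp
      then show "(\<lambda>n. LINT \<theta>|?\<nu> x. (h' n \<theta>)\<^sup>2) \<longlonglongrightarrow> (norm (A x))\<^sup>2"
        by (simp only:) (intro tendsto_power tendsto_norm lim)
    qed measurable
    moreover have "(LINT \<theta>|?\<nu> x. complex_of_real (h \<theta>)) = cinner (A x) x"
    proof (rule LIMSEQ_unique)
      have "integrable (?\<nu> x) h"
        by (rule finite_measure.square_integrable_imp_integrable[OF finite_\<nu> _ int2]) measurable
      then have "(\<lambda>n. LINT \<theta>|?\<nu> x. complex_of_real (h' n \<theta>)) \<longlonglongrightarrow> (LINT \<theta>|?\<nu> x. complex_of_real (h \<theta>))"
        by (intro integral_dominated_convergence[where w = "\<lambda>\<theta>. \<bar>h \<theta>\<bar>"])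
          (auto simp: h'le borel_measurable_\<nu> intro!: tendsto_of_real h'lim)
      then show "(\<lambda>n. cinner (op (\<lambda>\<theta>. of_real (h' n \<theta>)) x) x) \<longlonglongrightarrow> (LINT \<theta>|?\<nu> x. complex_of_real (h \<theta>))"
        unfolding op_integral[OF ch'] .
      show "(\<lambda>n. cinner (op (\<lambda>\<theta>. of_real (h' n \<theta>)) x) x) \<longlonglongrightarrow> cinner (A x) x"
        by (intro cinner.tendsto lim tendsto_const)
    qed
    ultimately show ?thesis by blast
  qed
  have range: "x \<in> D" if int: "integrable (?\<nu> x) (\<lambda>\<theta>. (h \<theta>)\<^sup>2)" for x
  proof -
    define g where "g = (\<lambda>w::complex. 1 / (1 - w))"
    \<comment> \<open>The bound on \<open>g\<close> in terms of \<open>cayley_inv\<close> holds on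
      the circle only; the sphere indicator makes \<open>g'\<close> bounded on the whole plane, as
      \<open>calculable_cis_borel\<close> requires.\<close>
    define g' where "g' = (\<lambda>(n::nat) w. g w * indicator {-real n..real n} (cayley_inv w) * indicator (sphere 0 1) w)"
    have gm [measurable]: "g \<in> borel_measurable borel" unfolding g_def by measurable
    have [measurable]: "sphere (0::complex) 1 \<in> sets borel" by (intro borel_closed closed_sphere)
    have g'm [measurable]: "g' n \<in> borel_measurable borel" for n unfolding g'_def by measurable
    have gle: "cmod (g w) \<le> 1 + \<bar>cayley_inv w\<bar>" if "cmod w = 1" for w
    proof (cases "w = 1")
      case False
      have "(cmod (g w))\<^sup>2 \<le> (1 + \<bar>cayley_inv w\<bar>)\<^sup>2"
        unfolding g_def cayley_inv_norm[OF that False] by (simp add: power2_sum)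
      then show ?thesis by (rule power2_le_imp_le) simp
    qed (simp add: g_def)
    have g'le: "cmod (g' n w) \<le> 1 + real n" for n w
      using gle[of w] by (auto simp: g'_def indicator_def)
    have cg: "calculable (\<lambda>\<theta>. g' n (cis \<theta>))" for n
      by (rule calculable_cis_borel[OF g'm g'le])
    have g'lim: "(\<lambda>n. g' n (cis \<theta>)) \<longlonglongrightarrow> g (cis \<theta>)" for \<theta>
    proof (rule tendsto_eventually)
      obtain N :: nat where "\<bar>h \<theta>\<bar> \<le> real N" using real_arch_simple by blast
      then show "\<forall>\<^sub>F n in sequentially. g' n (cis \<theta>) = g (cis \<theta>)"
        by (intro eventually_mono[OF eventually_ge_at_top[of N]]) (auto simp: g'_def h_def indicator_def)
    qed
    have "convergent (\<lambda>n. op (\<lambda>\<theta>. g' n (cis \<theta>)) x)"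
    proof (rule convergent_of_L2_dominated[where N = "?\<nu> x" and f = "\<lambda>n \<theta>. g' n (cis \<theta>)"
          and g = "\<lambda>\<theta>. g (cis \<theta>)" and w = "\<lambda>\<theta>. 1 + \<bar>h \<theta>\<bar>"])
      show "(dist (op (\<lambda>\<theta>. g' n (cis \<theta>)) x) (op (\<lambda>\<theta>. g' m (cis \<theta>)) x))\<^sup>2
          \<le> (LINT t|?\<nu> x. (cmod (g' n (cis t) - g' m (cis t)))\<^sup>2)" for n m
        using op_norm[OF calculable_diff[OF cg cg]] by (simp add: dist_norm op_diff[OF cg cg])
      show "(\<lambda>\<theta>. g' n (cis \<theta>)) \<in> borel_measurable (?\<nu> x)" for n
        unfolding borel_measurable_\<nu> by (rule calc_measurable[OF calc_op[OF cg]])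
      show "cmod (g' n (cis \<theta>)) \<le> 1 + \<bar>h \<theta>\<bar>" for n \<theta>
        using gle[of "cis \<theta>"] by (auto simp: g'_def h_def indicator_def)
      have "integrable (?\<nu> x) h"
        by (rule finite_measure.square_integrable_imp_integrable[OF finite_\<nu> _ int]) measurable
      then have "integrable (?\<nu> x) (\<lambda>\<theta>. 1 + 2 * \<bar>h \<theta>\<bar> + (h \<theta>)\<^sup>2)"
        using int integrable_bounded[of "\<lambda>_. 1::real" 1 x] by auto
      then show "integrable (?\<nu> x) (\<lambda>\<theta>. (1 + \<bar>h \<theta>\<bar>)\<^sup>2)" by (simp add: power2_sum algebra_simps)
    qed (use g'lim in auto)
    then obtain y where y: "(\<lambda>n. op (\<lambda>\<theta>. g' n (cis \<theta>)) x) \<longlonglongrightarrow> y" by (auto simp: convergent_def)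
    \<comment> \<open>On the circle \<open>(1 - w) * g w\<close> is 1 except at
      \<open>w = 1\<close>, which carries no spectral mass, so the limit operator is the
      identity.\<close>
    have "(\<lambda>n. op (\<lambda>\<theta>. (1 - cis \<theta>) * g' n (cis \<theta>)) x) \<longlonglongrightarrow> op (\<lambda>\<theta>. 1 - indicator {1} (cis \<theta>)) x"
    proof (rule calculable_limit(2)[where K = 1])
      show "calculable (\<lambda>\<theta>. (1 - cis \<theta>) * g' n (cis \<theta>))" for n
        by (intro calculable_mult op_one_minus(1) cg)
      show "cmod ((1 - cis \<theta>) * g' n (cis \<theta>)) \<le> 1" for n \<theta>
        by (auto simp: g'_def g_def indicator_def)
      have "(1 - cis \<theta>) * g (cis \<theta>) = 1 - indicator {1} (cis \<theta>)" for \<theta>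
        by (auto simp: g_def indicator_def)
      then show "(\<lambda>n. (1 - cis \<theta>) * g' n (cis \<theta>)) \<longlonglongrightarrow> 1 - indicator {1} (cis \<theta>)" for \<theta>
        using tendsto_mult[OF tendsto_const[of "1 - cis \<theta>"] g'lim[of \<theta>]] by simp
    qed
    then have "(\<lambda>n. op (\<lambda>\<theta>. 1 - cis \<theta>) (op (\<lambda>\<theta>. g' n (cis \<theta>)) x)) \<longlonglongrightarrow> x"
      by (simp only: op_mult[OF op_one_minus(1) cg] pt)
    moreover have "(\<lambda>n. op (\<lambda>\<theta>. 1 - cis \<theta>) (op (\<lambda>\<theta>. g' n (cis \<theta>)) x)) \<longlonglongrightarrow> op (\<lambda>\<theta>. 1 - cis \<theta>) y"
      by (rule op_tendsto[OF op_one_minus(1) y])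
    ultimately have "x = y - W y" unfolding op_one_minus(2) by (rule LIMSEQ_unique)
    then show ?thesis by (auto simp: D)
  qed
  have meas: "h \<in> measurable (?\<nu> x) borel" for x by (rule hm)
  have idist: "integrable (scalar_spectral_measure cayley_pvm x) (\<lambda>t. (cmod (complex_of_real t))\<^sup>2)
      \<longleftrightarrow> integrable (?\<nu> x) (\<lambda>\<theta>. (h \<theta>)\<^sup>2)" for x
    unfolding scalar_spectral_measure_cayley h_def[symmetric]
    by (subst integrable_distr_eq) auto
  have "is_spectral_integral cayley_pvm complex_of_real D A"
    unfolding is_spectral_integral_def
  proof (intro conjI ballI)
    show "clinear_on D A" by (rule self_adjoint_linear[OF A])
    show "D = {x. integrable (scalar_spectral_measure cayley_pvm x) (\<lambda>t. (cmod (complex_of_real t))\<^sup>2)}"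
      unfolding idist using domain range D by blast
    fix x assume "x \<in> D"
    then obtain y where "x = y - W y" using D by blast
    then have "(LINT \<theta>|?\<nu> x. complex_of_real (h \<theta>)) = cinner (A x) x" using domain by blast
    then show "cinner (A x) x = (CLINT t|scalar_spectral_measure cayley_pvm x. complex_of_real t)"
      unfolding scalar_spectral_measure_cayley h_def[symmetric]
      by (subst integral_distr) auto
  qed
  then show ?thesis using projection_valued_measure_cayley by blast
qed

section \<open>Interpolation of finite differences\<close>

lemma cis_neq_1:
  assumes "0 < \<bar>t\<bar>" "\<bar>t\<bar> < 2 * pi" shows "cis t \<noteq> 1"
proof
  assume "cis t = 1"
  then have "cos t = 1" by (simp add: complex_eq_iff)
  then have "cos (2 * (\<bar>t\<bar> / 2)) = 1" by simp
  then have "sin (\<bar>t\<bar> / 2) = 0" unfolding cos_double_sin by simp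
  moreover have "sin (\<bar>t\<bar> / 2) > 0" using assms by (intro sin_gt_zero) auto
  ultimately show False by simp
qed

text \<open>For \<open>k < 2 n\<close> these are the zeros of \<open>cos (n t)\<close> in one
  period, where \<open>sin (n t)\<close> alternates between 1 and -1.\<close>

definition node :: "nat \<Rightarrow> nat \<Rightarrow> real"
  where "node n k = (2 * real k + 1) * pi / (2 * real n)"

lemma node_mult: "n \<ge> 1 \<Longrightarrow> real n * node n k = real k * pi + pi / 2"
  by (simp add: node_def field_simps)

lemma sin_node: "n \<ge> 1 \<Longrightarrow> sin (real n * node n k) = (-1) ^ k"
  and cos_node: "n \<ge> 1 \<Longrightarrow> cos (real n * node n k) = 0"
  by (simp_all add: node_mult sin_add cos_add cos_npi)

definition node_sum :: "nat \<Rightarrow> int \<Rightarrow> complex"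
  where "node_sum n r = (\<Sum>k<2*n. cis (of_int r * node n k))"

lemma node_sum_0: "node_sum n 0 = 2 * of_nat n"
  by (simp add: node_sum_def)

text \<open>A geometric sum over a full period whose ratio is a nontrivial \<open>2n\<close>-th root
  of unity.\<close>

lemma node_sum_eq_0:
  assumes n: "n \<ge> 1" and r: "r \<noteq> 0" "\<bar>r\<bar> < 2 * int n"
  shows "node_sum n r = 0"
proof -
  define z where "z = cis (of_int r * pi / real n)"
  have "cis (of_int r * node n k) = cis (of_int r * pi / (2 * real n)) * z ^ k" for k
  proof -
    have "of_int r * node n k = of_int r * pi / (2 * real n) + real k * (of_int r * pi / real n)"
      using n by (simp add: node_def field_simps)
    then show ?thesis unfolding z_def by (simp only: Complex.DeMoivre cis_mult)
  qed
  then have "node_sum n r = cis (of_int r * pi / (2 * real n)) * (\<Sum>k<2*n. z ^ k)"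
    unfolding node_sum_def by (simp add: sum_distrib_left)
  moreover have "z \<noteq> 1"
    unfolding z_def
  proof (rule cis_neq_1)
    have "\<bar>real_of_int r\<bar> * pi < 2 * real n * pi"
    proof (rule mult_strict_right_mono)
      show "\<bar>real_of_int r\<bar> < 2 * real n" using r(2) by linarith
    qed simp
    then show "\<bar>of_int r * pi / real n\<bar> < 2 * pi"
      using n by (simp add: abs_mult field_simps)
    show "0 < \<bar>of_int r * pi / real n\<bar>" using r n by simp
  qed
  moreover have "z ^ (2 * n) = 1"
  proof -
    have "real (2 * n) * (of_int r * pi / real n) = 2 * pi * of_int r" using n by (simp add: field_simps)
    then have "z ^ (2 * n) = cis (2 * pi * of_int r)" unfolding z_def by (simp only: Complex.DeMoivre)
    then show ?thesis using cis_multiple_2pi[of "of_int r"] by simp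
  qed
  ultimately show ?thesis by (simp add: sum_gp_strict)
qed

text \<open>Aliasing at frequency \<open>2n\<close>: every term is
  \<open>cis ((2 k + 1) * pi)\<close> or its conjugate, and the half-step offset of the nodes turns
  the sign negative.\<close>

lemma node_sum_2n:
  assumes n: "n \<ge> 1" and r: "\<bar>r\<bar> = 2 * int n"
  shows "node_sum n r = - 2 * of_nat n"
proof -
  have "cis (of_int r * node n k) = -1" for k
  proof -
    have c: "cis (2 * (real n * node n k)) = -1"
      using cis_multiple_2pi[of "real k"]
      by (simp add: node_mult[OF n] distrib_left cis_mult[symmetric] mult_ac)
    have "r = 2 * int n \<or> r = - (2 * int n)" using r by linarith
    then have "of_int r * node n k = 2 * (real n * node n k) \<or> of_int r * node n k = - (2 * (real n * node n k))" by auto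
    moreover have "cis (- (2 * (real n * node n k))) = -1" using arg_cong[OF c, of cnj] by (simp add: cis_cnj)
    ultimately show ?thesis using c by metis
  qed
  then show ?thesis by (simp add: node_sum_def)
qed

text \<open>
  The weights of the interpolation formula \<open>p (\<tau> + \<alpha>) - p (\<tau> - \<alpha>) = (\<Sum>k<2n. c\<^sub>k p (\<tau> + \<tau>\<^sub>k))\<close> for
  trigonometric polynomials of degree \<open>n\<close>, a finite difference analogue of the interpolation
  formula of M. Riesz.  They are the discrete Fourier coefficients of the multiplier
  \<open>2 i sin (l \<alpha>)\<close>; the nodes make its values at \<open>l = n\<close> and \<open>l = - n\<close> compatible.
\<close>

definition weight :: "nat \<Rightarrow> real \<Rightarrow> nat \<Rightarrow> real"
  where "weight n \<alpha> k = ((\<Sum>j=1..<n. 2 * sin (real j * \<alpha>) * sin (real j * node n k))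
    + sin (real n * \<alpha>) * sin (real n * node n k)) / real n"

lemma sum_sin_node:
  "(\<Sum>k<2*n. complex_of_real (sin (real j * node n k)) * cis (of_int l * node n k))
    = (node_sum n (l + int j) - node_sum n (l - int j)) / (2 * \<i>)"
proof -
  have "complex_of_real (sin (real j * t)) * cis (of_int l * t)
      = (cis (of_int (l + int j) * t) - cis (of_int (l - int j) * t)) / (2 * \<i>)" for t
  proof -
    have "complex_of_real (sin (real j * t)) = (cis (real j * t) - cis (- (real j * t))) / (2 * \<i>)"
      by (simp add: complex_eq_iff)
    moreover have "cis (of_int (l + int j) * t) = cis (real j * t) * cis (of_int l * t)"
      "cis (of_int (l - int j) * t) = cis (- (real j * t)) * cis (of_int l * t)"
      by (simp_all add: cis_mult algebra_simps)
    ultimately show ?thesis by (simp add: left_diff_distrib diff_divide_distrib)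
  qed
  then show ?thesis
    unfolding node_sum_def by (simp only: sum_subtractf[symmetric] sum_divide_distrib)
qed

text \<open>Discrete orthogonality of sines: the sum against \<open>sin (j t)\<close> detects
  \<open>l = j\<close> and \<open>l = - j\<close> with opposite signs.\<close>

lemma weight_interpolation:
  assumes n: "n \<ge> 1" and l: "\<bar>l\<bar> \<le> int n"
  shows "(\<Sum>k<2*n. complex_of_real (weight n \<alpha> k) * cis (of_int l * node n k)) = 2 * \<i> * of_real (sin (of_int l * \<alpha>))"
proof -
  let ?s = "\<lambda>j. \<Sum>k<2*n. complex_of_real (sin (real j * node n k)) * cis (of_int l * node n k)"
  let ?\<delta> = "\<lambda>j. (if l = int j then 1 else 0) - (if l = - int j then 1 else (0::complex))"
  have s1: "?s j = \<i> * of_nat n * ?\<delta> j" if j: "1 \<le> j" "j < n" for j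
  proof -
    have "l + int j = 0 \<or> node_sum n (l + int j) = 0" "l - int j = 0 \<or> node_sum n (l - int j) = 0"
      using node_sum_eq_0[OF n, of "l + int j"] node_sum_eq_0[OF n, of "l - int j"] l j by linarith+
    then show ?thesis unfolding sum_sin_node using j
      by (auto simp: node_sum_0 complex_eq_iff add_eq_0_iff) 
  qed
  \<comment> \<open>At \<open>j = n\<close> and \<open>l = n\<close> or \<open>l = - n\<close>, both
    node sums contribute with opposite values, which doubles the result; the last term of
    \<open>weight\<close> lacks the factor 2 for this reason.\<close>
  have s2: "?s n = 2 * \<i> * of_nat n * ?\<delta> n"
  proof -
    consider "l = int n" | "l = - int n" | "\<bar>l\<bar> < int n" using l by linarith
    then show ?thesis
    proof cases
      case 1
      then have "node_sum n (l + int n) = - 2 * of_nat n" by (intro node_sum_2n n) simp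
      then show ?thesis unfolding sum_sin_node using 1 n by (simp add: node_sum_0 complex_eq_iff)
    next
      case 2
      then have "node_sum n (l - int n) = - 2 * of_nat n" by (intro node_sum_2n n) simp
      then show ?thesis unfolding sum_sin_node using 2 n by (simp add: node_sum_0 complex_eq_iff)
    next
      case 3
      then have "node_sum n (l + int n) = 0" "node_sum n (l - int n) = 0"
        by (intro node_sum_eq_0 n; linarith)+
      then show ?thesis unfolding sum_sin_node using 3 by auto
    qed
  qed
  have n0: "complex_of_nat n \<noteq> 0" using n by simp
  have w: "complex_of_real (weight n \<alpha> k) = (\<Sum>j=1..<n. of_real (2 * sin (real j * \<alpha>) / real n) * complex_of_real (sin (real j * node n k)))
      + of_real (sin (real n * \<alpha>) / real n) * complex_of_real (sin (real n * node n k))" for k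
    by (simp add: weight_def add_divide_distrib sum_divide_distrib)
  have "(\<Sum>k<2*n. complex_of_real (weight n \<alpha> k) * cis (of_int l * node n k))
      = (\<Sum>j=1..<n. of_real (2 * sin (real j * \<alpha>) / real n) * ?s j) + of_real (sin (real n * \<alpha>) / real n) * ?s n"
    unfolding w distrib_right sum.distrib sum_distrib_right sum_distrib_left
    by (subst sum.swap) (simp add: mult.assoc)
  also have "\<dots> = (\<Sum>j=1..<n. 2 * \<i> * (of_real (sin (real j * \<alpha>)) * ?\<delta> j)) + 2 * \<i> * (of_real (sin (real n * \<alpha>)) * ?\<delta> n)"
    unfolding s2 by (intro arg_cong2[of _ _ _ _ "(+)"] sum.cong refl) (use n0 in \<open>simp_all only: s1 atLeastLessThan_iff, simp_all\<close>)
  also have "\<dots> = 2 * \<i> * (\<Sum>j=1..n. of_real (sin (real j * \<alpha>)) * ?\<delta> j)"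
  proof -
    have "{1..n} = insert n {1..<n}" using n by auto
    then show ?thesis by (simp add: sum_distrib_left distrib_left)
  qed
  also have "(\<Sum>j=1..n. of_real (sin (real j * \<alpha>)) * ?\<delta> j) = complex_of_real (sin (of_int l * \<alpha>))"
  proof -
    consider "l = 0" | p where "l = int p" "1 \<le> p" "p \<le> n" | p where "l = - int p" "1 \<le> p" "p \<le> n"
      using l that(2)[of "nat l"] that(3)[of "nat (-l)"] by linarith
    then show ?thesis
    proof cases
      case 1
      then show ?thesis by (intro trans[OF sum.neutral]) auto
    next
      case (2 p)
      then have "(\<Sum>j=1..n. of_real (sin (real j * \<alpha>)) * ?\<delta> j) = (\<Sum>j=1..n. if p = j then complex_of_real (sin (real j * \<alpha>)) else 0)"
        by (intro sum.cong) auto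
      then show ?thesis using 2 by simp
    next
      case (3 p)
      then have "(\<Sum>j=1..n. of_real (sin (real j * \<alpha>)) * ?\<delta> j) = (\<Sum>j=1..n. if p = j then - complex_of_real (sin (real j * \<alpha>)) else 0)"
        by (intro sum.cong) auto
      then show ?thesis using 3 by simp
    qed
  qed
  finally show ?thesis .
qed

text \<open>A Dirichlet-type kernel. Halving the last term produces the product
  \<open>sin (n x) * cot (x / 2)\<close>, whose first factor is explicit at shifted nodes.\<close>

lemma sin_half_mult_sum_cos:
  assumes "n \<ge> 1"
  shows "2 * sin (x / 2) * ((\<Sum>j=1..<n. cos (real j * x)) + cos (real n * x) / 2)
    = sin (real n * x) * cos (x / 2) - sin (x / 2)"
  using assms
proof (induction n rule: nat_induct_at_least)
  case base
  have s: "sin x = 2 * sin (x / 2) * cos (x / 2)" and c: "cos x = 2 * (cos (x / 2))\<^sup>2 - 1"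
    using sin_double[of "x / 2"] cos_double_cos[of "x / 2"] by simp_all
  show ?case by (simp add: s c power2_eq_square field_simps)
next
  case (Suc n)
  have x: "x = x / 2 + x / 2" by simp
  have "sin (real (Suc n) * x) * cos (x / 2) - cos (real (Suc n) * x) * sin (x / 2)
      = sin (real (Suc n) * x - x / 2)" by (simp add: sin_diff)
  also have "real (Suc n) * x - x / 2 = real n * x + x / 2" by (simp add: algebra_simps)
  also have "sin (real n * x + x / 2) = sin (real n * x) * cos (x / 2) + cos (real n * x) * sin (x / 2)"
    by (simp add: sin_add)
  finally have "sin (real (Suc n) * x) * cos (x / 2) - cos (real (Suc n) * x) * sin (x / 2)
      = sin (real n * x) * cos (x / 2) + cos (real n * x) * sin (x / 2)" .
  moreover have "(\<Sum>j=1..<Suc n. cos (real j * x)) = (\<Sum>j=1..<n. cos (real j * x)) + cos (real n * x)"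
    using Suc.hyps by simp
  ultimately show ?case using Suc.IH by (simp add: algebra_simps)
qed

text \<open>Up to the factor \<open>n\<close>, the weight is a difference of kernel values at
  \<open>node n k - \<alpha>\<close> and \<open>node n k + \<alpha>\<close>. There
  \<open>sin (n x)\<close> takes the common value \<open>(-1) ^ k * cos (n * \<alpha>)\<close>, and
  what remains is a difference of cotangents, nonnegative because both points lie in
  \<open>(0, 2 \<pi>)\<close>.\<close>

lemma weight_sign:
  assumes n: "n \<ge> 1" and k: "k < 2 * n" and \<alpha>: "0 \<le> \<alpha>" "real n * \<alpha> < pi / 2"
  shows "0 \<le> (-1) ^ k * weight n \<alpha> k"
proof -
  define T where "T = (\<lambda>x. (\<Sum>j=1..<n. cos (real j * x)) + cos (real n * x) / 2)"
  define u where "u = node n k - \<alpha>"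
  define v where "v = node n k + \<alpha>"
  have n0: "real n > 0" using n by simp
  have "\<alpha> < pi / (2 * real n)" using \<alpha>(2) n0 by (simp add: field_simps)
  moreover have "pi / (2 * real n) \<le> node n k"
    unfolding node_def by (intro divide_right_mono) (auto simp: algebra_simps)
  moreover have "node n k \<le> 2 * pi - pi / (2 * real n)"
  proof -
    have "(2 * real k + 1) * pi \<le> (4 * real n - 1) * pi" using k by (intro mult_right_mono) auto
    then have "node n k \<le> (4 * real n - 1) * pi / (2 * real n)"
      unfolding node_def by (intro divide_right_mono) auto
    also have "\<dots> = 2 * pi - pi / (2 * real n)" using n0 by (simp add: field_simps)
    finally show ?thesis .
  qed
  ultimately have uv: "0 < u" "u \<le> v" "v < 2 * pi" using \<alpha>(1) by (auto simp: u_def v_def)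
  have su: "sin (u / 2) > 0" and sv: "sin (v / 2) > 0" using uv by (auto intro!: sin_gt_zero)
  have s\<alpha>: "sin \<alpha> \<ge> 0"
  proof (rule sin_ge_zero)
    have "1 * \<alpha> \<le> real n * \<alpha>" using n \<alpha>(1) by (intro mult_right_mono) auto
    then show "\<alpha> \<le> pi" using \<alpha>(2) pi_gt_zero by linarith
  qed (rule \<alpha>)
  have c\<alpha>: "cos (real n * \<alpha>) \<ge> 0" using \<alpha> by (intro cos_ge_zero) (auto intro: order_trans[of _ 0])
  have sgn: "(-1) ^ k * sin (real n * u) = cos (real n * \<alpha>)" "(-1) ^ k * sin (real n * v) = cos (real n * \<alpha>)"
    by (simp_all add: u_def v_def right_diff_distrib distrib_left sin_diff sin_add sin_node[OF n] cos_node[OF n]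
        power_mult_distrib[symmetric] mult.assoc[symmetric])
  have nw: "real n * weight n \<alpha> k = T u - T v"
  proof -
    have eq: "2 * sin (real j * \<alpha>) * sin (real j * node n k) = cos (real j * u) - cos (real j * v)" for j
      by (simp add: u_def v_def right_diff_distrib distrib_left cos_diff cos_add)
    have "sin (real n * \<alpha>) * sin (real n * node n k) = (cos (real n * u) - cos (real n * v)) / 2"
      using eq[of n] by simp
    moreover have "(\<Sum>j=1..<n. 2 * sin (real j * \<alpha>) * sin (real j * node n k))
        = (\<Sum>j=1..<n. cos (real j * u)) - (\<Sum>j=1..<n. cos (real j * v))"
      by (simp only: eq sum_subtractf)
    ultimately show ?thesis
      unfolding weight_def T_def using n0 by (simp add: diff_divide_distrib)
  qed
  have Tu: "T u = (sin (real n * u) * cos (u / 2) / sin (u / 2) - 1) / 2"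
    and Tv: "T v = (sin (real n * v) * cos (v / 2) / sin (v / 2) - 1) / 2"
  proof -
    have "2 * sin (x / 2) * T x = sin (real n * x) * cos (x / 2) - sin (x / 2)" for x
      unfolding T_def by (rule sin_half_mult_sum_cos[OF n])
    from this[of u] this[of v] su sv
    show "T u = (sin (real n * u) * cos (u / 2) / sin (u / 2) - 1) / 2"
      "T v = (sin (real n * v) * cos (v / 2) / sin (v / 2) - 1) / 2"
      by (simp_all add: field_simps)
  qed
  have "(-1) ^ k * (real n * weight n \<alpha> k)
      = (((-1) ^ k * sin (real n * u)) * (cos (u / 2) / sin (u / 2)) - ((-1) ^ k * sin (real n * v)) * (cos (v / 2) / sin (v / 2))) / 2"
    unfolding nw Tu Tv by (simp add: algebra_simps diff_divide_distrib)
  also have "\<dots> = cos (real n * \<alpha>) * (cos (u / 2) / sin (u / 2) - cos (v / 2) / sin (v / 2)) / 2"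
    unfolding sgn by (simp add: algebra_simps)
  also have "cos (u / 2) / sin (u / 2) - cos (v / 2) / sin (v / 2) = sin (v / 2 - u / 2) / (sin (u / 2) * sin (v / 2))"
    unfolding sin_diff using su sv by (simp add: field_simps)
  also have "v / 2 - u / 2 = \<alpha>" by (simp add: u_def v_def field_simps)
  finally have "(-1) ^ k * (real n * weight n \<alpha> k) \<ge> 0"
    using su sv s\<alpha> c\<alpha> by simp
  then have "real n * ((-1) ^ k * weight n \<alpha> k) \<ge> 0" by (simp add: mult_ac)
  then show ?thesis using n0 by (simp add: zero_le_mult_iff)
qed

text \<open>The signs of the weights agree with \<open>sin (n t)\<close> at the nodes, so the sum of
  absolute values is the interpolation formula evaluated on this extremal function.\<close>

lemma sum_abs_weight:
  assumes n: "n \<ge> 1" and \<alpha>: "0 \<le> \<alpha>" "real n * \<alpha> < pi / 2"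
  shows "(\<Sum>k<2*n. \<bar>weight n \<alpha> k\<bar>) = 2 * sin (real n * \<alpha>)"
proof -
  have "\<bar>weight n \<alpha> k\<bar> = weight n \<alpha> k * sin (real n * node n k)" if "k < 2 * n" for k
    using weight_sign[OF n that \<alpha>] unfolding sin_node[OF n] by (cases "even k") auto
  then have "(\<Sum>k<2*n. \<bar>weight n \<alpha> k\<bar>) = (\<Sum>k<2*n. weight n \<alpha> k * sin (real n * node n k))"
    by (intro sum.cong) auto
  also have "\<dots> = Im (\<Sum>k<2*n. complex_of_real (weight n \<alpha> k) * cis (of_int (int n) * node n k))"
    by simp
  also have "\<dots> = 2 * sin (real n * \<alpha>)" using n by (subst weight_interpolation) auto
  finally show ?thesis .
qed

section \<open>Vector-valued trigonometric polynomials\<close>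

text \<open>The inductive form avoids families of vector coefficients: linear identities need
  checking on monomials only.\<close>

inductive trig_curve :: "nat \<Rightarrow> (real \<Rightarrow> 'a::complex_inner) \<Rightarrow> bool" for n
  where
    trig_curve_monom: "\<bar>l\<bar> \<le> int n \<Longrightarrow> trig_curve n (\<lambda>\<tau>. cis (of_int l * \<tau>) *\<^sub>C x)"
  | trig_curve_add: "trig_curve n F \<Longrightarrow> trig_curve n G \<Longrightarrow> trig_curve n (\<lambda>\<tau>. F \<tau> + G \<tau>)"

lemma trig_curve_const: "trig_curve n (\<lambda>_. x)"
  using trig_curve_monom[of 0 n x] by simp

lemma trig_curve_sum:
  "(\<And>i. i \<in> I \<Longrightarrow> trig_curve n (F i)) \<Longrightarrow> trig_curve n (\<lambda>\<tau>. \<Sum>i\<in>I. F i \<tau>)"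
  by (induction I rule: infinite_finite_induct) (auto intro: trig_curve_const trig_curve_add)

lemma trig_curve_linear:
  assumes "trig_curve n F" and T: "clinear_on UNIV T"
  shows "trig_curve n (\<lambda>\<tau>. T (F \<tau>))"
  using assms(1)
  by induction (auto simp: clinear_on_add[OF T] clinear_on_scaleC[OF T] intro: trig_curve.intros)

lemma trig_curve_scale: "trig_curve n F \<Longrightarrow> trig_curve n (\<lambda>\<tau>. c *\<^sub>C F \<tau>)"
  by (erule trig_curve_linear) (simp add: clinear_on_UNIV_iff scaleC_add_right scaleC_scaleC mult.commute)

lemma trig_curve_diff:
  assumes "trig_curve n F" "trig_curve n G" shows "trig_curve n (\<lambda>\<tau>. F \<tau> - G \<tau>)"
  using trig_curve_add[OF assms(1) trig_curve_scale[OF assms(2), of "-1"]] by (simp add: scaleC_minus_one)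

lemma trig_curve_shift:
  assumes "trig_curve n F" shows "trig_curve n (\<lambda>\<tau>. F (\<tau> + s))"
  using assms
proof induction
  case (trig_curve_monom l x)
  then show ?case
    using trig_curve.trig_curve_monom[of l n "cis (of_int l * s) *\<^sub>C x"]
    by (simp add: scaleC_scaleC cis_mult distrib_left)
qed (rule trig_curve_add)

lemma trig_curve_mono:
  assumes "trig_curve n F" "n \<le> m" shows "trig_curve m F"
  using assms by induction (auto intro: trig_curve.intros)

text \<open>Degrees add when an operator-valued trigonometric polynomial acts on a curve. Only
  linearity of the coefficients \<open>P i\<close> enters, so this applies to noncommuting
  words.\<close>

lemma trig_curve_mult:
  assumes F: "trig_curve n F" and q: "\<And>i. i \<in> I \<Longrightarrow> \<bar>q i\<bar> \<le> int N"
    and P: "\<And>i. i \<in> I \<Longrightarrow> clinear_on UNIV (P i)"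
  shows "trig_curve (n + N) (\<lambda>\<tau>. \<Sum>i\<in>I. cis (of_int (q i) * \<tau>) *\<^sub>C P i (F \<tau>))"
  using F
proof induction
  case (trig_curve_monom l x)
  have "trig_curve (n + N) (\<lambda>\<tau>. \<Sum>i\<in>I. cis (of_int (q i + l) * \<tau>) *\<^sub>C P i x)"
    by (intro trig_curve_sum trig_curve.trig_curve_monom) (use q trig_curve_monom in force)
  moreover have "cis (of_int (q i + l) * \<tau>) *\<^sub>C P i x = cis (of_int (q i) * \<tau>) *\<^sub>C P i (cis (of_int l * \<tau>) *\<^sub>C x)"
    if "i \<in> I" for i \<tau>
    using clinear_on_scaleC[OF P[OF that], of x] by (simp add: scaleC_scaleC cis_mult distrib_right)
  ultimately show ?case by simp
next
  case (trig_curve_add F G)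
  have "(\<Sum>i\<in>I. cis (of_int (q i) * \<tau>) *\<^sub>C P i (F \<tau> + G \<tau>))
      = (\<Sum>i\<in>I. cis (of_int (q i) * \<tau>) *\<^sub>C P i (F \<tau>)) + (\<Sum>i\<in>I. cis (of_int (q i) * \<tau>) *\<^sub>C P i (G \<tau>))" for \<tau>
    unfolding sum.distrib[symmetric]
    by (intro sum.cong refl) (simp add: clinear_on_add[OF P] scaleC_add_right)
  then show ?case using trig_curve.trig_curve_add[OF trig_curve_add.IH] by simp
qed

lemma trig_curve_interpolation:
  assumes "trig_curve n G" and n: "n \<ge> 1"
  shows "G (\<tau> + \<alpha>) - G (\<tau> - \<alpha>) = (\<Sum>k<2*n. complex_of_real (weight n \<alpha> k) *\<^sub>C G (\<tau> + node n k))"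
  using assms(1)
proof induction
  case (trig_curve_monom l x)
  have "cis (of_int l * (\<tau> + \<alpha>)) - cis (of_int l * (\<tau> - \<alpha>)) = cis (of_int l * \<tau>) * (2 * \<i> * of_real (sin (of_int l * \<alpha>)))"
    by (simp add: complex_eq_iff right_diff_distrib distrib_left cos_add cos_diff sin_add sin_diff)
  also have "\<dots> = (\<Sum>k<2*n. complex_of_real (weight n \<alpha> k) * cis (of_int l * (\<tau> + node n k)))"
    unfolding weight_interpolation[OF n trig_curve_monom, symmetric] sum_distrib_left
    by (simp add: distrib_left cis_mult[symmetric] mult_ac)
  finally show ?case
    by (simp add: scaleC_scaleC scaleC.sum_left[symmetric] scaleC.diff_left[symmetric])
next
  case (trig_curve_add F G)
  then show ?case by (simp add: scaleC_add_right sum.distrib algebra_simps)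
qed

text \<open>The Bernstein inequality for differences follows from the interpolation formula and the
  sum of the absolute weights. At \<open>n * \<alpha> = \<pi> / 2\<close>, excluded in
  \<open>weight_sign\<close>, the triangle inequality already gives the constant 2.\<close>

lemma trig_curve_difference_le:
  assumes G: "trig_curve n G" and M: "\<And>\<tau>. norm (G \<tau>) \<le> M" and \<alpha>: "0 \<le> \<alpha>" "real n * \<alpha> \<le> pi / 2"
  shows "norm (G (\<tau> + \<alpha>) - G (\<tau> - \<alpha>)) \<le> 2 * sin (real n * \<alpha>) * M"
proof -
  consider "n = 0" | "real n * \<alpha> = pi / 2" | "n \<ge> 1" "real n * \<alpha> < pi / 2" using \<alpha> by linarith
  then show ?thesis
  proof cases
    case 1
    have "G s = G t" for s t using G unfolding 1 by induction auto
    from this[of "\<tau> + \<alpha>" "\<tau> - \<alpha>"] show ?thesis by (simp add: 1)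
  next
    case 2
    have "sin (real n * \<alpha>) = 1" unfolding 2 by simp
    then show ?thesis
      using norm_triangle_ineq4[of "G (\<tau> + \<alpha>)" "G (\<tau> - \<alpha>)"] M[of "\<tau> + \<alpha>"] M[of "\<tau> - \<alpha>"] by simp
  next
    case 3
    have "norm (G (\<tau> + \<alpha>) - G (\<tau> - \<alpha>)) \<le> (\<Sum>k<2*n. norm (complex_of_real (weight n \<alpha> k) *\<^sub>C G (\<tau> + node n k)))"
      unfolding trig_curve_interpolation[OF G 3(1)] by (rule norm_sum)
    also have "\<dots> \<le> (\<Sum>k<2*n. \<bar>weight n \<alpha> k\<bar> * M)"
      by (intro sum_mono) (simp add: norm_scaleC mult_left_mono M)
    also have "\<dots> = 2 * sin (real n * \<alpha>) * M"
      by (simp add: sum_distrib_right[symmetric] sum_abs_weight[OF 3(1) \<alpha>(1) 3(2)])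
    finally show ?thesis .
  qed
qed

text \<open>Pascal's rule: a difference of order \<open>m + 1\<close> is the \<open>m\<close>-th
  difference of the first differences.\<close>

lemma alternating_binomial_sum_Suc:
  fixes v :: "nat \<Rightarrow> 'a::complex_inner"
  shows "(\<Sum>k=0..Suc m. ((-1) ^ k * of_nat (Suc m choose k)) *\<^sub>C v k)
    = (\<Sum>k=0..m. ((-1) ^ k * of_nat (m choose k)) *\<^sub>C (v k - v (Suc k)))"
proof -
  let ?t = "\<lambda>k. ((-1) ^ k * of_nat (m choose k)) *\<^sub>C v k"
  have "(\<Sum>k=0..Suc m. ((-1) ^ k * of_nat (Suc m choose k)) *\<^sub>C v k)
      = v 0 + (\<Sum>k=0..m. ((-1) ^ Suc k * of_nat (Suc m choose Suc k)) *\<^sub>C v (Suc k))"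
    by (simp add: sum.atLeast0_atMost_Suc_shift del: sum.cl_ivl_Suc)
  also have "(\<Sum>k=0..m. ((-1) ^ Suc k * of_nat (Suc m choose Suc k)) *\<^sub>C v (Suc k))
      = (\<Sum>k=0..m. ?t (Suc k)) - (\<Sum>k=0..m. ((-1) ^ k * of_nat (m choose k)) *\<^sub>C v (Suc k))"
    unfolding sum_subtractf[symmetric]
  proof (intro sum.cong refl)
    fix k
    have "(-1) ^ Suc k * of_nat (Suc m choose Suc k)
        = (-1) ^ Suc k * of_nat (m choose Suc k) - (-1) ^ k * (of_nat (m choose k) :: complex)"
      by (simp add: algebra_simps)
    then show "((-1) ^ Suc k * of_nat (Suc m choose Suc k)) *\<^sub>C v (Suc k)
        = ?t (Suc k) - ((-1) ^ k * of_nat (m choose k)) *\<^sub>C v (Suc k)"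
      by (simp only: scaleC.diff_left)
  qed
  also have "v 0 + ((\<Sum>k=0..m. ?t (Suc k)) - (\<Sum>k=0..m. ((-1) ^ k * of_nat (m choose k)) *\<^sub>C v (Suc k)))
      = (\<Sum>k=0..Suc m. ?t k) - (\<Sum>k=0..m. ((-1) ^ k * of_nat (m choose k)) *\<^sub>C v (Suc k))"
    by (simp add: sum.atLeast0_atMost_Suc_shift del: sum.cl_ivl_Suc binomial_Suc_Suc)
  also have "(\<Sum>k=0..Suc m. ?t k) = (\<Sum>k=0..m. ?t k)" by (simp add: binomial_eq_0)
  finally show ?thesis by (simp add: sum_subtractf[symmetric] scaleC.diff_right)
qed

text \<open>A first difference is again a curve of degree \<open>n\<close>, smaller by the Bernstein
  factor, so the bound iterates. The central difference uses the half step
  \<open>\<eta> / 2\<close>.\<close>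

lemma trig_curve_iterated_difference_le:
  assumes "trig_curve n G" "\<And>\<tau>. norm (G \<tau>) \<le> M" "0 \<le> \<eta>" "real n * \<eta> \<le> pi"
  shows "norm (\<Sum>k=0..m. ((-1) ^ k * of_nat (m choose k)) *\<^sub>C G (\<tau> + real k * \<eta>))
    \<le> (2 * sin (real n * \<eta> / 2)) ^ m * M"
  using assms(1,2)
proof (induction m arbitrary: G M)
  case 0
  then show ?case by simp
next
  case (Suc m)
  define H where "H = (\<lambda>\<tau>. G \<tau> - G (\<tau> + \<eta>))"
  have "trig_curve n H" unfolding H_def by (intro trig_curve_diff trig_curve_shift Suc.prems)
  moreover have "norm (H \<tau>) \<le> 2 * sin (real n * \<eta> / 2) * M" for \<tau>
    using trig_curve_difference_le[OF Suc.prems, of "\<eta> / 2" "\<tau> + \<eta> / 2"] assms(3,4)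
    by (simp add: H_def norm_minus_commute add.commute)
  ultimately have "norm (\<Sum>k=0..m. ((-1) ^ k * of_nat (m choose k)) *\<^sub>C H (\<tau> + real k * \<eta>))
      \<le> (2 * sin (real n * \<eta> / 2)) ^ m * (2 * sin (real n * \<eta> / 2) * M)" by (rule Suc.IH)
  moreover have "H (\<tau> + real k * \<eta>) = G (\<tau> + real k * \<eta>) - G (\<tau> + real (Suc k) * \<eta>)" for k
    by (simp add: H_def algebra_simps)
  ultimately show ?case
    by (simp only: alternating_binomial_sum_Suc[of m "\<lambda>k. G (\<tau> + real k * \<eta>)"]) (simp add: mult_ac)
qed

section \<open>Borel functions of a projection-valued measure\<close>

lemma orthogonal_projection_cinner:
  assumes P: "orthogonal_projection P" shows "cinner (P x) x = of_real ((norm (P x))\<^sup>2)"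
proof -
  have "P (P x) = P x" using P unfolding orthogonal_projection_def o_def by metis
  then have "cinner (P x) x = cinner (P x) (P x)"
    using P unfolding orthogonal_projection_def by metis
  then show ?thesis by (simp only: cinner_self)
qed

lemma orthogonal_projection_norm_le:
  assumes P: "orthogonal_projection P" shows "norm (P x) \<le> norm x"
proof -
  have "(norm (P x))\<^sup>2 \<le> norm (P x) * norm x"
    using cmod_cinner_le[of "P x" x] unfolding orthogonal_projection_cinner[OF P] norm_of_real by simp
  then show ?thesis by (cases "norm (P x) = 0") (simp_all add: power2_eq_square)
qed

definition pvm_gen ::
    "(real set \<Rightarrow> 'a::complex_inner \<Rightarrow> 'a) \<Rightarrow> (real \<Rightarrow> complex) \<Rightarrow> ('a \<Rightarrow> 'a) \<Rightarrow> ('a \<Rightarrow> 'a) \<Rightarrow> bool"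
  where "pvm_gen E f S S' \<longleftrightarrow> (\<exists>c. \<exists>B\<in>sets borel. f = (\<lambda>t. c * indicator B t) \<and>
    S = (\<lambda>x. c *\<^sub>C E B x) \<and> S' = (\<lambda>x. cnj c *\<^sub>C E B x))"

text \<open>\<open>spectral_measure\<close> is an arbitrary choice among the admissible measures, so
  the calculus is rebuilt from the abstract properties of \<open>E\<close> instead of being taken
  from \<open>W\<close>.\<close>

locale spectral_resolution =
  fixes E :: "real set \<Rightarrow> 'a::chilbert_space \<Rightarrow> 'a"
  assumes pvm: "projection_valued_measure E"
begin

lemma proj: "B \<in> sets borel \<Longrightarrow> orthogonal_projection (E B)"
  and E_empty: "E {} x = 0"
  and E_UNIV: "E UNIV x = x"
  and E_Int: "B \<in> sets borel \<Longrightarrow> C \<in> sets borel \<Longrightarrow> E (B \<inter> C) x = E B (E C x)"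
  and E_sums: "range F \<subseteq> sets borel \<Longrightarrow> disjoint_family F \<Longrightarrow> (\<lambda>n. E (F n) x) sums E (\<Union>n. F n) x"
  using pvm unfolding projection_valued_measure_def by (simp_all add: fun_eq_iff)

lemma proj_linear: "B \<in> sets borel \<Longrightarrow> clinear_on UNIV (E B)"
  and proj_adjoint: "B \<in> sets borel \<Longrightarrow> cinner (E B x) y = cinner x (E B y)"
  using proj unfolding orthogonal_projection_def by blast+

lemma sets_scalar: "sets (scalar_spectral_measure E x) = sets borel"
  and space_scalar: "space (scalar_spectral_measure E x) = UNIV"
  using sets.sigma_sets_eq[of "borel :: real measure"]
  by (simp_all add: scalar_spectral_measure_def sets_measure_of space_measure_of_conv)

text \<open>\<open>measure_of\<close> takes the intended values only once positivity and countable
  additivity are verified; the latter is the strong additivity of \<open>E\<close> seen through the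
  inner product.\<close>

lemma emeasure_scalar:
  assumes B: "B \<in> sets borel"
  shows "emeasure (scalar_spectral_measure E x) B = ennreal ((norm (E B x))\<^sup>2)"
proof -
  let ?f = "\<lambda>B. ennreal (Re (cinner (E B x) x))"
  have nonneg: "Re (cinner (E B x) x) \<ge> 0" if "B \<in> sets borel" for B
    unfolding orthogonal_projection_cinner[OF proj[OF that]] by simp
  have "emeasure (scalar_spectral_measure E x) B = ?f B"
  proof (rule emeasure_measure_of[OF scalar_spectral_measure_def])
    show "positive (sets (scalar_spectral_measure E x)) ?f"
      by (simp add: positive_def E_empty cinner.zero_left)
    show "countably_additive (sets (scalar_spectral_measure E x)) ?f"
      unfolding countably_additive_def sets_scalar
    proof (intro allI impI)
      fix F :: "nat \<Rightarrow> real set"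
      assume F: "range F \<subseteq> sets borel" "disjoint_family F" "(\<Union>i. F i) \<in> sets borel"
      have "(\<lambda>i. Re (cinner (E (F i) x) x)) sums Re (cinner (E (\<Union>i. F i) x) x)"
        by (rule bounded_linear.sums[OF bounded_linear_compose[OF bounded_linear_Re cinner.bounded_linear_left] E_sums[OF F(1,2)]])
      then have "(\<lambda>i. ?f (F i)) sums ?f (\<Union>i. F i)"
        using F nonneg by (subst sums_ennreal) auto
      then show "(\<Sum>i. ?f (F i)) = ?f (\<Union>i. F i)" by (simp add: sums_iff)
    qed
  qed (use B in \<open>auto simp: sets_scalar\<close>)
  then show ?thesis unfolding orthogonal_projection_cinner[OF proj[OF B]] by simp
qed

lemma finite_scalar: "finite_measure (scalar_spectral_measure E x)"
  by (rule finite_measureI) (simp add: space_scalar emeasure_scalar)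

lemma measure_scalar:
  "B \<in> sets borel \<Longrightarrow> measure (scalar_spectral_measure E x) B = (norm (E B x))\<^sup>2"
  using emeasure_scalar by (simp add: measure_def)

lemma integral_scalar_indicator:
  assumes B: "B \<in> sets borel"
  shows "(LINT t|scalar_spectral_measure E x. indicator B t) = cinner (E B x) x"
proof -
  have "(LINT t|scalar_spectral_measure E x. indicator B t :: complex)
      = (LINT t|scalar_spectral_measure E x. complex_of_real (indicator B t))"
    by (intro Bochner_Integration.integral_cong refl) (simp add: indicator_def)
  also have "\<dots> = complex_of_real (LINT t|scalar_spectral_measure E x. indicator B t)"
    by (rule integral_complex_of_real)
  also have "\<dots> = complex_of_real ((norm (E B x))\<^sup>2)"
    using B by (simp add: sets_scalar measure_scalar space_scalar)
  finally show ?thesis by (simp only: orthogonal_projection_cinner[OF proj[OF B]])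
qed

end

sublocale spectral_resolution \<subseteq> operator_calculus "pvm_gen E" "scalar_spectral_measure E"
proof (rule operator_calculus.intro)
  fix f S S' x y assume "pvm_gen E f S S'"
  then obtain c B where B: "B \<in> sets borel" and f: "f = (\<lambda>t. c * indicator B t)"
    and S: "S = (\<lambda>x. c *\<^sub>C E B x)" and S': "S' = (\<lambda>x. cnj c *\<^sub>C E B x)"
    by (auto simp: pvm_gen_def)
  note L = proj_linear[OF B]
  show "\<exists>K. \<forall>t. cmod (f t) \<le> K"
    by (rule exI[of _ "cmod c"]) (auto simp: f indicator_def)
  show "f \<in> borel_measurable borel" unfolding f using B by measurable
  show "clinear_on UNIV S"
    by (simp add: clinear_on_UNIV_iff S clinear_on_add[OF L] clinear_on_scaleC[OF L]
        scaleC_add_right scaleC_scaleC mult.commute)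
  show "\<exists>K. \<forall>x. norm (S x) \<le> K * norm x"
    by (rule exI[of _ "cmod c"])
      (auto simp: S norm_scaleC intro!: mult_left_mono orthogonal_projection_norm_le[OF proj[OF B]])
  show "cinner (S x) y = cinner x (S' y)"
    by (simp add: S S' cinner_scaleC_left cinner_scaleC_right proj_adjoint[OF B])
  show "cinner (S x) x = (LINT t|scalar_spectral_measure E x. f t)"
    by (simp add: S f cinner_scaleC_left integral_scalar_indicator[OF B])
  have "cnj (c * indicator B t) = cnj c * indicator B t" for t by (simp add: indicator_def)
  then show "pvm_gen E (\<lambda>t. cnj (f t)) S' S"
    unfolding pvm_gen_def using B by (intro exI[of _ "cnj c"] bexI[of _ B]) (auto simp: f S S')
  fix g T T' assume "pvm_gen E g T T'"
  then obtain b C where C: "C \<in> sets borel" and g: "g = (\<lambda>t. b * indicator C t)"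
    and T: "T = (\<lambda>x. b *\<^sub>C E C x)" and T': "T' = (\<lambda>x. cnj b *\<^sub>C E C x)"
    by (auto simp: pvm_gen_def)
  note L' = proj_linear[OF C]
  have "E C (E B x) = E (B \<inter> C) x" for x using E_Int[OF C B] by (simp add: Int_commute)
  then show "pvm_gen E (\<lambda>t. f t * g t) (S \<circ> T) (T' \<circ> S')"
    unfolding pvm_gen_def using B C
    by (intro exI[of _ "c * b"] bexI[of _ "B \<inter> C"])
      (auto simp: f g S S' T T' fun_eq_iff E_Int clinear_on_scaleC[OF L] clinear_on_scaleC[OF L']
        scaleC_scaleC indicator_def mult.commute)
next
  show "pvm_gen E (\<lambda>_. c) (\<lambda>x. c *\<^sub>C x) (\<lambda>x. cnj c *\<^sub>C x)" for c
    unfolding pvm_gen_def by (intro exI[of _ c] bexI[of _ UNIV]) (auto simp: E_UNIV)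
qed (rule finite_scalar sets_scalar)+

context operator_calculus
begin

lemma op_unitary:
  assumes f: "calculable f" and 1: "\<And>t. cmod (f t) = 1"
  shows "unitary (op f)" "inv (op f) = op (\<lambda>t. cnj (f t))"
proof -
  have "f t * cnj (f t) = 1" for t using complex_norm_square[of "f t"] 1[of t] by simp
  then have r: "op f (op (\<lambda>t. cnj (f t)) x) = x" and l: "op (\<lambda>t. cnj (f t)) (op f x) = x" for x
    using op_mult[OF f calculable_conj[OF f]] op_mult[OF calculable_conj[OF f] f]
    by (simp_all add: mult.commute op_const)
  show "unitary (op f)"
    unfolding unitary_def
    using op_linear[OF f] op_adjoint[OF f] r l by (auto simp: surj_def) metis
  show "inv (op f) = op (\<lambda>t. cnj (f t))" by (rule inv_equality) (use r l in auto)
qed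

text \<open>\<open>f - g\<close> equals its product with the indicator of \<open>N\<close>, so its
  operator factors through 0. This permits changing a function off the spectrum.\<close>

lemma op_cong_null:
  assumes N: "calculable (indicator N)" "\<And>x. op (indicator N) x = 0"
    and f: "calculable f" and g: "calculable g" and eq: "\<And>t. t \<notin> N \<Longrightarrow> f t = g t"
  shows "op f x = op g x"
proof -
  have "(\<lambda>t. (f t - g t) * indicator N t) = (\<lambda>t. f t - g t)"
    using eq by (force simp: indicator_def)
  then have "op (\<lambda>t. f t - g t) x = op (\<lambda>t. f t - g t) (op (indicator N) x)"
    using op_mult[OF calculable_diff[OF f g] N(1)] by simp
  also have "\<dots> = 0" by (simp add: N(2) clinear_on_zero[OF op_linear[OF calculable_diff[OF f g]]])
  finally show ?thesis by (simp add: op_diff[OF f g])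
qed

end

section \<open>Bounded Borel functions and spectral null sets\<close>

context spectral_resolution
begin

lemma calculable_indicator: "B \<in> sets borel \<Longrightarrow> calculable (indicator B)"
  unfolding calculable_def
  by (rule exI, rule exI, rule calc_gen[of _ "E B" "E B"], unfold pvm_gen_def,
      rule exI[of _ 1], rule bexI[of _ B]) auto

lemma op_indicator: "B \<in> sets borel \<Longrightarrow> op (indicator B) = E B"
  by (rule op_eq[of _ _ "E B"], rule calc_gen, unfold pvm_gen_def,
      rule exI[of _ 1], rule bexI[of _ B]) auto

lemma calculable_bounded:
  assumes "f \<in> borel_measurable borel" "\<And>t. cmod (f t) \<le> K"
  shows "calculable f"
  using calculable_borel[where \<phi> = "\<lambda>t. t", OF _ assms] calculable_indicator by simp

lemma calculable_cis: "\<phi> \<in> borel_measurable borel \<Longrightarrow> calculable (\<lambda>t. cis (\<phi> t))"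
proof (rule calculable_bounded[where K = 1])
  assume "\<phi> \<in> borel_measurable borel"
  from measurable_compose[OF this borel_measurable_cis_mult[of 1]]
  show "(\<lambda>t. cis (\<phi> t)) \<in> borel_measurable borel" by simp
qed simp

text \<open>Identifies the description in \<open>bounded_borel_calculus\<close> with
  \<open>op\<close>; uniqueness is polarization.\<close>

lemma the_spectral_integral:
  assumes f: "f \<in> borel_measurable borel" "\<And>t. cmod (f t) \<le> K"
  shows "(THE T. is_spectral_integral E f UNIV T) = op f"
proof (rule the_equality)
  note c = calculable_bounded[OF f]
  have "norm ((cmod (f t))\<^sup>2) \<le> K\<^sup>2" for t using power_mono[OF f(2)[of t], of 2] by simp
  then have "integrable (scalar_spectral_measure E x) (\<lambda>t. (cmod (f t))\<^sup>2)" for x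
    using f(1) by (intro integrable_bounded[of _ "K\<^sup>2"]) auto
  then show "is_spectral_integral E f UNIV (op f)"
    unfolding is_spectral_integral_def using op_linear[OF c] op_integral[OF c] by auto
  fix T assume "is_spectral_integral E f UNIV T"
  then show "T = op f"
    unfolding is_spectral_integral_def using op_linear[OF c] op_integral[OF c]
    by (intro clinear_on_eqI) auto
qed

text \<open>A norm bound is an essential bound: a vector \<open>u\<close> in the range of the
  projection onto \<open>B n\<close> satisfies \<open>(\<delta> + 1 / (n + 1))
  \<parallel>u\<parallel> \<le> \<parallel>op f u\<parallel> \<le> \<delta>
  \<parallel>u\<parallel>\<close>, so \<open>u = 0\<close>. The sets \<open>B n\<close> exhaust the
  strict superlevel set.\<close>

lemma null_of_norm_le:
  assumes f: "f \<in> borel_measurable borel" "\<And>t. cmod (f t) \<le> K"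
    and \<delta>: "\<And>x. norm (op f x) \<le> \<delta> * norm x" "0 \<le> \<delta>"
  shows "op (indicator {t. \<delta> < cmod (f t)}) x = 0"
proof -
  note cf = calculable_bounded[OF f]
  note [measurable] = f(1)
  define B where "B = (\<lambda>n. {t. \<delta> + inverse (real (Suc n)) \<le> cmod (f t)})"
  have B: "B n \<in> sets borel" for n unfolding B_def by measurable
  have z: "op (indicator (B n)) x = 0" for n
  proof -
    let ?u = "op (indicator (B n)) x"
    let ?e = "\<delta> + inverse (real (Suc n))"
    note ci = calculable_indicator[OF B[of n]]
    have e0: "?e \<ge> 0" using \<delta>(2) by simp
    have "?e\<^sup>2 * (norm ?u)\<^sup>2 = (LINT t|scalar_spectral_measure E x. ?e\<^sup>2 * (cmod (indicator (B n) t))\<^sup>2)"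
      unfolding op_norm[OF ci] by simp
    also have "\<dots> \<le> (LINT t|scalar_spectral_measure E x. (cmod (f t * indicator (B n) t))\<^sup>2)"
    proof (rule integral_mono)
      show "integrable (scalar_spectral_measure E x) (\<lambda>t. ?e\<^sup>2 * (cmod (indicator (B n) t))\<^sup>2)"
        using B[of n] by (intro integrable_bounded[of _ "?e\<^sup>2"]) (auto simp: indicator_def)
      show "integrable (scalar_spectral_measure E x) (\<lambda>t. (cmod (f t * indicator (B n) t))\<^sup>2)"
        using B[of n] power_mono[OF f(2) norm_ge_zero, of _ 2]
        by (intro integrable_bounded[of _ "K\<^sup>2"]) (auto simp: indicator_def)
      show "?e\<^sup>2 * (cmod (indicator (B n) t))\<^sup>2 \<le> (cmod (f t * indicator (B n) t))\<^sup>2" for t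
        using power_mono[OF _ e0, of "cmod (f t)" 2] by (auto simp: indicator_def B_def)
    qed
    also have "\<dots> = (norm (op f ?u))\<^sup>2"
      unfolding op_mult[OF cf ci, symmetric] op_norm[OF calculable_mult[OF cf ci]] ..
    also have "\<dots> \<le> (\<delta> * norm ?u)\<^sup>2" by (intro power_mono \<delta>) simp
    finally have "(?e * norm ?u)\<^sup>2 \<le> (\<delta> * norm ?u)\<^sup>2" by (simp add: power_mult_distrib)
    then have "?e * norm ?u \<le> \<delta> * norm ?u" by (rule power2_le_imp_le) (simp add: \<delta>)
    then have "inverse (real (Suc n)) * norm ?u \<le> 0" by (simp add: distrib_right)
    then show ?thesis by (simp add: mult_le_0_iff del: of_nat_Suc)
  qed
  have inc: "incseq B"
  proof (rule incseq_SucI, unfold B_def, safe)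
    fix n t assume "\<delta> + inverse (real (Suc n)) \<le> cmod (f t)"
    moreover have "inverse (real (Suc (Suc n))) \<le> inverse (real (Suc n))" by (rule le_imp_inverse_le) auto
    ultimately show "\<delta> + inverse (real (Suc (Suc n))) \<le> cmod (f t)" by linarith
  qed
  have un: "(\<Union>n. B n) = {t. \<delta> < cmod (f t)}"
  proof safe
    fix t n assume "t \<in> B n"
    moreover have "inverse (real (Suc n)) > 0" by simp
    ultimately show "\<delta> < cmod (f t)" unfolding B_def mem_Collect_eq by linarith
  next
    fix t assume "\<delta> < cmod (f t)"
    then obtain n where "inverse (real (Suc n)) < cmod (f t) - \<delta>" using reals_Archimedean[of "cmod (f t) - \<delta>"] by auto
    then show "t \<in> (\<Union>n. B n)" by (auto simp: B_def intro!: exI[of _ n])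
  qed
  have "(\<lambda>n. op (indicator (B n)) x) \<longlonglongrightarrow> op (indicator (\<Union>n. B n)) x"
    by (rule calculable_limit(2)[where K = 1, OF calculable_indicator[OF B] _ LIMSEQ_indicator_incseq[OF inc]])
      (simp add: indicator_def)
  then show ?thesis by (simp add: z un LIMSEQ_const_iff)
qed

text \<open>\<open>A\<close> itself is outside the bounded calculus, so the argument uses its
  quadratic form: on the range of \<open>E (B n)\<close> it is at least
  \<open>(M + 1 / (n + 1)) \<parallel>u\<parallel>\<^sup>2\<close> in modulus, against the upper
  bound \<open>M \<parallel>u\<parallel>\<^sup>2\<close>.\<close>

lemma null_of_operator_bound:
  assumes A: "is_spectral_integral E complex_of_real D A"
    and M: "\<And>x. x \<in> D \<Longrightarrow> norm (A x) \<le> M * norm x" "0 \<le> M"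
  shows "op (indicator {t. M < \<bar>t\<bar>}) x = 0"
proof -
  have half: "op (indicator {t. M < s * t}) x = 0" if s: "s = 1 \<or> s = -1" for s :: real
  proof -
    \<comment> \<open>The sign \<open>s\<close> selects one half line, where the integral of
      \<open>t\<close> has no cancellation; the upper cutoff keeps \<open>t\<close> bounded, so that
      the projected vector lies in \<open>D\<close>.\<close>
    define B where "B = (\<lambda>n. {t. M + inverse (real (Suc n)) \<le> s * t \<and> s * t \<le> real n})"
    have B: "B n \<in> sets borel" for n unfolding B_def by measurable
    have z: "op (indicator (B n)) x = 0" for n
    proof -
      define u where "u = E (B n) x"
      let ?\<mu> = "scalar_spectral_measure E u"
      have i0: "inverse (real (Suc n)) > 0" by simp
      have "- B n \<in> sets borel" using B by auto
      then have "emeasure ?\<mu> (- B n) = 0"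
        using E_Int[of "- B n" "B n" x] B by (simp add: emeasure_scalar u_def E_empty)
      then have "- B n \<in> null_sets ?\<mu>" using B by (simp add: null_sets_def sets_scalar)
      \<comment> \<open>The scalar measure of a vector in the range of \<open>E (B n)\<close> is
        concentrated on \<open>B n\<close>.\<close>
      then have AE: "AE t in ?\<mu>. t \<in> B n" by (rule AE_I') auto
      have AEn: "AE t in ?\<mu>. \<bar>t\<bar> \<le> real n"
        using AE
      proof eventually_elim
        case (elim t)
        then show ?case using s M(2) i0 unfolding B_def mem_Collect_eq by (elim disjE; simp only: abs_if split: if_split; linarith)
      qed
      interpret \<mu>: finite_measure ?\<mu> by (rule finite_scalar)
      have "AE t in ?\<mu>. norm ((cmod (complex_of_real t))\<^sup>2) \<le> (real n)\<^sup>2"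
        using AEn by eventually_elim (simp add: abs_le_square_iff[symmetric])
      then have "integrable ?\<mu> (\<lambda>t. (cmod (complex_of_real t))\<^sup>2)"
        by (rule \<mu>.integrable_const_bound) (simp add: borel_measurable_\<nu>)
      then have uD: "u \<in> D" using A by (simp add: is_spectral_integral_def)
      have int: "integrable ?\<mu> (\<lambda>t. t)"
        by (rule \<mu>.integrable_const_bound[of _ "real n"]) (use AEn in \<open>auto simp: borel_measurable_\<nu>\<close>)
      have "cinner (A u) u = (LINT t|?\<mu>. complex_of_real t)" using A uD by (simp add: is_spectral_integral_def)
      then have Au: "cinner (A u) u = complex_of_real (LINT t|?\<mu>. t)" by simp
      have "(M + inverse (real (Suc n))) * (norm u)\<^sup>2 = (LINT t|?\<mu>. M + inverse (real (Suc n)))"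
        by (simp add: measure_\<nu> mult.commute del: of_nat_Suc)
      also have "\<dots> \<le> (LINT t|?\<mu>. s * t)"
        by (rule integral_mono_AE) (use AE int in \<open>auto simp: B_def\<close>)
      also have "\<dots> = s * (LINT t|?\<mu>. t)" by simp
      also have "\<dots> \<le> \<bar>LINT t|?\<mu>. t\<bar>" using s by auto
      also have "\<dots> = cmod (cinner (A u) u)" unfolding Au by simp
      also have "\<dots> \<le> norm (A u) * norm u" by (rule cmod_cinner_le)
      also have "\<dots> \<le> M * norm u * norm u" by (intro mult_right_mono M uD) simp
      finally have "inverse (real (Suc n)) * (norm u)\<^sup>2 \<le> 0" by (simp add: algebra_simps power2_eq_square)
      then have "u = 0" by (simp add: mult_le_0_iff del: of_nat_Suc)
      then show ?thesis by (simp add: op_indicator[OF B] u_def)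
    qed
    have inc: "incseq B"
    proof (rule incseq_SucI, unfold B_def, safe)
      fix n t assume "M + inverse (real (Suc n)) \<le> s * t" "s * t \<le> real n"
      moreover have "inverse (real (Suc (Suc n))) \<le> inverse (real (Suc n))" by (rule le_imp_inverse_le) auto
      ultimately show "M + inverse (real (Suc (Suc n))) \<le> s * t" "s * t \<le> real (Suc n)" by linarith+
    qed
    have un: "(\<Union>n. B n) = {t. M < s * t}"
    proof safe
      fix t n assume "t \<in> B n"
      moreover have "inverse (real (Suc n)) > 0" by simp
      ultimately show "M < s * t" unfolding B_def mem_Collect_eq by linarith
    next
      fix t assume "M < s * t"
      then obtain n where n: "inverse (real (Suc n)) < s * t - M" using reals_Archimedean[of "s * t - M"] by auto
      obtain k where k: "s * t \<le> real k" using real_arch_simple by blast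
      have "inverse (real (Suc (max n k))) \<le> inverse (real (Suc n))" by (rule le_imp_inverse_le) auto
      moreover have "real k \<le> real (max n k)" by simp
      ultimately have "t \<in> B (max n k)" using n k unfolding B_def mem_Collect_eq by linarith
      then show "t \<in> (\<Union>n. B n)" by blast
    qed
    have "(\<lambda>n. op (indicator (B n)) x) \<longlonglongrightarrow> op (indicator (\<Union>n. B n)) x"
      by (rule calculable_limit(2)[where K = 1, OF calculable_indicator[OF B] _ LIMSEQ_indicator_incseq[OF inc]])
        (simp add: indicator_def)
    then show ?thesis by (simp add: z un LIMSEQ_const_iff)
  qed
  have eq: "indicator {t. M < \<bar>t\<bar>} = (\<lambda>t. indicator {t. M < 1 * t} t + indicator {t. M < -1 * t} t :: complex)"
    using M(2) by (auto simp: indicator_def fun_eq_iff abs_if)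
  have "calculable (indicator {t. M < 1 * t})" "calculable (indicator {t. M < -1 * t})"
    by (rule calculable_indicator, measurable)+
  from op_add[OF this] show ?thesis unfolding eq using half[of 1] half[of "-1"] by (simp add: fun_eq_iff)
qed

end

section \<open>The operator inequality\<close>

lemma cmod_cis_diff_1: "cmod (cis y - 1) = 2 * \<bar>sin (y / 2)\<bar>"
proof -
  have "(cmod (cis y - 1))\<^sup>2 = 2 - 2 * cos y"
    unfolding cmod_power2 using sin_cos_squared_add[of y] by (simp add: power2_eq_square algebra_simps)
  also have "\<dots> = (2 * \<bar>sin (y / 2)\<bar>)\<^sup>2"
    using cos_double_sin[of "y / 2"] by (simp add: power_mult_distrib)
  finally show ?thesis by (rule power2_eq_imp_eq) auto
qed

lemma cmod_cis_diff_1_le: "cmod (cis y - 1) \<le> \<bar>y\<bar>"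
  unfolding cmod_cis_diff_1 using abs_sin_x_le_abs_x[of "y / 2"] by simp

lemma cmod_cis_diff_le: "cmod (cis x - cis y) \<le> \<bar>x - y\<bar>"
proof -
  have "cis x - cis y = cis y * (cis (x - y) - 1)" by (simp add: right_diff_distrib cis_mult)
  then show ?thesis using cmod_cis_diff_1_le[of "x - y"] by (simp add: norm_mult)
qed

text \<open>Addition theorem and induction. This converts the angle \<open>d \<sigma>\<close> back
  into \<open>d\<close> chords.\<close>

lemma abs_sin_nat_mult_le: "\<bar>sin (real d * y)\<bar> \<le> real d * \<bar>sin y\<bar>"
proof (induction d)
  case (Suc d)
  have "\<bar>sin (real (Suc d) * y)\<bar> \<le> \<bar>sin (real d * y) * cos y\<bar> + \<bar>cos (real d * y) * sin y\<bar>"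
    using abs_triangle_ineq[of "sin (real d * y) * cos y" "cos (real d * y) * sin y"]
    by (simp add: distrib_right sin_add algebra_simps)
  also have "\<dots> \<le> \<bar>sin (real d * y)\<bar> * 1 + 1 * \<bar>sin y\<bar>"
    unfolding abs_mult by (intro add_mono mult_mono) auto
  finally show ?case using Suc by (simp add: algebra_simps)
qed simp

text \<open>Each application of \<open>W \<tau>\<close> or of its inverse raises the degree by
  \<open>N\<close>.\<close>

lemma trig_curve_op_powi:
  assumes W: "\<And>n F. trig_curve n F \<Longrightarrow> trig_curve (n + N) (\<lambda>\<tau>. W \<tau> (F \<tau>))"
    and W': "\<And>n F. trig_curve n F \<Longrightarrow> trig_curve (n + N) (\<lambda>\<tau>. inv (W \<tau>) (F \<tau>))"
  shows "trig_curve (nat \<bar>k\<bar> * N) (\<lambda>\<tau>. op_powi (W \<tau>) k x)"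
proof -
  have pow: "trig_curve (n * N) (\<lambda>\<tau>. (W \<tau> ^^ n) x)"
    if "\<And>n F. trig_curve n F \<Longrightarrow> trig_curve (n + N) (\<lambda>\<tau>. W \<tau> (F \<tau>))"
    for n and W :: "real \<Rightarrow> 'a \<Rightarrow> 'a"
  proof (induction n)
    case (Suc n)
    from that[OF this] show ?case by (simp add: add.commute)
  qed (simp add: trig_curve_const)
  show ?thesis
    using pow[of W "nat k"] pow[of "\<lambda>\<tau>. inv (W \<tau>)" "nat (- k)"] W W'
    by (cases "k \<ge> 0") (simp_all add: op_powi_def)
qed

lemma unitary_seq_tendsto:
  assumes W: "\<And>n. unitary (W n)" and lim: "\<And>y. (\<lambda>n. W n y) \<longlonglongrightarrow> V y" and v: "v \<longlonglongrightarrow> l"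
  shows "(\<lambda>n. W n (v n)) \<longlonglongrightarrow> V l"
proof (rule LIM_zero_cancel, rule Lim_null_comparison)
  show "\<forall>\<^sub>F n in sequentially. norm (W n (v n) - V l) \<le> norm (v n - l) + norm (W n l - V l)"
  proof (intro always_eventually allI)
    fix n
    have "norm (W n (v n) - V l) \<le> norm (W n (v n) - W n l) + norm (W n l - V l)"
      using norm_triangle_ineq[of "W n (v n) - W n l" "W n l - V l"] by simp
    also have "W n (v n) - W n l = W n (v n - l)" by (simp add: clinear_on_diff[OF unitary_linear[OF W]])
    finally show "norm (W n (v n) - V l) \<le> norm (v n - l) + norm (W n l - V l)" by (simp add: unitary_norm[OF W])
  qed
  have "(\<lambda>n. norm (v n - l)) \<longlonglongrightarrow> 0" "(\<lambda>n. norm (W n l - V l)) \<longlonglongrightarrow> 0"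
    by (intro tendsto_norm_zero LIM_zero v lim)+
  from tendsto_add[OF this] show "(\<lambda>n. norm (v n - l) + norm (W n l - V l)) \<longlonglongrightarrow> 0" by simp
qed

text \<open>Strong convergence does not pass to inverses in general; here isometry rewrites the
  error as \<open>\<parallel>W n (inv V y) - y\<parallel>\<close>, and
  \<open>y = V (inv V y)\<close>.\<close>

lemma unitary_inv_tendsto:
  assumes W: "\<And>n. unitary (W n)" and V: "unitary V" and lim: "\<And>y. (\<lambda>n. W n y) \<longlonglongrightarrow> V y"
  shows "(\<lambda>n. inv (W n) y) \<longlonglongrightarrow> inv V y"
proof (rule LIM_zero_cancel, rule tendsto_norm_zero_cancel)
  have "norm (inv (W n) y - inv V y) = norm (W n (inv V y) - y)" for n
  proof -
    have "norm (inv (W n) y - inv V y) = norm (W n (inv (W n) y - inv V y))" by (simp add: unitary_norm[OF W])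
    then show ?thesis
      by (simp add: clinear_on_diff[OF unitary_linear[OF W]] unitary_inv_right[OF W] norm_minus_commute)
  qed
  moreover have "(\<lambda>n. norm (W n (inv V y) - y)) \<longlonglongrightarrow> 0"
    using tendsto_norm_zero[OF LIM_zero[OF lim[of "inv V y"]]] by (simp add: unitary_inv_right[OF V])
  ultimately show "(\<lambda>n. norm (inv (W n) y - inv V y)) \<longlonglongrightarrow> 0" by simp
qed

lemma op_powi_tendsto:
  assumes W: "\<And>n. unitary (W n)" and V: "unitary V" and lim: "\<And>y. (\<lambda>n. W n y) \<longlonglongrightarrow> V y"
  shows "(\<lambda>n. op_powi (W n) k x) \<longlonglongrightarrow> op_powi V k x"
proof -
  have pow: "(\<lambda>n. (W n ^^ j) x) \<longlonglongrightarrow> (V ^^ j) x"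
    if "\<And>n. unitary (W n)" "\<And>y. (\<lambda>n. W n y) \<longlonglongrightarrow> V y" for W V and j :: nat
    by (induction j) (use unitary_seq_tendsto[OF that] in auto)
  show ?thesis
    using pow[OF W lim] pow[OF unitary_inv[OF W] unitary_inv_tendsto[OF W V lim]]
    by (simp add: op_powi_def)
qed

text \<open>The representative of \<open>t\<close> modulo \<open>2 \<pi>\<close> in
  \<open>[-\<pi>, \<pi>)\<close>.\<close>

definition principal_arg :: "real \<Rightarrow> real"
  where "principal_arg t = t - 2 * pi * of_int \<lfloor>t / (2 * pi) + 1 / 2\<rfloor>"

lemma principal_arg_measurable [measurable]: "principal_arg \<in> borel_measurable borel"
  unfolding principal_arg_def by measurable

lemma cis_int_mult_principal_arg: "cis (of_int k * principal_arg t) = cis (of_int k * t)"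
proof -
  have "of_int k * principal_arg t = of_int k * t - 2 * pi * of_int (k * \<lfloor>t / (2 * pi) + 1 / 2\<rfloor>)"
    by (simp add: principal_arg_def algebra_simps)
  then show ?thesis by (simp only: cis_divide[symmetric]) (simp add: cis_multiple_2pi)
qed

lemma abs_principal_arg_le: "\<bar>principal_arg t\<bar> \<le> pi"
proof -
  define r where "r = t / (2 * pi) + 1 / 2"
  have "t = 2 * pi * r - pi" by (simp add: r_def field_simps)
  then have "principal_arg t = 2 * pi * (r - of_int \<lfloor>r\<rfloor>) - pi"
    unfolding principal_arg_def r_def[symmetric] by (simp add: algebra_simps)
  moreover have "0 \<le> 2 * pi * (r - of_int \<lfloor>r\<rfloor>)" by simp
  moreover have "2 * pi * (r - of_int \<lfloor>r\<rfloor>) \<le> 2 * pi * 1"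
  proof (rule mult_left_mono)
    show "r - of_int \<lfloor>r\<rfloor> \<le> 1" by linarith
  qed simp
  ultimately show ?thesis by linarith
qed

lemma abs_le_of_cmod_cis_le:
  assumes y: "\<bar>y\<bar> \<le> pi" and \<delta>: "0 \<le> \<delta>" "\<delta> \<le> 2" and le: "cmod (cis y - 1) \<le> \<delta>"
  shows "\<bar>y\<bar> \<le> 2 * arcsin (\<delta> / 2)"
proof (rule ccontr)
  assume "\<not> \<bar>y\<bar> \<le> 2 * arcsin (\<delta> / 2)"
  then have lt: "arcsin (\<delta> / 2) < \<bar>y\<bar> / 2" by simp
  have "sin (arcsin (\<delta> / 2)) < sin (\<bar>y\<bar> / 2)"
    by (rule sin_monotone_2pi[OF _ lt]) (use y arcsin_bounded[of "\<delta> / 2"] \<delta> in auto)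
  then have "\<delta> < 2 * sin (\<bar>y\<bar> / 2)" using \<delta> by simp
  moreover have "sin (\<bar>y\<bar> / 2) \<le> \<bar>sin (y / 2)\<bar>" by (cases "y \<ge> 0") auto
  ultimately show False using le unfolding cmod_cis_diff_1 by linarith
qed

lemma alternating_binomial_sum_norm_le:
  fixes v :: "nat \<Rightarrow> 'a::complex_inner"
  assumes "\<And>k. norm (v k) \<le> M"
  shows "norm (\<Sum>k=0..m. ((-1) ^ k * of_nat (m choose k)) *\<^sub>C v k) \<le> 2 ^ m * M"
proof -
  have "norm (\<Sum>k=0..m. ((-1) ^ k * of_nat (m choose k)) *\<^sub>C v k)
      \<le> (\<Sum>k=0..m. real (m choose k) * M)"
    by (rule order_trans[OF norm_sum], rule sum_mono)
      (auto simp: norm_scaleC norm_mult norm_power intro!: mult_left_mono assms)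
  also have "\<dots> = real (\<Sum>k\<le>m. m choose k) * M"
    by (simp add: sum_distrib_right atLeast0AtMost)
  also have "\<dots> = 2 ^ m * M" by (simp only: choose_row_sum) simp
  finally show ?thesis .
qed

context spectral_resolution
begin

lemma iterated_difference_le:
  assumes U: "unitary U" and a: "\<And>\<zeta>. cmod \<zeta> = 1 \<Longrightarrow> cmod (trig_poly d a \<zeta>) \<le> 1"
    and \<delta>: "\<And>x. norm (op cis x - x) \<le> \<delta> * norm x" "0 \<le> \<delta>" "\<delta> \<le> 2"
  shows "norm (\<Sum>k=0..m. ((-1) ^ k * of_nat (m choose k)) *\<^sub>C
      trig_poly_op d a (op (\<lambda>t. cis (real k * t)) \<circ> U) x) \<le> (real d * \<delta>) ^ m * norm x"
proof -
  \<comment> \<open>The angle subtending a chord of length \<open>\<delta>\<close> in the unit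
    circle.\<close>
  define \<sigma> where "\<sigma> = 2 * arcsin (\<delta> / 2)"
  have \<sigma>: "0 \<le> \<sigma>" "\<sigma> \<le> pi"
    using \<delta>(2,3) arcsin_bounded[of "\<delta> / 2"] arcsin_le_arcsin[of 0 "\<delta> / 2"] by (auto simp: \<sigma>_def)
  have sin\<sigma>: "2 * sin (\<sigma> / 2) = \<delta>" using \<delta>(2,3) by (simp add: \<sigma>_def)
  have uV: "unitary (op (\<lambda>t. cis (\<phi> t)))" "inv (op (\<lambda>t. cis (\<phi> t))) = op (\<lambda>t. cis (- \<phi> t))"
    if "\<phi> \<in> borel_measurable borel" for \<phi>
    using op_unitary[OF calculable_cis[OF that]] by (simp_all add: cis_cnj)
  show ?thesis
  proof (cases "real d * \<sigma> \<le> pi")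
    case False
    then have d0: "d > 0" using pi_gt_zero by (intro gr0I) simp
    \<comment> \<open>Chosen with \<open>sin (d y) = 1\<close>; since
      \<open>y \<le> \<sigma> / 2\<close>, this gives
      \<open>1 \<le> d sin y \<le> d sin (\<sigma> / 2) = d \<delta> / 2\<close>.\<close>
    define y where "y = pi / 2 / real d"
    have y: "0 \<le> y" "y \<le> \<sigma> / 2" "real d * y = pi / 2" using False d0 by (auto simp: y_def field_simps)
    have "1 \<le> real d * \<bar>sin y\<bar>" using abs_sin_nat_mult_le[of d y] unfolding y(3) by simp
    also have "\<bar>sin y\<bar> = sin y" using y \<sigma> by (intro abs_of_nonneg sin_ge_zero) auto
    also have "real d * sin y \<le> real d * sin (\<sigma> / 2)"
      using y \<sigma> by (intro mult_left_mono sin_monotone_2pi_le) auto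
    finally have "2 \<le> real d * \<delta>" unfolding sin\<sigma>[symmetric] by simp
    then have "2 ^ m * norm x \<le> (real d * \<delta>) ^ m * norm x"
      by (intro mult_right_mono power_mono) auto
    moreover have "unitary (op (\<lambda>t. cis (real k * t)) \<circ> U)" for k
      by (intro unitary_comp uV U) measurable
    then have "norm (trig_poly_op d a (op (\<lambda>t. cis (real k * t)) \<circ> U) x) \<le> norm x" for k
      by (rule unitary_von_neumann[OF _ a])
    then have "norm (\<Sum>k=0..m. ((-1) ^ k * of_nat (m choose k)) *\<^sub>C
        trig_poly_op d a (op (\<lambda>t. cis (real k * t)) \<circ> U) x) \<le> 2 ^ m * norm x"
      by (rule alternating_binomial_sum_norm_le)
    ultimately show ?thesis by linarith
  next
    case d\<sigma>: True
    \<comment> \<open>The symbol of the operator \<open>B\<close>: the principal logarithm of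
      \<open>cis\<close>, set to 0 where it exceeds \<open>\<sigma>\<close>, which happens only on
      the spectral null set \<open>N\<close>.\<close>
    define g where "g = (\<lambda>t. if \<bar>principal_arg t\<bar> \<le> \<sigma> then principal_arg t else 0)"
    have gm [measurable]: "g \<in> borel_measurable borel" unfolding g_def by measurable
    have gle: "\<bar>g t\<bar> \<le> \<sigma>" for t using \<sigma> by (simp add: g_def)
    define N where "N = {t. \<delta> < cmod (cis t - 1)}"
    have [measurable]: "cis \<in> borel_measurable borel" using borel_measurable_cis_mult[of 1] by simp
    have cc: "calculable cis" using calculable_cis[of "\<lambda>t. t"] by simp
    have Nb: "N \<in> sets borel" unfolding N_def by measurable
    have N0: "op (indicator N) y = 0" for y
      unfolding N_def
    proof (rule null_of_norm_le[where K = 2])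
      show "cmod (cis t - 1) \<le> 2" for t unfolding cmod_cis_diff_1 by simp
      show "norm (op (\<lambda>t. cis t - 1) z) \<le> \<delta> * norm z" for z
        using \<delta>(1)[of z] op_diff[OF cc calculable_const[of 1]] by (simp add: op_const)
    qed (use \<delta> in measurable)
    \<comment> \<open>Here \<open>k\<close> must be an integer: \<open>cis (k * t)\<close> then
      depends only on \<open>t\<close> modulo \<open>2 \<pi>\<close>.\<close>
    have Vg: "op (\<lambda>t. cis (real k * t)) y = op (\<lambda>t. cis (real k * g t)) y" for k y
    proof (rule op_cong_null[OF calculable_indicator[OF Nb] N0])
      fix t assume "t \<notin> N"
      then have "cmod (cis (principal_arg t) - 1) \<le> \<delta>"
        using cis_int_mult_principal_arg[of 1 t] by (simp add: N_def)
      then have "\<bar>principal_arg t\<bar> \<le> \<sigma>"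
        unfolding \<sigma>_def by (intro abs_le_of_cmod_cis_le abs_principal_arg_le \<delta>)
      then show "cis (real k * t) = cis (real k * g t)"
        using cis_int_mult_principal_arg[of "int k" t] by (simp add: g_def)
    qed (rule calculable_cis, measurable)+
    \<comment> \<open>Replacing \<open>g\<close> by multiples of \<open>\<sigma> / (n + 1)\<close> turns \<open>\<tau> \<mapsto> f (V \<tau> U) x\<close> into a trigonometric
      polynomial of degree \<open>d (n + 1)\<close>, evaluated at multiples of \<open>\<sigma> / (n + 1)\<close>; the product of
      degree and step is always \<open>d \<sigma>\<close>.\<close>
    define j where "j = (\<lambda>n t. \<lfloor>real (Suc n) * g t / \<sigma>\<rfloor>)"
    have jle: "\<bar>j n t\<bar> \<le> int (Suc n)" for n t
    proof -
      have "\<bar>real (Suc n) * g t / \<sigma>\<bar> \<le> real (Suc n)"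
      \<comment> \<open>For \<open>\<sigma> = 0\<close> division by zero makes the quotient 0,
        consistent with \<open>g = 0\<close>.\<close>
      proof (cases "\<sigma> = 0")
        case False
        then have "\<bar>g t\<bar> / \<sigma> \<le> 1" using gle[of t] \<sigma> by simp
        from mult_left_mono[OF this, of "real (Suc n)"] show ?thesis
          using \<sigma> by (simp add: abs_mult del: of_nat_Suc)
      qed simp
      then show ?thesis unfolding j_def by linarith
    qed
    define \<eta> where "\<eta> = (\<lambda>n. \<sigma> / real (Suc n))"
    have \<eta>0: "\<eta> n \<ge> 0" for n using \<sigma> by (simp add: \<eta>_def)
    have jg: "\<bar>\<eta> n * of_int (j n t) - g t\<bar> \<le> \<eta> n" for n t
    proof (cases "\<sigma> = 0")
      case True
      then show ?thesis using gle[of t] by (simp add: \<eta>_def)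
    next
      case False
      then have pos: "\<eta> n > 0" using \<sigma> by (simp add: \<eta>_def)
      have "\<bar>of_int (j n t) - real (Suc n) * g t / \<sigma>\<bar> \<le> 1" unfolding j_def by linarith
      from mult_left_mono[OF this \<eta>0[of n]]
      have "\<bar>\<eta> n * (of_int (j n t) - real (Suc n) * g t / \<sigma>)\<bar> \<le> \<eta> n"
        using pos by (simp only: abs_mult abs_of_pos mult_1_right)
      then have "\<bar>\<eta> n * of_int (j n t) - \<eta> n * (real (Suc n) * g t / \<sigma>)\<bar> \<le> \<eta> n"
        by (simp only: right_diff_distrib)
      moreover have "\<eta> n * (real (Suc n) * g t / \<sigma>) = g t" using False by (simp add: \<eta>_def del: of_nat_Suc)
      ultimately show ?thesis by simp
    qed
    have jm [measurable]: "(\<lambda>t. real_of_int (j n t)) \<in> borel_measurable borel" for n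
      unfolding j_def by measurable
    define V where "V = (\<lambda>n \<tau>. op (\<lambda>t. cis (\<tau> * of_int (j n t))))"
    have V: "unitary (V n \<tau>)" "inv (V n \<tau>) = V n (- \<tau>)" for n \<tau>
      unfolding V_def using uV[of "\<lambda>t. \<tau> * of_int (j n t)"] by auto
    define P where "P = (\<lambda>n i. op (indicator {t. j n t = i}))"
    have Pb: "{t. j n t = i} \<in> sets borel" for n i
    proof -
      have "{t. j n t = i} = {t. real_of_int (j n t) = of_int i}" by simp
      also have "\<dots> \<in> sets borel" by measurable
      finally show ?thesis .
    qed
    note cP = calculable_indicator[OF Pb]
    have PL: "clinear_on UNIV (P n i)" for n i unfolding P_def by (rule op_linear[OF cP])
    \<comment> \<open>\<open>j n\<close> takes finitely many integer values, so the operator splits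
      over the spectral projections \<open>P n i\<close> of its level sets.\<close>
    have V_sum: "V n \<tau> y = (\<Sum>i\<in>{- int (Suc n)..int (Suc n)}. cis (of_int i * \<tau>) *\<^sub>C P n i y)" for n \<tau> y
    proof -
      have "cis (\<tau> * of_int (j n t)) = (\<Sum>i\<in>{- int (Suc n)..int (Suc n)}. cis (of_int i * \<tau>) * indicator {t. j n t = i} t)" for t
      proof -
        have "(\<Sum>i\<in>{- int (Suc n)..int (Suc n)}. cis (of_int i * \<tau>) * indicator {t. j n t = i} t)
            = (\<Sum>i\<in>{- int (Suc n)..int (Suc n)}. if j n t = i then cis (of_int i * \<tau>) else 0)"
          by (intro sum.cong refl) (simp add: indicator_def)
        moreover have "j n t \<in> {- int (Suc n)..int (Suc n)}" using jle[of n t] by (simp add: abs_le_iff)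
        ultimately show ?thesis by (simp add: mult.commute del: of_nat_Suc)
      qed
      then have "V n \<tau> y = op (\<lambda>t. \<Sum>i\<in>{- int (Suc n)..int (Suc n)}. cis (of_int i * \<tau>) * indicator {t. j n t = i} t) y"
        by (simp only: V_def)
      also have "\<dots> = (\<Sum>i\<in>{- int (Suc n)..int (Suc n)}. op (\<lambda>t. cis (of_int i * \<tau>) * indicator {t. j n t = i} t) y)"
        by (rule op_sum) (intro calculable_mult calculable_const cP)
      also have "\<dots> = (\<Sum>i\<in>{- int (Suc n)..int (Suc n)}. cis (of_int i * \<tau>) *\<^sub>C P n i y)"
        unfolding P_def by (simp only: op_scale[OF cP])
      finally show ?thesis .
    qed
    have curveV: "trig_curve (r + Suc n) (\<lambda>\<tau>. V n \<tau> (F \<tau>))" "trig_curve (r + Suc n) (\<lambda>\<tau>. V n (- \<tau>) (F \<tau>))"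
      if F: "trig_curve r F" for r n and F :: "real \<Rightarrow> 'a"
    proof -
      show "trig_curve (r + Suc n) (\<lambda>\<tau>. V n \<tau> (F \<tau>))"
        unfolding V_sum by (rule trig_curve_mult[OF F _ PL]) (auto simp: abs_le_iff)
      have "trig_curve (r + Suc n) (\<lambda>\<tau>. \<Sum>i\<in>{- int (Suc n)..int (Suc n)}. cis (of_int (- i) * \<tau>) *\<^sub>C P n i (F \<tau>))"
        by (rule trig_curve_mult[OF F _ PL]) (auto simp: abs_le_iff)
      then show "trig_curve (r + Suc n) (\<lambda>\<tau>. V n (- \<tau>) (F \<tau>))" unfolding V_sum by simp
    qed
    have uVU: "unitary (V n \<tau> \<circ> U)" for n \<tau> by (intro unitary_comp V U)
    define G where "G = (\<lambda>n \<tau>. trig_poly_op d a (V n \<tau> \<circ> U) x)"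
    have "trig_curve (d * Suc n) (G n)" for n
      unfolding G_def trig_poly_op_def
    proof (intro trig_curve_sum trig_curve_scale)
      fix k assume "k \<in> {- int d..int d}"
      then have "nat \<bar>k\<bar> * Suc n \<le> d * Suc n" by (intro mult_right_mono) auto
      moreover have "trig_curve (nat \<bar>k\<bar> * Suc n) (\<lambda>\<tau>. op_powi (V n \<tau> \<circ> U) k x)"
      proof (rule trig_curve_op_powi)
        fix r and F :: "real \<Rightarrow> 'a" assume F: "trig_curve r F"
        show "trig_curve (r + Suc n) (\<lambda>\<tau>. (V n \<tau> \<circ> U) (F \<tau>))"
          using curveV(1)[OF trig_curve_linear[OF F unitary_linear[OF U]]] by simp
        have "inv (V n \<tau> \<circ> U) = inv U \<circ> V n (- \<tau>)" for \<tau>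
          using o_inv_distrib[OF unitary_bij[OF V(1)] unitary_bij[OF U]] V(2) by metis
        then show "trig_curve (r + Suc n) (\<lambda>\<tau>. inv (V n \<tau> \<circ> U) (F \<tau>))"
          using trig_curve_linear[OF curveV(2)[OF F] unitary_linear[OF unitary_inv[OF U]]] by simp
      qed
      ultimately show "trig_curve (d * Suc n) (\<lambda>\<tau>. op_powi (V n \<tau> \<circ> U) k x)" by (rule trig_curve_mono[rotated])
    qed
    moreover have "norm (G n \<tau>) \<le> norm x" for n \<tau>
      unfolding G_def by (rule unitary_von_neumann[OF uVU a])
    moreover have d\<eta>: "real (d * Suc n) * \<eta> n = real d * \<sigma>" for n
      unfolding of_nat_mult \<eta>_def by (simp del: of_nat_Suc)
    ultimately have bound: "norm (\<Sum>k=0..m. ((-1) ^ k * of_nat (m choose k)) *\<^sub>C G n (0 + real k * \<eta> n))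
        \<le> (2 * sin (real d * \<sigma> / 2)) ^ m * norm x" for n
      using trig_curve_iterated_difference_le[of "d * Suc n" "G n" "norm x" "\<eta> n" m 0] \<eta>0[of n] d\<sigma>
      by (simp only: d\<eta>)
    \<comment> \<open>The grid error in \<open>g\<close> is at most \<open>\<eta> n\<close>, and
      \<open>cis\<close> is 1-Lipschitz, so the operators differ in norm by at most
      \<open>k * \<eta> n\<close>.\<close>
    have conv: "(\<lambda>n. V n (real k * \<eta> n) y) \<longlonglongrightarrow> op (\<lambda>t. cis (real k * t)) y" for k y
    proof (rule LIM_zero_cancel, rule Lim_null_comparison[OF always_eventually], intro allI)
      have c1: "calculable (\<lambda>t. cis (real k * \<eta> n * of_int (j n t)))" for n by (rule calculable_cis) measurable
      have c2: "calculable (\<lambda>t. cis (real k * g t))" by (rule calculable_cis) measurable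
      show "norm (V n (real k * \<eta> n) y - op (\<lambda>t. cis (real k * t)) y) \<le> real k * \<eta> n * norm y" for n
        unfolding V_def Vg op_diff[OF c1 c2, symmetric]
      proof (rule op_norm_le[OF calculable_diff[OF c1 c2]])
        fix t
        have "cmod (cis (real k * \<eta> n * of_int (j n t)) - cis (real k * g t)) \<le> \<bar>real k * (\<eta> n * of_int (j n t) - g t)\<bar>"
          using cmod_cis_diff_le[of "real k * \<eta> n * of_int (j n t)" "real k * g t"] by (simp add: algebra_simps)
        also have "\<dots> \<le> real k * \<eta> n" unfolding abs_mult using jg[of n t] by (simp add: mult_left_mono)
        finally show "cmod (cis (real k * \<eta> n * of_int (j n t)) - cis (real k * g t)) \<le> real k * \<eta> n" .
      qed
      have "(\<lambda>n. real k * (\<sigma> * inverse (real (Suc n))) * norm y) \<longlonglongrightarrow> real k * (\<sigma> * 0) * norm y"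
        by (intro tendsto_mult tendsto_const LIMSEQ_inverse_real_of_nat)
      then show "(\<lambda>n. real k * \<eta> n * norm y) \<longlonglongrightarrow> 0" by (simp add: \<eta>_def divide_inverse del: of_nat_Suc)
    qed
    have "(\<lambda>n. G n (real k * \<eta> n)) \<longlonglongrightarrow> trig_poly_op d a (op (\<lambda>t. cis (real k * t)) \<circ> U) x" for k
      unfolding G_def trig_poly_op_def
    proof (intro tendsto_sum scaleC.tendsto tendsto_const op_powi_tendsto uVU)
      show "unitary (op (\<lambda>t. cis (real k * t)) \<circ> U)" by (intro unitary_comp uV U) measurable
      show "(\<lambda>n. (V n (real k * \<eta> n) \<circ> U) y) \<longlonglongrightarrow> (op (\<lambda>t. cis (real k * t)) \<circ> U) y" for y
        using conv by simp
    qed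
    then have "(\<lambda>n. norm (\<Sum>k=0..m. ((-1) ^ k * of_nat (m choose k)) *\<^sub>C G n (0 + real k * \<eta> n)))
        \<longlonglongrightarrow> norm (\<Sum>k=0..m. ((-1) ^ k * of_nat (m choose k)) *\<^sub>C
          trig_poly_op d a (op (\<lambda>t. cis (real k * t)) \<circ> U) x)"
      by (intro tendsto_norm tendsto_sum scaleC.tendsto tendsto_const) simp
    from LIMSEQ_le_const2[OF this] bound
    have "norm (\<Sum>k=0..m. ((-1) ^ k * of_nat (m choose k)) *\<^sub>C
        trig_poly_op d a (op (\<lambda>t. cis (real k * t)) \<circ> U) x) \<le> (2 * sin (real d * \<sigma> / 2)) ^ m * norm x"
      by blast
    also have "\<dots> \<le> (real d * \<delta>) ^ m * norm x"
    proof (intro mult_right_mono power_mono)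
      have "sin (real d * (\<sigma> / 2)) \<le> real d * \<bar>sin (\<sigma> / 2)\<bar>" using abs_sin_nat_mult_le[of d "\<sigma> / 2"] by linarith
      also have "\<bar>sin (\<sigma> / 2)\<bar> = sin (\<sigma> / 2)" using \<sigma> by (intro abs_of_nonneg sin_ge_zero) auto
      finally show "2 * sin (real d * \<sigma> / 2) \<le> real d * \<delta>" unfolding sin\<sigma>[symmetric] by (simp add: mult_ac)
      show "0 \<le> 2 * sin (real d * \<sigma> / 2)" using d\<sigma> \<sigma> by (intro mult_nonneg_nonneg sin_ge_zero) auto
    qed simp
    finally show ?thesis .
  qed
qed

end

lemma opnorm_leI:
  assumes "\<And>x. x \<in> D \<Longrightarrow> norm (T x) \<le> c * norm x" "0 \<le> c"
  shows "opnorm D T \<le> ennreal c"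
  unfolding opnorm_def
proof (rule SUP_least)
  fix x assume x: "x \<in> {x \<in> D. norm x \<le> 1}"
  then have "norm (T x) \<le> c * 1" using assms by (blast intro: order_trans mult_left_mono)
  then show "ennreal (norm (T x)) \<le> ennreal c" by (simp add: ennreal_leI)
qed

lemma opnorm_norm_le:
  assumes T: "clinear_on D T" and c: "opnorm D T = ennreal c" "0 \<le> c" and x: "x \<in> D"
  shows "norm (T x) \<le> c * norm x"
proof (cases "x = 0")
  case True
  then show ?thesis by (simp add: clinear_on_zero[OF T])
next
  case False
  define r where "r = 1 / norm x"
  have r: "r > 0" using False by (simp add: r_def)
  have "r *\<^sub>R x \<in> {x \<in> D. norm x \<le> 1}"
    using False x by (auto simp: r_def scaleR_scaleC clinear_on_mem_scaleC[OF T] norm_scaleC norm_divide)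
  then have "ennreal (norm (T (r *\<^sub>R x))) \<le> opnorm D T" unfolding opnorm_def by (rule SUP_upper)
  then have "norm (T (r *\<^sub>R x)) \<le> c" using c by (simp add: ennreal_le_iff)
  moreover have "norm (T (r *\<^sub>R x)) = r * norm (T x)"
    using r by (simp add: scaleR_scaleC clinear_on_scaleC[OF T x] norm_scaleC)
  ultimately have "r * norm (T x) \<le> c" by simp
  then show ?thesis using False by (simp add: r_def field_simps)
qed

theorem theorem5p17:
  fixes D :: "'a::chilbert_space set"
    and A U :: "'a \<Rightarrow> 'a"
    and a :: "int \<Rightarrow> complex"
    and d m :: nat
  assumes "self_adjoint D A"
    and "unitary U"
    and "m \<ge> 1"
    and "\<And>\<zeta>. cmod \<zeta> = 1 \<Longrightarrow> cmod (trig_poly d a \<zeta>) \<le> 1"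
  shows "opnorm UNIV (\<lambda>x. \<Sum>k=0..m. ((-1) ^ k * of_nat (m choose k)) *\<^sub>C
             trig_poly_op d a (exp_i (real k) D A \<circ> U) x)
           \<le> of_nat d ^ m * opnorm UNIV (\<lambda>x. exp_i 1 D A x - x) ^ m
       \<and> of_nat d ^ m * opnorm UNIV (\<lambda>x. exp_i 1 D A x - x) ^ m
           \<le> of_nat d ^ m * opnorm D A ^ m"
proof -
  define E where "E = spectral_measure D A"
  have E: "projection_valued_measure E \<and> is_spectral_integral E complex_of_real D A"
    unfolding E_def spectral_measure_def by (rule someI_ex[OF spectral_theorem[OF assms(1)]])
  interpret spectral_resolution E by standard (use E in blast)
  have exp_i: "exp_i s D A = op (\<lambda>t. cis (s * t))" for s
    unfolding exp_i_def bounded_borel_calculus_def E_def[symmetric] cis_conv_exp[symmetric]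
    by (rule the_spectral_integral[where K = 1]) auto
  have cc: "calculable cis" using calculable_cis[of "\<lambda>t. t"] by simp
  have c1: "calculable (\<lambda>t. cis t - 1)" by (intro calculable_diff calculable_const cc)
  have V1: "(\<lambda>x. exp_i 1 D A x - x) = op (\<lambda>t. cis t - 1)"
    using op_diff[OF cc calculable_const[of 1]] by (simp add: exp_i op_const fun_eq_iff)
  \<comment> \<open>This a priori bound makes the extended norm a real number
    \<open>\<delta>\<close> with \<open>\<delta> / 2\<close> in the domain of
    \<open>arcsin\<close>.\<close>
  have "opnorm UNIV (op (\<lambda>t. cis t - 1)) \<le> ennreal 2"
    by (intro opnorm_leI op_norm_le[OF c1]) (auto simp: cmod_cis_diff_1)
  then obtain \<delta> where \<delta>: "opnorm UNIV (op (\<lambda>t. cis t - 1)) = ennreal \<delta>" "0 \<le> \<delta>" "\<delta> \<le> 2"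
    by (cases "opnorm UNIV (op (\<lambda>t. cis t - 1))") (auto simp: ennreal_le_iff[of 2, simplified] top_unique)
  have \<delta>_le: "norm (op cis x - x) \<le> \<delta> * norm x" for x
    using opnorm_norm_le[OF op_linear[OF c1] \<delta>(1,2), of x] op_diff[OF cc calculable_const[of 1]]
    by (simp add: op_const)
  have "opnorm UNIV (\<lambda>x. \<Sum>k=0..m. ((-1) ^ k * of_nat (m choose k)) *\<^sub>C
      trig_poly_op d a (exp_i (real k) D A \<circ> U) x) \<le> ennreal ((real d * \<delta>) ^ m)"
    unfolding exp_i
    by (intro opnorm_leI iterated_difference_le[OF assms(2,4) \<delta>_le \<delta>(2,3)]) (use \<delta>(2) in auto)
  also have "\<dots> = of_nat d ^ m * opnorm UNIV (\<lambda>x. exp_i 1 D A x - x) ^ m"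
    unfolding V1 \<delta>(1) using \<delta>(2)
    by (simp add: power_mult_distrib ennreal_mult ennreal_power ennreal_of_nat_eq_real_of_nat)
  finally have *: "opnorm UNIV (\<lambda>x. \<Sum>k=0..m. ((-1) ^ k * of_nat (m choose k)) *\<^sub>C
      trig_poly_op d a (exp_i (real k) D A \<circ> U) x)
      \<le> of_nat d ^ m * opnorm UNIV (\<lambda>x. exp_i 1 D A x - x) ^ m" .
  have "opnorm UNIV (op (\<lambda>t. cis t - 1)) \<le> opnorm D A"
  proof (cases "opnorm D A")
    case (real M)
    have "norm (A x) \<le> M * norm x" if "x \<in> D" for x
      by (rule opnorm_norm_le[OF self_adjoint_linear[OF assms(1)] real(2,1) that])
    then have null: "op (indicator {t. M < \<bar>t\<bar>}) x = 0" for x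
      using null_of_operator_bound E real(1) by blast
    have m: "{t. M < \<bar>t\<bar>} \<in> sets borel" "{t. \<bar>t\<bar> \<le> M} \<in> sets borel" by measurable
    \<comment> \<open>Cutting off outside \<open>[-M, M]\<close> changes nothing spectrally, and on
      that interval \<open>|e^(it) - 1| \<le> |t| \<le> M\<close>.\<close>
    let ?f = "\<lambda>t. (cis t - 1) * indicator {t. \<bar>t\<bar> \<le> M} t"
    have c2: "calculable ?f" by (intro calculable_mult c1 calculable_indicator m)
    have "norm (op (\<lambda>t. cis t - 1) x) \<le> M * norm x" for x
    proof -
      have "op (\<lambda>t. cis t - 1) x = op ?f x"
        by (rule op_cong_null[OF calculable_indicator[OF m(1)] null c1 c2]) (auto simp: indicator_def)
      moreover have "cmod (?f t) \<le> M" for t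
        using cmod_cis_diff_1_le[of t] real(1) by (auto simp: indicator_def)
      ultimately show ?thesis using op_norm_le[OF c2] by simp
    qed
    then show ?thesis unfolding real(2) using real(1) by (intro opnorm_leI)
  qed simp
  then have "of_nat d ^ m * opnorm UNIV (\<lambda>x. exp_i 1 D A x - x) ^ m \<le> of_nat d ^ m * opnorm D A ^ m"
    unfolding V1 by (intro mult_left_mono power_mono) auto
  with * show ?thesis by blast
qed

end
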